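(* Let $T\in C^{\ast}_{\mathcal{E}}(\mathcal{D})$ be a normal operator. Then the map $\Phi:C(\sigma_{loc}(T))\to\mathcal{A}[T]$ defined by $$\Phi(f)=f(T)=\varprojlim_{\alpha\in\Lambda}\Gamma_\alpha^{-1}(f_\alpha)$$ is a coherent local contractive (isometric) $\ast$-homomorphism. Moreover: (1) If $\mathcal{P}(z,\bar z)$ is a polynomial of two variables, then $\mathcal{P}(T)=\varprojlim_{\alpha\in\Lambda}\mathcal{P}(T_\alpha,T_\alpha^{\ast})$, where $\mathcal{P}(T)$ denotes $\Phi$ applied to the function $z\mapsto\mathcal{P}(z,\bar z)$. In particular, if $f(z)=z$ is the identity function in $C(\sigma_{loc}(T))$, then $f(T)=T$. (2) $T$ is self-adjoint if and only if $\sigma_{loc}(T)\subseteq\mathbb{R}$. (3) $T$ is unitary if and only if $\sigma_{loc}(T)\subseteq\partial\mathbb{D}$, where $\mathbb{D}=\{z\in\mathbb{C}:|z|<1\}$.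
   Context: Let $(\Lambda,\le)$ be a directed partially ordered set and $\mathcal{E}=\{\mathcal{H}_\alpha\}_{\alpha\in\Lambda}$ a family of nonzero closed subspaces of a complex Hilbert space $\mathcal{H}$ with $\mathcal{H}_\alpha\subseteq\mathcal{H}_\beta$ for $\alpha\le\beta$, such that $\mathcal{D}=\bigcup_\alpha\mathcal{H}_\alpha$ is dense in $\mathcal{H}$. Let $P_\alpha$ be the orthogonal projection of $\mathcal{H}$ onto $\mathcal{H}_\alpha$. $C^{\ast}_{\mathcal{E}}(\mathcal{D})$ is the unital $\ast$-algebra of all linear $T:\mathcal{D}\to\mathcal{D}$ such that for every $\alpha$, $P_\alpha Tx=TP_\alpha x$ for all $x\in\mathcal{D}$ and $T_\alpha:=T|_{\mathcal{H}_\alpha}\in\mathcal{B}(\mathcal{H}_\alpha)$; the involution is determined by $T^{\ast}|_{\mathcal{H}_\alpha}=T_\alpha^{\ast}$. $T$ is normal if $TT^{\ast}=T^{\ast}T$, self-adjoint if $T=T^{\ast}$, unitary if $TT^{\ast}=T^{\ast}T=I_{\mathcal{D}}$. For a family $R_\alpha\in\mathcal{B}(\mathcal{H}_\alpha)$ such that, for $\alpha\le\beta$, $\mathcal{H}_\alpha$ reduces $R_\beta$ and $R_\beta|_{\mathcal{H}_\alpha}=R_\alpha$, $\varprojlim_\alpha R_\alpha$ denotes the unique $R\in C^{\ast}_{\mathcal{E}}(\mathcal{D})$ with $R|_{\mathcal{H}_\alpha}=R_\alpha$ for all $\alpha$. The local spectrum $\sigma_{loc}(T)$ is the set of $\lambda\in\mathbb{C}$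 such that $\lambda I_{\mathcal{D}}-T$ is not invertible in $C^{\ast}_{\mathcal{E}}(\mathcal{D})$; it equals $\bigcup_\alpha\sigma(T_\alpha)$, with $\sigma(T_\alpha)\subseteq\sigma(T_\beta)$ for $\alpha\le\beta$. It is equipped with the inductive limit topology: $S\subseteq\sigma_{loc}(T)$ is open iff $S\cap\sigma(T_\alpha)$ is open in $\sigma(T_\alpha)$ for every $\alpha$. $C(\sigma_{loc}(T))$ is the $\ast$-algebra of continuous complex functions for this topology, with seminorms $f\mapsto\|f_\alpha\|_\infty$, $f_\alpha:=f|_{\sigma(T_\alpha)}$; it is the projective limit of the $C(\sigma(T_\alpha))$ with maps $\zeta_\alpha(f)=f_\alpha$. $C^{\ast}\{I_{\mathcal{H}_\alpha},T_\alpha,T_\alpha^{\ast}\}$ is the unital $C^{\ast}$-algebra generated by the normal operator $T_\alpha$, and $\Gamma_\alpha:C^{\ast}\{I_{\mathcal{H}_\alpha},T_\alpha,T_\alpha^{\ast}\}\to C(\sigma(T_\alpha))$ is its Gelfand isomorphism, $\Gamma_\alpha(p(T_\alpha,T_\alpha^{\ast}))(\lambda)=p(\lambda,\bar\lambda)$ for polynomials $p$; so $\Gamma_\alpha^{-1}(g)=g(T_\alpha)$ is the usual continuous functional calculus. $\mathcal{A}[T]=\{R\in C^{\ast}_{\mathcal{E}}(\mathcal{D}):R|_{\mathcal{H}_\alpha}\in C^{\ast}\{I_{\mathcal{H}_\alpha},T_\alpha,T_\alpha^{\ast}\}\ \forall\alpha\}$ with the seminorms $s_\alpha(R)=\|R|_{\mathcal{H}_\alpha}\|$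 and the maps $\phi_\alpha:\mathcal{A}[T]\to C^{\ast}\{I_{\mathcal{H}_\alpha},T_\alpha,T_\alpha^{\ast}\}$, $\phi_\alpha(R)=R|_{\mathcal{H}_\alpha}$. For $f\in C(\sigma_{loc}(T))$ and $\alpha\le\beta$, the subspace $\mathcal{H}_\alpha$ reduces $\Gamma_\beta^{-1}(f_\beta)$ and $\Gamma_\beta^{-1}(f_\beta)|_{\mathcal{H}_\alpha}=\Gamma_\alpha^{-1}(f_\alpha)$, so $f(T):=\varprojlim_\alpha\Gamma_\alpha^{-1}(f_\alpha)$ is defined (the continuous functional calculus of $f$ at $T$). "Coherent" means there is a net of linear maps $\Phi_\alpha:C(\sigma(T_\alpha))\to C^{\ast}\{I_{\mathcal{H}_\alpha},T_\alpha,T_\alpha^{\ast}\}$ with $\phi_\alpha\circ\Phi=\Phi_\alpha\circ\zeta_\alpha$ for all $\alpha$. "Local contractive (isometric)" means $s_\alpha(\Phi(f))\le\|f_\alpha\|_\infty$ (respectively $s_\alpha(\Phi(f))=\|f_\alpha\|_\infty$) for all $f$ and $\alpha$; the isometric version is asserted. *)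

theory Defs
  imports "HOL-Analysis.Analysis" "HOL-Computational_Algebra.Polynomial"
begin

section \<open>Complex Hilbert spaces\<close>

text \<open>The inner product is linear in its first argument.\<close>

class complex_hilbert_space = banach +
  fixes scaleC :: "complex \<Rightarrow> 'a \<Rightarrow> 'a" (infixr "*\<^sub>C" 75)
    and cinner :: "'a \<Rightarrow> 'a \<Rightarrow> complex"
  assumes scaleC_add_right: "c *\<^sub>C (x + y) = c *\<^sub>C x + c *\<^sub>C y"
    and scaleC_add_left: "(c + d) *\<^sub>C x = c *\<^sub>C x + d *\<^sub>C x"
    and scaleC_scaleC: "c *\<^sub>C d *\<^sub>C x = (c * d) *\<^sub>C x"
    and scaleC_one: "1 *\<^sub>C x = x"
    and scaleR_scaleC: "r *\<^sub>R x = complex_of_real r *\<^sub>C x"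
    and cinner_commute: "cinner x y = cnj (cinner y x)"
    and cinner_add_left: "cinner (x + y) z = cinner x z + cinner y z"
    and cinner_scaleC_left: "cinner (c *\<^sub>C x) y = c * cinner x y"
    and cinner_ge_zero: "0 \<le> Re (cinner x x)"
    and cinner_eq_zero_iff: "cinner x x = 0 \<longleftrightarrow> x = 0"
    and norm_eq_sqrt_cinner: "norm x = sqrt (Re (cinner x x))"

definition csubspace :: "'a::complex_hilbert_space set \<Rightarrow> bool" where
  "csubspace M \<longleftrightarrow> 0 \<in> M \<and> (\<forall>x\<in>M. \<forall>y\<in>M. x + y \<in> M) \<and> (\<forall>c. \<forall>x\<in>M. c *\<^sub>C x \<in> M)"

definition orth_proj :: "'a::complex_hilbert_space set \<Rightarrow> 'a \<Rightarrow> 'a" where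
  "orth_proj M x = (THE y. y \<in> M \<and> (\<forall>z\<in>M. cinner (x - y) z = 0))"

section \<open>Algebras of operators on a subspace\<close>

text \<open>
  An operator on a subspace \<open>V\<close> is an element of \<open>V \<rightarrow>\<^sub>E V\<close>, so that operators on \<open>V\<close> are equal as
  soon as they agree on \<open>V\<close>; the restriction of an operator to \<open>M\<close> is \<open>restrict T M\<close>, and the
  product of \<open>A\<close> and \<open>B\<close> is \<open>compose V A B\<close>. Complex functions on a set \<open>K\<close> are likewise elements
  of \<open>extensional K\<close>.
\<close>

definition op_id :: "'a set \<Rightarrow> 'a \<Rightarrow> 'a" where
  "op_id V = (\<lambda>x\<in>V. x)"

definition op_add :: "'a::complex_hilbert_space set \<Rightarrow> ('a \<Rightarrow> 'a) \<Rightarrow> ('a \<Rightarrow> 'a) \<Rightarrow> 'a \<Rightarrow> 'a" where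
  "op_add V A B = (\<lambda>x\<in>V. A x + B x)"

definition op_diff :: "'a::complex_hilbert_space set \<Rightarrow> ('a \<Rightarrow> 'a) \<Rightarrow> ('a \<Rightarrow> 'a) \<Rightarrow> 'a \<Rightarrow> 'a" where
  "op_diff V A B = (\<lambda>x\<in>V. A x - B x)"

definition op_scale :: "'a::complex_hilbert_space set \<Rightarrow> complex \<Rightarrow> ('a \<Rightarrow> 'a) \<Rightarrow> 'a \<Rightarrow> 'a" where
  "op_scale V c A = (\<lambda>x\<in>V. c *\<^sub>C A x)"

definition clinear_on :: "'a::complex_hilbert_space set \<Rightarrow> ('a \<Rightarrow> 'a) \<Rightarrow> bool" where
  "clinear_on V A \<longleftrightarrow>
     (\<forall>x\<in>V. \<forall>y\<in>V. A (x + y) = A x + A y) \<and> (\<forall>c. \<forall>x\<in>V. A (c *\<^sub>C x) = c *\<^sub>C A x)"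

definition bounded_ops :: "'a::complex_hilbert_space set \<Rightarrow> ('a \<Rightarrow> 'a) set" where
  "bounded_ops M = {A \<in> M \<rightarrow>\<^sub>E M. clinear_on M A \<and> (\<exists>K. \<forall>x\<in>M. norm (A x) \<le> K * norm x)}"

definition op_norm :: "'a::complex_hilbert_space set \<Rightarrow> ('a \<Rightarrow> 'a) \<Rightarrow> real" where
  "op_norm M A = (SUP x\<in>{x \<in> M. norm x \<le> 1}. norm (A x))"

definition adj_on :: "'a::complex_hilbert_space set \<Rightarrow> ('a \<Rightarrow> 'a) \<Rightarrow> 'a \<Rightarrow> 'a" where
  "adj_on M A = (THE B. B \<in> bounded_ops M \<and> (\<forall>x\<in>M. \<forall>y\<in>M. cinner (A x) y = cinner x (B y)))"

text \<open>\<open>\<A>\<close> below is an algebra of operators on \<open>V\<close> with unit \<open>op_id V\<close>.\<close>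

definition invertible_in :: "'a set \<Rightarrow> ('a \<Rightarrow> 'a) set \<Rightarrow> ('a \<Rightarrow> 'a) \<Rightarrow> bool" where
  "invertible_in V \<A> R \<longleftrightarrow> (\<exists>S\<in>\<A>. compose V S R = op_id V \<and> compose V R S = op_id V)"

definition spectrum_in ::
    "'a::complex_hilbert_space set \<Rightarrow> ('a \<Rightarrow> 'a) set \<Rightarrow> ('a \<Rightarrow> 'a) \<Rightarrow> complex set" where
  "spectrum_in V \<A> R =
     {z. \<not> invertible_in V \<A> (op_diff V (op_scale V z (op_id V)) R)}"

definition op_spectrum :: "'a::complex_hilbert_space set \<Rightarrow> ('a \<Rightarrow> 'a) \<Rightarrow> complex set" where
  "op_spectrum M A = spectrum_in M (bounded_ops M) A"

section \<open>Generated C*-algebras and the Gelfand isomorphism\<close>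

definition cstar_subalgebra :: "'a::complex_hilbert_space set \<Rightarrow> ('a \<Rightarrow> 'a) set \<Rightarrow> bool" where
  "cstar_subalgebra M \<A> \<longleftrightarrow>
     \<A> \<subseteq> bounded_ops M \<and>
     (\<forall>A\<in>\<A>. \<forall>B\<in>\<A>. op_add M A B \<in> \<A>) \<and>
     (\<forall>c. \<forall>A\<in>\<A>. op_scale M c A \<in> \<A>) \<and>
     (\<forall>A\<in>\<A>. \<forall>B\<in>\<A>. compose M A B \<in> \<A>) \<and>
     (\<forall>A\<in>\<A>. adj_on M A \<in> \<A>) \<and>
     (\<forall>R A. (\<forall>n. R n \<in> \<A>) \<and> A \<in> bounded_ops M \<and>
        (\<lambda>n::nat. op_norm M (op_diff M (R n) A)) \<longlonglongrightarrow> 0 \<longrightarrow> A \<in> \<A>)"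

definition cstar_gen :: "'a::complex_hilbert_space set \<Rightarrow> ('a \<Rightarrow> 'a) \<Rightarrow> ('a \<Rightarrow> 'a) set" where
  "cstar_gen M A = \<Inter>{\<A>. cstar_subalgebra M \<A> \<and> {op_id M, A, adj_on M A} \<subseteq> \<A>}"

definition characters ::
    "'a::complex_hilbert_space set \<Rightarrow> ('a \<Rightarrow> 'a) set \<Rightarrow> (('a \<Rightarrow> 'a) \<Rightarrow> complex) set" where
  "characters M \<A> = {h \<in> extensional \<A>.
     (\<forall>A\<in>\<A>. \<forall>B\<in>\<A>. h (op_add M A B) = h A + h B) \<and>
     (\<forall>c. \<forall>A\<in>\<A>. h (op_scale M c A) = c * h A) \<and>
     (\<forall>A\<in>\<A>. \<forall>B\<in>\<A>. h (compose M A B) = h A * h B) \<and>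
     (\<exists>A\<in>\<A>. h A \<noteq> 0)}"

text \<open>
  For normal \<open>A\<close> the map \<open>h \<mapsto> h A\<close> identifies the character space of \<open>cstar_gen M A\<close> with the
  spectrum of \<open>A\<close>; under this identification the Gelfand transform is a map into functions on the
  spectrum.
\<close>

definition gelfand ::
    "'a::complex_hilbert_space set \<Rightarrow> ('a \<Rightarrow> 'a) \<Rightarrow> ('a \<Rightarrow> 'a) \<Rightarrow> complex \<Rightarrow> complex" where
  "gelfand M A R =
     (\<lambda>z\<in>op_spectrum M A. (THE h. h \<in> characters M (cstar_gen M A) \<and> h A = z) R)"

definition gelfand_inv ::
    "'a::complex_hilbert_space set \<Rightarrow> ('a \<Rightarrow> 'a) \<Rightarrow> (complex \<Rightarrow> complex) \<Rightarrow> 'a \<Rightarrow> 'a" where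
  "gelfand_inv M A = inv_into (cstar_gen M A) (gelfand M A)"

section \<open>The *-algebra of a quantized domain\<close>

locale quantized_domain =
  fixes Hs :: "'i::order \<Rightarrow> 'a::complex_hilbert_space set"
  assumes directed: "\<exists>\<gamma>. \<alpha> \<le> \<gamma> \<and> \<beta> \<le> \<gamma>"
    and Hs_csubspace: "csubspace (Hs \<alpha>)"
    and Hs_closed: "closed (Hs \<alpha>)"
    and Hs_nonzero: "Hs \<alpha> \<noteq> {0}"
    and Hs_mono: "\<alpha> \<le> \<beta> \<Longrightarrow> Hs \<alpha> \<subseteq> Hs \<beta>"
    and Hs_dense: "closure (\<Union>\<alpha>. Hs \<alpha>) = UNIV"

definition dom_E :: "('i \<Rightarrow> 'a set) \<Rightarrow> 'a set" where
  "dom_E Hs = (\<Union>\<alpha>. Hs \<alpha>)"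

definition cstar_E :: "('i \<Rightarrow> 'a::complex_hilbert_space set) \<Rightarrow> ('a \<Rightarrow> 'a) set" where
  "cstar_E Hs = {T \<in> dom_E Hs \<rightarrow>\<^sub>E dom_E Hs. clinear_on (dom_E Hs) T \<and>
     (\<forall>\<alpha>. (\<forall>x\<in>dom_E Hs. orth_proj (Hs \<alpha>) (T x) = T (orth_proj (Hs \<alpha>) x)) \<and>
          restrict T (Hs \<alpha>) \<in> bounded_ops (Hs \<alpha>))}"

text \<open>
  The projective limit is meaningful for families \<open>R\<close> that are compatible with restriction;
  otherwise the description does not denote.
\<close>

definition proj_lim ::
    "('i \<Rightarrow> 'a::complex_hilbert_space set) \<Rightarrow> ('i \<Rightarrow> 'a \<Rightarrow> 'a) \<Rightarrow> 'a \<Rightarrow> 'a" where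
  "proj_lim Hs R = (THE S. S \<in> cstar_E Hs \<and> (\<forall>\<alpha>. restrict S (Hs \<alpha>) = R \<alpha>))"

definition star_E ::
    "('i \<Rightarrow> 'a::complex_hilbert_space set) \<Rightarrow> ('a \<Rightarrow> 'a) \<Rightarrow> 'a \<Rightarrow> 'a" where
  "star_E Hs T = proj_lim Hs (\<lambda>\<alpha>. adj_on (Hs \<alpha>) (restrict T (Hs \<alpha>)))"

definition normal_E :: "('i \<Rightarrow> 'a::complex_hilbert_space set) \<Rightarrow> ('a \<Rightarrow> 'a) \<Rightarrow> bool" where
  "normal_E Hs T \<longleftrightarrow>
     compose (dom_E Hs) T (star_E Hs T) = compose (dom_E Hs) (star_E Hs T) T"

definition selfadjoint_E :: "('i \<Rightarrow> 'a::complex_hilbert_space set) \<Rightarrow> ('a \<Rightarrow> 'a) \<Rightarrow> bool" where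
  "selfadjoint_E Hs T \<longleftrightarrow> T = star_E Hs T"

definition unitary_E :: "('i \<Rightarrow> 'a::complex_hilbert_space set) \<Rightarrow> ('a \<Rightarrow> 'a) \<Rightarrow> bool" where
  "unitary_E Hs T \<longleftrightarrow>
     compose (dom_E Hs) T (star_E Hs T) = op_id (dom_E Hs) \<and>
     compose (dom_E Hs) (star_E Hs T) T = op_id (dom_E Hs)"

section \<open>The local spectrum and its continuous functions\<close>

definition spec_at ::
    "('i \<Rightarrow> 'a::complex_hilbert_space set) \<Rightarrow> ('a \<Rightarrow> 'a) \<Rightarrow> 'i \<Rightarrow> complex set" where
  "spec_at Hs T \<alpha> = op_spectrum (Hs \<alpha>) (restrict T (Hs \<alpha>))"

definition loc_spectrum ::
    "('i \<Rightarrow> 'a::complex_hilbert_space set) \<Rightarrow> ('a \<Rightarrow> 'a) \<Rightarrow> complex set" where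
  "loc_spectrum Hs T = spectrum_in (dom_E Hs) (cstar_E Hs) T"

definition loc_spectrum_topology ::
    "('i \<Rightarrow> 'a::complex_hilbert_space set) \<Rightarrow> ('a \<Rightarrow> 'a) \<Rightarrow> complex topology" where
  "loc_spectrum_topology Hs T = topology (\<lambda>S. S \<subseteq> loc_spectrum Hs T \<and>
     (\<forall>\<alpha>. openin (top_of_set (spec_at Hs T \<alpha>)) (S \<inter> spec_at Hs T \<alpha>)))"

lemma openin_loc_spectrum_topology:
  "openin (loc_spectrum_topology Hs T) S \<longleftrightarrow> S \<subseteq> loc_spectrum Hs T \<and>
     (\<forall>\<alpha>. openin (top_of_set (spec_at Hs T \<alpha>)) (S \<inter> spec_at Hs T \<alpha>))"
proof -
  let ?P = "\<lambda>S. S \<subseteq> loc_spectrum Hs T \<and>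
     (\<forall>\<alpha>. openin (top_of_set (spec_at Hs T \<alpha>)) (S \<inter> spec_at Hs T \<alpha>))"
  have "istopology ?P"
    unfolding istopology_def
  proof (intro conjI allI impI)
    fix S S' assume S: "?P S" and S': "?P S'"
    show "S \<inter> S' \<subseteq> loc_spectrum Hs T" using S by blast
    fix \<alpha>
    have "S \<inter> S' \<inter> spec_at Hs T \<alpha> = (S \<inter> spec_at Hs T \<alpha>) \<inter> (S' \<inter> spec_at Hs T \<alpha>)" by blast
    then show "openin (top_of_set (spec_at Hs T \<alpha>)) (S \<inter> S' \<inter> spec_at Hs T \<alpha>)"
      using S S' by (metis openin_Int)
  next
    fix \<K> assume \<K>: "\<forall>K\<in>\<K>. ?P K"
    show "\<Union>\<K> \<subseteq> loc_spectrum Hs T" using \<K> by blast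
    fix \<alpha>
    have "\<Union>\<K> \<inter> spec_at Hs T \<alpha> = (\<Union>K\<in>\<K>. K \<inter> spec_at Hs T \<alpha>)" by blast
    moreover have "openin (top_of_set (spec_at Hs T \<alpha>)) (\<Union>K\<in>\<K>. K \<inter> spec_at Hs T \<alpha>)"
      using \<K> by (intro openin_Union) blast
    ultimately show "openin (top_of_set (spec_at Hs T \<alpha>)) (\<Union>\<K> \<inter> spec_at Hs T \<alpha>)" by simp
  qed
  then show ?thesis
    unfolding loc_spectrum_topology_def by (simp add: topology_inverse')
qed

definition C_loc ::
    "('i \<Rightarrow> 'a::complex_hilbert_space set) \<Rightarrow> ('a \<Rightarrow> 'a) \<Rightarrow> (complex \<Rightarrow> complex) set" where
  "C_loc Hs T =
     {f \<in> extensional (loc_spectrum Hs T). continuous_map (loc_spectrum_topology Hs T) euclidean f}"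

definition C_on :: "complex set \<Rightarrow> (complex \<Rightarrow> complex) set" where
  "C_on K = {f \<in> extensional K. continuous_on K f}"

definition sup_norm_on :: "complex set \<Rightarrow> (complex \<Rightarrow> complex) \<Rightarrow> real" where
  "sup_norm_on K f = (SUP z\<in>K. cmod (f z))"

section \<open>Functional calculus\<close>

definition A_alg ::
    "('i \<Rightarrow> 'a::complex_hilbert_space set) \<Rightarrow> ('a \<Rightarrow> 'a) \<Rightarrow> ('a \<Rightarrow> 'a) set" where
  "A_alg Hs T =
     {R \<in> cstar_E Hs. \<forall>\<alpha>. restrict R (Hs \<alpha>) \<in> cstar_gen (Hs \<alpha>) (restrict T (Hs \<alpha>))}"

definition func_calc ::
    "('i \<Rightarrow> 'a::complex_hilbert_space set) \<Rightarrow> ('a \<Rightarrow> 'a) \<Rightarrow> (complex \<Rightarrow> complex) \<Rightarrow> 'a \<Rightarrow> 'a" where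
  "func_calc Hs T f =
     proj_lim Hs (\<lambda>\<alpha>. gelfand_inv (Hs \<alpha>) (restrict T (Hs \<alpha>)) (restrict f (spec_at Hs T \<alpha>)))"

text \<open>
  Linear maps and *-homomorphisms from an algebra \<open>\<C>\<close> of complex functions on \<open>K\<close> to an algebra \<open>\<A>\<close>
  of operators on \<open>V\<close>, the latter with involution \<open>st\<close>.
\<close>

definition linear_fun_op ::
    "complex set \<Rightarrow> (complex \<Rightarrow> complex) set \<Rightarrow> 'a::complex_hilbert_space set \<Rightarrow> ('a \<Rightarrow> 'a) set \<Rightarrow>
     ((complex \<Rightarrow> complex) \<Rightarrow> 'a \<Rightarrow> 'a) \<Rightarrow> bool" where
  "linear_fun_op K \<C> V \<A> \<Phi> \<longleftrightarrow>
     \<Phi> \<in> \<C> \<rightarrow> \<A> \<and>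
     (\<forall>f\<in>\<C>. \<forall>g\<in>\<C>. \<Phi> (\<lambda>z\<in>K. f z + g z) = op_add V (\<Phi> f) (\<Phi> g)) \<and>
     (\<forall>c. \<forall>f\<in>\<C>. \<Phi> (\<lambda>z\<in>K. c * f z) = op_scale V c (\<Phi> f))"

definition star_hom ::
    "complex set \<Rightarrow> (complex \<Rightarrow> complex) set \<Rightarrow> 'a::complex_hilbert_space set \<Rightarrow> ('a \<Rightarrow> 'a) set \<Rightarrow>
     (('a \<Rightarrow> 'a) \<Rightarrow> 'a \<Rightarrow> 'a) \<Rightarrow> ((complex \<Rightarrow> complex) \<Rightarrow> 'a \<Rightarrow> 'a) \<Rightarrow> bool" where
  "star_hom K \<C> V \<A> st \<Phi> \<longleftrightarrow>
     linear_fun_op K \<C> V \<A> \<Phi> \<and>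
     (\<forall>f\<in>\<C>. \<forall>g\<in>\<C>. \<Phi> (\<lambda>z\<in>K. f z * g z) = compose V (\<Phi> f) (\<Phi> g)) \<and>
     (\<forall>f\<in>\<C>. \<Phi> (\<lambda>z\<in>K. cnj (f z)) = st (\<Phi> f))"

definition coherent ::
    "('i \<Rightarrow> 'a::complex_hilbert_space set) \<Rightarrow> ('a \<Rightarrow> 'a) \<Rightarrow>
     ((complex \<Rightarrow> complex) \<Rightarrow> 'a \<Rightarrow> 'a) \<Rightarrow> bool" where
  "coherent Hs T \<Phi> \<longleftrightarrow> (\<exists>\<Psi>. \<forall>\<alpha>.
     linear_fun_op (spec_at Hs T \<alpha>) (C_on (spec_at Hs T \<alpha>))
       (Hs \<alpha>) (cstar_gen (Hs \<alpha>) (restrict T (Hs \<alpha>))) (\<Psi> \<alpha>) \<and>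
     (\<forall>f\<in>C_loc Hs T. restrict (\<Phi> f) (Hs \<alpha>) = \<Psi> \<alpha> (restrict f (spec_at Hs T \<alpha>))))"

definition local_isometric ::
    "('i \<Rightarrow> 'a::complex_hilbert_space set) \<Rightarrow> ('a \<Rightarrow> 'a) \<Rightarrow>
     ((complex \<Rightarrow> complex) \<Rightarrow> 'a \<Rightarrow> 'a) \<Rightarrow> bool" where
  "local_isometric Hs T \<Phi> \<longleftrightarrow> (\<forall>f\<in>C_loc Hs T. \<forall>\<alpha>.
     op_norm (Hs \<alpha>) (restrict (\<Phi> f) (Hs \<alpha>)) =
     sup_norm_on (spec_at Hs T \<alpha>) (restrict f (spec_at Hs T \<alpha>)))"

text \<open>
  A polynomial in two variables \<open>(z, w)\<close> is a \<open>complex poly poly\<close> whose outer variable is \<open>z\<close>: the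
  coefficient of \<open>z ^ i * w ^ j\<close> is \<open>coeff (coeff P i) j\<close>.
\<close>

definition poly2 :: "complex poly poly \<Rightarrow> complex \<Rightarrow> complex \<Rightarrow> complex" where
  "poly2 P z w = (\<Sum>i\<le>degree P. \<Sum>j\<le>degree (coeff P i). coeff (coeff P i) j * z ^ i * w ^ j)"

definition op_poly2 ::
    "'a::complex_hilbert_space set \<Rightarrow> complex poly poly \<Rightarrow> ('a \<Rightarrow> 'a) \<Rightarrow> ('a \<Rightarrow> 'a) \<Rightarrow> 'a \<Rightarrow> 'a" where
  "op_poly2 M P A B = (\<lambda>x\<in>M. \<Sum>i\<le>degree P. \<Sum>j\<le>degree (coeff P i).
     coeff (coeff P i) j *\<^sub>C (A ^^ i) ((B ^^ j) x))"

end

(*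
  Let A be a normal operator on M. The set of pairs (z, w) such that every approximate eigenvector
  of A at z is an approximate eigenvector of R at w gives, for z in the spectrum of A, a character
  R |-> w of the C*-algebra of A; every character arises in this way, since otherwise
  (A - z)*(A - z) + (R - w)*(R - w) would be an invertible element of its kernel. An approximate
  eigenvector of R*R at the square of the norm of R can be improved to a joint approximate
  eigenvector of R*R and of the real and imaginary parts of A, because these commute; so the norm of
  R is attained by some character and the Gelfand transform is isometric. It is onto by the
  Stone-Weierstrass theorem. Joint approximate eigenvectors in a subspace are ones in any larger
  subspace, which makes the functional calculi on the subspaces compatible.
*)

theory Submission
  imports Defs
begin

section \<open>Complex Hilbert spaces\<close>

text \<open>\<open>gelfand\<close> selects a character by a definite description, so it says nothing
  until each spectral point is known to carry exactly one character. \<open>approx_value\<close>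
  provides this without maximal ideals or the spectral radius formula. Its shape, an arbitrarily
  small multiple of \<open>norm x\<close> plus a constant times the defect of \<open>A\<close>, is
  stable under sums, products and norm limits, so it spreads from the generators to the whole
  algebra. Adjoints can be carried along because, for normal \<open>A\<close>, the operator A - z
  and its adjoint have equal norms on every vector. The passage from X^2 - r^2 to one of its factors
  works for a single self-adjoint operator. Hence the real and imaginary parts of \<open>A\<close>
  are treated one after the other, with a seminorm \<open>q\<close> that remembers the defects
  already made small and that commutation keeps under control. On the domain, operators are glued
  from their restrictions. The obstacle there is membership in \<open>cstar_E\<close>: commuting
  with all projections is obtained from the fact that the adjoint on a larger subspace leaves the
  smaller ones invariant.\<close>

lemma scaleC_zero_left [simp]: "0 *\<^sub>C x = 0"
  using scaleC_add_left[of 0 0 x] by simp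

lemma scaleC_zero_right [simp]: "c *\<^sub>C 0 = 0"
  using scaleC_add_right[of c 0 0] by simp

lemma scaleC_minus_left: "(- c) *\<^sub>C x = - (c *\<^sub>C x)"
  using scaleC_add_left[of "-c" c x] by (simp add: eq_neg_iff_add_eq_0)

lemma scaleC_minus_right: "c *\<^sub>C (- x) = - (c *\<^sub>C x)"
  using scaleC_add_right[of c "-x" x] by (simp add: eq_neg_iff_add_eq_0)

lemma scaleC_diff_right: "c *\<^sub>C (x - y) = c *\<^sub>C x - c *\<^sub>C y"
  using scaleC_add_right[of c x "-y"] by (simp add: scaleC_minus_right)

lemma scaleC_diff_left: "(c - d) *\<^sub>C x = c *\<^sub>C x - d *\<^sub>C x"
  using scaleC_add_left[of c "-d" x] by (simp add: scaleC_minus_left)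

lemma cinner_add_right: "cinner x (y + z) = cinner x y + cinner x z"
  by (metis cinner_add_left cinner_commute complex_cnj_add)

lemma cinner_scaleC_right: "cinner x (c *\<^sub>C y) = cnj c * cinner x y"
  by (metis cinner_scaleC_left cinner_commute complex_cnj_mult)

lemma cinner_zero_left [simp]: "cinner 0 y = 0"
  using cinner_add_left[of 0 0 y] by simp

lemma cinner_zero_right [simp]: "cinner x 0 = 0"
  using cinner_add_right[of x 0 0] by simp

lemma cinner_minus_left: "cinner (- x) y = - cinner x y"
  using cinner_add_left[of "-x" x y] by (simp add: eq_neg_iff_add_eq_0)

lemma cinner_minus_right: "cinner x (- y) = - cinner x y"
  using cinner_add_right[of x "-y" y] by (simp add: eq_neg_iff_add_eq_0)

lemma cinner_diff_left: "cinner (x - y) z = cinner x z - cinner y z"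
  using cinner_add_left[of x "-y" z] by (simp add: cinner_minus_left)

lemma cinner_diff_right: "cinner x (y - z) = cinner x y - cinner x z"
  using cinner_add_right[of x y "-z"] by (simp add: cinner_minus_right)

lemma cinner_self: "cinner x x = complex_of_real ((norm x)\<^sup>2)"
proof -
  have "Im (cinner x x) = 0"
    using arg_cong[OF cinner_commute[of x x], of Im] by simp
  then show ?thesis
    using cinner_ge_zero[of x] by (simp add: complex_eq_iff norm_eq_sqrt_cinner)
qed

lemma norm_square: "(norm x)\<^sup>2 = Re (cinner x x)"
  by (simp add: cinner_self)

lemma norm_scaleC [simp]: "norm (c *\<^sub>C x) = cmod c * norm x"
proof -
  have "cinner (c *\<^sub>C x) (c *\<^sub>C x) = (c * cnj c) * cinner x x"
    by (simp only: cinner_scaleC_left cinner_scaleC_right ac_simps)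
  then have "(norm (c *\<^sub>C x))\<^sup>2 = Re ((c * cnj c) * cinner x x)"
    by (simp only: norm_square)
  also have "\<dots> = (cmod c * norm x)\<^sup>2"
    by (simp add: cinner_self complex_norm_square[symmetric] power_mult_distrib del: of_real_power)
  finally show ?thesis
    by (simp add: power2_eq_iff_nonneg)
qed

lemma norm_diff_square:
  "(norm (x - y))\<^sup>2 = (norm x)\<^sup>2 - 2 * Re (cinner x y) + (norm y)\<^sup>2"
  using arg_cong[OF cinner_commute[of x y], of Re]
  by (simp add: norm_square cinner_diff_left cinner_diff_right)

lemma norm_add_square:
  "(norm (x + y))\<^sup>2 = (norm x)\<^sup>2 + 2 * Re (cinner x y) + (norm y)\<^sup>2"
  using arg_cong[OF cinner_commute[of x y], of Re]
  by (simp add: norm_square cinner_add_left cinner_add_right)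

lemma Cauchy_Schwarz_cinner: "cmod (cinner x y) \<le> norm x * norm y"
proof (cases "y = 0")
  case False
  then have y: "norm y > 0" by simp
  \<comment> \<open>\<open>c\<close> times \<open>y\<close> is the orthogonal projection of
    \<open>x\<close> onto the line through \<open>y\<close>; the claim is that the remainder has
    nonnegative square norm.\<close>
  define c where "c = cinner x y / complex_of_real ((norm y)\<^sup>2)"
  have "Re (cinner x (c *\<^sub>C y)) = Re (cnj (cinner x y) * cinner x y) / (norm y)\<^sup>2"
    by (simp add: cinner_scaleC_right c_def del: of_real_power)
  also have "\<dots> = (cmod (cinner x y))\<^sup>2 / (norm y)\<^sup>2"
    using cmod_power2[of "cinner x y"] by (simp add: power2_eq_square)
  finally have "(norm (x - c *\<^sub>C y))\<^sup>2
      = (norm x)\<^sup>2 - 2 * ((cmod (cinner x y))\<^sup>2 / (norm y)\<^sup>2) + (cmod c * norm y)\<^sup>2"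
    by (simp add: norm_diff_square)
  also have "(cmod c * norm y)\<^sup>2 = (cmod (cinner x y))\<^sup>2 / (norm y)\<^sup>2"
    using y by (simp add: c_def norm_divide power_mult_distrib power_divide norm_power)
       (simp add: power2_eq_square power4_eq_xxxx field_simps)
  finally have "(cmod (cinner x y))\<^sup>2 / (norm y)\<^sup>2 \<le> (norm x)\<^sup>2"
    using zero_le_power2[of "norm (x - c *\<^sub>C y)"] by linarith
  then have "(cmod (cinner x y))\<^sup>2 \<le> (norm x * norm y)\<^sup>2"
    using y by (simp add: field_simps power_mult_distrib)
  then show ?thesis
    by (rule power2_le_imp_le) simp
qed simp

text \<open>First-order condition at a minimum along a real line. It turns the minimality in the
  Riesz argument into an equation.\<close>

lemma linear_term_eq_0:
  fixes a b :: real
  assumes "a \<ge> 0" and nonneg: "\<And>t. 0 \<le> t\<^sup>2 * a + 2 * t * b"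
  shows "b = 0"
proof -
  \<comment> \<open>The minimum of the quadratic is at -b / a; the 1 in the denominator covers a = 0
    and still leaves a negative value unless b = 0.\<close>
  define t where "t = - b / (1 + a)"
  have t: "t * (1 + a) = - b" using assms(1) by (simp add: t_def)
  have "0 \<le> (t\<^sup>2 * a + 2 * t * b) * (1 + a)\<^sup>2"
    by (intro mult_nonneg_nonneg nonneg) simp
  also have "\<dots> = (t * (1 + a))\<^sup>2 * a + 2 * (t * (1 + a)) * b * (1 + a)"
    by (simp add: power2_eq_square algebra_simps)
  also have "\<dots> = - (b\<^sup>2 * (a + 2))"
    unfolding t by (simp add: power2_eq_square algebra_simps)
  finally have "b\<^sup>2 * (a + 2) \<le> 0" by simp
  then show ?thesis using assms(1) by (simp add: mult_le_0_iff)
qed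

lemma csubspace_simps:
  assumes "csubspace M"
  shows "0 \<in> M" "\<And>x y. x \<in> M \<Longrightarrow> y \<in> M \<Longrightarrow> x + y \<in> M" "\<And>c x. x \<in> M \<Longrightarrow> c *\<^sub>C x \<in> M"
    "\<And>x y. x \<in> M \<Longrightarrow> y \<in> M \<Longrightarrow> x - y \<in> M"
proof -
  show "0 \<in> M" "\<And>x y. x \<in> M \<Longrightarrow> y \<in> M \<Longrightarrow> x + y \<in> M" "\<And>c x. x \<in> M \<Longrightarrow> c *\<^sub>C x \<in> M"
    using assms by (auto simp: csubspace_def)
  then show "x - y \<in> M" if "x \<in> M" "y \<in> M" for x y
    using that by (metis diff_conv_add_uminus scaleC_minus_left scaleC_one)
qed

section \<open>Closed subspaces: Riesz representation and orthogonal projection\<close>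

locale closed_csubspace =
  fixes M :: "'a::complex_hilbert_space set"
  assumes csubspace: "csubspace M" and closed: "closed M"
begin

lemmas M_simps [simp, intro] = csubspace_simps[OF csubspace]

lemma cinner_eqI:
  assumes "u \<in> M" "v \<in> M" "\<And>x. x \<in> M \<Longrightarrow> cinner x u = cinner x v"
  shows "u = v"
proof -
  have "cinner (u - v) (u - v) = 0"
    using assms(3)[of "u - v"] assms by (simp add: cinner_diff_right)
  then show ?thesis by (simp add: cinner_eq_zero_iff)
qed

text \<open>The representing vector minimises \<open>\<parallel>v\<parallel>\<^sup>2 - 2 Re (f v)\<close>.\<close>

lemma riesz:
  assumes add: "\<And>x y. x \<in> M \<Longrightarrow> y \<in> M \<Longrightarrow> f (x + y) = f x + f y"
    and scale: "\<And>c x. x \<in> M \<Longrightarrow> f (c *\<^sub>C x) = c * f x"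
    and bound: "\<And>x. x \<in> M \<Longrightarrow> cmod (f x) \<le> K * norm x"
  obtains v where "v \<in> M" "\<And>x. x \<in> M \<Longrightarrow> f x = cinner x v"
proof -
  define J where "J v = (norm v)\<^sup>2 - 2 * Re (f v)" for v
  have diff: "f (x - y) = f x - f y" if "x \<in> M" "y \<in> M" for x y
    using add[of "x - y" y] that by simp
  have J_ge: "J v \<ge> - K\<^sup>2" if "v \<in> M" for v
  proof -
    have "Re (f v) \<le> K * norm v"
      using bound[OF that] complex_Re_le_cmod[of "f v"] by linarith
    moreover have "0 \<le> (norm v - K)\<^sup>2" by simp
    ultimately show ?thesis
      unfolding J_def power2_diff by (simp add: mult.commute)
  qed
  have bdd: "bdd_below (J ` M)"
    using J_ge by (intro bdd_belowI2)
  define m where "m = Inf (J ` M)"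
  have m_le: "m \<le> J v" if "v \<in> M" for v
    unfolding m_def using bdd that by (simp add: cINF_lower)
  have "\<exists>v\<in>M. J v < m + 1 / Suc n" for n
  proof -
    have "Inf (J ` M) < m + 1 / Suc n" by (simp add: m_def)
    from cInf_lessD[OF _ this] show ?thesis using M_simps(1) by blast
  qed
  then obtain u where u: "\<And>n. u n \<in> M" "\<And>n. J (u n) < m + 1 / Suc n"
    by metis
  \<comment> \<open>Parallelogram identity at the midpoint \<open>w\<close>: as J w is at least the
    infimum \<open>m\<close>, two near-minimisers lie close to each other.\<close>
  have para: "(norm (x - y))\<^sup>2 \<le> 2 * J x + 2 * J y - 4 * m" if "x \<in> M" "y \<in> M" for x y
  proof -
    define w where "w = (1/2 :: complex) *\<^sub>C (x + y)"
    have "w \<in> M" using that by (simp add: w_def)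
    have "(norm w)\<^sup>2 = (norm (x + y))\<^sup>2 / 4"
      by (simp add: w_def power_mult_distrib norm_divide power_divide)
    moreover have "Re (f w) = (Re (f x) + Re (f y)) / 2"
      using that by (simp add: w_def scale add)
    ultimately have "4 * J w = (norm (x + y))\<^sup>2 - 4 * (Re (f x) + Re (f y))"
      by (simp add: J_def)
    then have "(norm (x - y))\<^sup>2 = 2 * J x + 2 * J y - 4 * J w"
      by (simp add: J_def norm_add_square norm_diff_square)
    then show ?thesis using m_le[OF \<open>w \<in> M\<close>] by simp
  qed
  have "Cauchy u"
  proof (rule metric_CauchyI)
    fix e :: real assume "e > 0"
    \<comment> \<open>Each of the two members exceeds \<open>m\<close> by less than 1 / Suc N and
      enters \<open>para\<close> with factor 2, which gives 4 / Suc N in total.\<close>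
    then obtain N where N: "1 / Suc N < e\<^sup>2 / 4"
      using nat_approx_posE[of "e\<^sup>2 / 4"] by auto
    show "\<exists>N. \<forall>m\<ge>N. \<forall>n\<ge>N. dist (u m) (u n) < e"
    proof (intro exI allI impI)
      fix k l assume "k \<ge> N" "l \<ge> N"
      then have "1 / Suc k \<le> 1 / Suc N" "1 / Suc l \<le> 1 / Suc N"
        by (auto intro!: divide_left_mono)
      then have "2 * J (u k) + 2 * J (u l) - 4 * m < e\<^sup>2"
        using u(2)[of k] u(2)[of l] N by linarith
      then have "(norm (u k - u l))\<^sup>2 < e\<^sup>2"
        using para[OF u(1) u(1)] by (rule le_less_trans[rotated])
      then show "dist (u k) (u l) < e"
        using \<open>e > 0\<close> by (simp add: dist_norm power_less_imp_less_base)
    qed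
  qed
  then obtain v where v: "u \<longlonglongrightarrow> v"
    using Cauchy_convergent_iff convergent_def by blast
  have "v \<in> M" using closed u(1) v closed_sequentially by blast
  have "(\<lambda>n. f (u n) - f v) \<longlonglongrightarrow> 0"
  proof (rule Lim_null_comparison)
    show "\<forall>\<^sub>F n in sequentially. norm (f (u n) - f v) \<le> K * norm (u n - v)"
      using bound[of "u _ - v"] u(1) \<open>v \<in> M\<close> by (intro always_eventually) (simp add: diff)
    show "(\<lambda>n. K * norm (u n - v)) \<longlonglongrightarrow> 0"
      using tendsto_mult_left[OF tendsto_norm[OF LIM_zero[OF v]], of K] by simp
  qed
  then have "(\<lambda>n. f (u n)) \<longlonglongrightarrow> f v" by (rule LIM_zero_cancel)
  then have "(\<lambda>n. J (u n)) \<longlonglongrightarrow> J v"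
    unfolding J_def by (intro tendsto_intros v)
  moreover have "(\<lambda>n. m + 1 / Suc n) \<longlonglongrightarrow> m + 0"
    by (intro tendsto_intros LIMSEQ_inverse_real_of_nat[unfolded inverse_eq_divide])
  ultimately have "J v \<le> m + 0"
    using u(2) by (intro LIMSEQ_le) (auto intro: less_imp_le)
  then have min: "J v \<le> J x" if "x \<in> M" for x using m_le[OF that] by linarith
  have Re_eq: "Re (cinner x v) = Re (f x)" if "x \<in> M" for x
  proof -
    define b where "b = Re (cinner x v) - Re (f x)"
    have "0 \<le> t\<^sup>2 * (norm x)\<^sup>2 + 2 * t * b" for t :: real
    proof -
      have "J v \<le> J (v + complex_of_real t *\<^sub>C x)"
        using \<open>v \<in> M\<close> that by (intro min) simp
      also have "\<dots> = J v + t\<^sup>2 * (norm x)\<^sup>2 + 2 * t * b"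
        using \<open>v \<in> M\<close> that arg_cong[OF cinner_commute[of v x], of Re]
        by (simp add: J_def b_def norm_add_square add scale cinner_scaleC_right algebra_simps)
      finally show ?thesis by simp
    qed
    then have "b = 0" by (intro linear_term_eq_0[of "(norm x)\<^sup>2" b]) auto
    then show ?thesis by (simp add: b_def)
  qed
  \<comment> \<open>A complex-linear functional is determined by its real part: the imaginary part
    at x is read off at i x.\<close>
  have "f x = cinner x v" if "x \<in> M" for x
    using Re_eq[OF that] Re_eq[of "\<i> *\<^sub>C x"] that
    by (simp add: complex_eq_iff scale cinner_scaleC_left)
  then show ?thesis using that \<open>v \<in> M\<close> by blast
qed

lemma orth_proj_unique:
  assumes "y \<in> M" "\<And>z. z \<in> M \<Longrightarrow> cinner (x - y) z = 0"
  shows "orth_proj M x = y"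
  unfolding orth_proj_def
proof (rule the_equality)
  show "y \<in> M \<and> (\<forall>z\<in>M. cinner (x - y) z = 0)" using assms by blast
next
  fix y' assume y': "y' \<in> M \<and> (\<forall>z\<in>M. cinner (x - y') z = 0)"
  show "y' = y"
  proof (rule cinner_eqI)
    fix z assume "z \<in> M"
    then have "cinner y z = cinner y' z"
      using y' assms(2)[of z] by (simp add: cinner_diff_left)
    then show "cinner z y' = cinner z y" by (metis cinner_commute)
  qed (use y' assms in auto)
qed

text \<open>The projection of \<open>x\<close> is the Riesz vector of the functional taking z to <z,
  x> on \<open>M\<close>; this settles existence in the definite description.\<close>

lemma orth_proj:
  shows orth_proj_in [simp]: "orth_proj M x \<in> M"
    and orth_proj_cinner: "z \<in> M \<Longrightarrow> cinner (orth_proj M x) z = cinner x z"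
proof -
  obtain y where y: "y \<in> M" "\<And>z. z \<in> M \<Longrightarrow> cinner z x = cinner z y"
  proof (rule riesz[of "\<lambda>z. cinner z x" "norm x"])
    show "cmod (cinner z x) \<le> norm x * norm z" for z
      using Cauchy_Schwarz_cinner[of z x] by (simp add: mult.commute)
  qed (auto simp: cinner_add_left cinner_scaleC_left)
  then have "cinner (x - y) z = 0" if "z \<in> M" for z
    using arg_cong[OF y(2)[OF that], of cnj]
    by (simp add: cinner_diff_left cinner_commute[symmetric])
  with y(1) have "orth_proj M x = y" by (rule orth_proj_unique)
  with y show "orth_proj M x \<in> M" "z \<in> M \<Longrightarrow> cinner (orth_proj M x) z = cinner x z"
    by (auto simp: cinner_commute[of _ z])
qed

section \<open>Bounded operators on a closed subspace\<close>

lemma bounded_opsI: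
  assumes "\<And>x. x \<in> M \<Longrightarrow> A x \<in> M" "A \<in> extensional M"
    and "\<And>x y. x \<in> M \<Longrightarrow> y \<in> M \<Longrightarrow> A (x + y) = A x + A y"
    and "\<And>c x. x \<in> M \<Longrightarrow> A (c *\<^sub>C x) = c *\<^sub>C A x"
    and "\<And>x. x \<in> M \<Longrightarrow> norm (A x) \<le> K * norm x"
  shows "A \<in> bounded_ops M"
proof -
  have "\<exists>K. \<forall>x\<in>M. norm (A x) \<le> K * norm x" using assms(5) by blast
  then show ?thesis using assms by (auto simp: bounded_ops_def clinear_on_def PiE_def)
qed

lemma
  assumes "A \<in> bounded_ops M"
  shows bounded_ops_in [simp]: "x \<in> M \<Longrightarrow> A x \<in> M"
    and bounded_ops_extensional: "A \<in> extensional M"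
    and bounded_ops_add: "x \<in> M \<Longrightarrow> y \<in> M \<Longrightarrow> A (x + y) = A x + A y"
    and bounded_ops_scale: "x \<in> M \<Longrightarrow> A (c *\<^sub>C x) = c *\<^sub>C A x"
    and bounded_ops_diff: "x \<in> M \<Longrightarrow> y \<in> M \<Longrightarrow> A (x - y) = A x - A y"
    and bounded_ops_zero [simp]: "A 0 = 0"
proof -
  show *: "x \<in> M \<Longrightarrow> A x \<in> M" "A \<in> extensional M"
    "x \<in> M \<Longrightarrow> y \<in> M \<Longrightarrow> A (x + y) = A x + A y"
    "x \<in> M \<Longrightarrow> A (c *\<^sub>C x) = c *\<^sub>C A x" for x y c
    using assms by (auto simp: bounded_ops_def clinear_on_def PiE_def)
  show "A (x - y) = A x - A y" if "x \<in> M" "y \<in> M"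
    using *(3)[of "x - y" y] that by simp
  show "A 0 = 0"
    using *(4)[of 0 0] by simp
qed

lemmas bounded_ops_linear = bounded_ops_add bounded_ops_scale bounded_ops_diff

text \<open>The constant in \<open>bounded_ops\<close> carries no sign and may be negative on the
  zero space, whereas later estimates multiply by it.\<close>

lemma bounded_ops_bound:
  assumes "A \<in> bounded_ops M"
  obtains K where "K \<ge> 0" "\<And>x. x \<in> M \<Longrightarrow> norm (A x) \<le> K * norm x"
proof -
  obtain K where K: "\<forall>x\<in>M. norm (A x) \<le> K * norm x"
    using assms by (auto simp: bounded_ops_def)
  have "norm (A x) \<le> \<bar>K\<bar> * norm x" if "x \<in> M" for x
    using K that by (meson abs_ge_self mult_right_mono norm_ge_zero order_trans)
  then show ?thesis using that[of "\<bar>K\<bar>"] by simp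
qed

lemma bounded_ops_eqI:
  assumes "A \<in> bounded_ops M" "B \<in> bounded_ops M" "\<And>x. x \<in> M \<Longrightarrow> A x = B x"
  shows "A = B"
  using assms bounded_ops_extensional by (blast intro: extensionalityI)

lemma op_apply [simp]:
  assumes "x \<in> M"
  shows "op_id M x = x" "op_add M A B x = A x + B x" "op_diff M A B x = A x - B x"
    "op_scale M c A x = c *\<^sub>C A x" "compose M A B x = A (B x)"
  using assms by (auto simp: op_id_def op_add_def op_diff_def op_scale_def compose_def)

lemma op_extensional [simp]:
  "op_id M \<in> extensional M" "op_add M A B \<in> extensional M" "op_diff M A B \<in> extensional M"
  "op_scale M c A \<in> extensional M" "compose M A B \<in> extensional M"
  by (auto simp: op_id_def op_add_def op_diff_def op_scale_def compose_def)

lemma op_id_bounded [simp]: "op_id M \<in> bounded_ops M"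
  by (rule bounded_opsI[where K = 1]) auto

lemma op_scale_bounded [simp]:
  assumes "A \<in> bounded_ops M"
  shows "op_scale M c A \<in> bounded_ops M"
proof -
  obtain K where K: "\<And>x. x \<in> M \<Longrightarrow> norm (A x) \<le> K * norm x"
    using bounded_ops_bound[OF assms] by blast
  show ?thesis
  proof (rule bounded_opsI[where K = "cmod c * K"])
    show "norm (op_scale M c A x) \<le> cmod c * K * norm x" if "x \<in> M" for x
      using mult_left_mono[OF K[OF that], of "cmod c"] that by (simp add: mult.assoc)
  qed (use assms in \<open>auto simp: bounded_ops_linear scaleC_add_right scaleC_scaleC mult.commute\<close>)
qed

lemma op_add_bounded [simp]:
  assumes A: "A \<in> bounded_ops M" and B: "B \<in> bounded_ops M"
  shows "op_add M A B \<in> bounded_ops M"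
proof -
  obtain K L where K: "\<And>x. x \<in> M \<Longrightarrow> norm (A x) \<le> K * norm x"
    and L: "\<And>x. x \<in> M \<Longrightarrow> norm (B x) \<le> L * norm x"
    using bounded_ops_bound[OF A] bounded_ops_bound[OF B] by metis
  show ?thesis
  proof (rule bounded_opsI[where K = "K + L"])
    show "norm (op_add M A B x) \<le> (K + L) * norm x" if "x \<in> M" for x
      using norm_triangle_ineq[of "A x" "B x"] K[OF that] L[OF that] that
      by (simp add: distrib_right)
  qed (use assms in \<open>auto simp: bounded_ops_linear scaleC_add_right\<close>)
qed

text \<open>Subalgebras are closed under sums and multiples by definition; closure under differences
  is derived through this form.\<close>

lemma op_diff_eq: "op_diff M A B = op_add M A (op_scale M (-1) B)"
  by (rule extensionalityI[of _ M]) (auto simp: scaleC_minus_left scaleC_one)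

lemma op_diff_bounded [simp]:
  "A \<in> bounded_ops M \<Longrightarrow> B \<in> bounded_ops M \<Longrightarrow> op_diff M A B \<in> bounded_ops M"
  by (simp add: op_diff_eq)

lemma compose_bounded [simp]:
  assumes A: "A \<in> bounded_ops M" and B: "B \<in> bounded_ops M"
  shows "compose M A B \<in> bounded_ops M"
proof -
  obtain K L where K: "\<And>x. x \<in> M \<Longrightarrow> norm (A x) \<le> K * norm x" "K \<ge> 0"
    and L: "\<And>x. x \<in> M \<Longrightarrow> norm (B x) \<le> L * norm x"
    using bounded_ops_bound[OF A] bounded_ops_bound[OF B] by metis
  show ?thesis
  proof (rule bounded_opsI[where K = "K * L"])
    show "norm (compose M A B x) \<le> K * L * norm x" if "x \<in> M" for x
      using K(1)[of "B x"] mult_left_mono[OF L[OF that] K(2)] B that by (simp add: mult.assoc)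
  qed (use assms in \<open>auto simp: bounded_ops_linear\<close>)
qed

section \<open>Adjoints\<close>

lemma adj_on_exists:
  assumes A: "A \<in> bounded_ops M"
  obtains B where "B \<in> bounded_ops M" "\<And>x y. x \<in> M \<Longrightarrow> y \<in> M \<Longrightarrow> cinner (A x) y = cinner x (B y)"
proof -
  obtain K where K: "\<And>x. x \<in> M \<Longrightarrow> norm (A x) \<le> K * norm x"
    using bounded_ops_bound[OF A] by blast
  have "\<exists>v\<in>M. \<forall>x\<in>M. cinner (A x) y = cinner x v" for y
  proof -
    have "cmod (cinner (A x) y) \<le> (K * norm y) * norm x" if "x \<in> M" for x
      using Cauchy_Schwarz_cinner[of "A x" y] mult_right_mono[OF K[OF that], of "norm y"]
      by (simp add: ac_simps)
    then obtain v where "v \<in> M" "\<And>x. x \<in> M \<Longrightarrow> cinner (A x) y = cinner x v"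
      using riesz[of "\<lambda>x. cinner (A x) y" "K * norm y"] A
      by (auto simp: bounded_ops_linear cinner_add_left cinner_scaleC_left)
    then show ?thesis by blast
  qed
  then obtain b where b: "\<And>y. b y \<in> M" "\<And>x y. x \<in> M \<Longrightarrow> cinner (A x) y = cinner x (b y)"
    by metis
  have *: "cinner x (b y) = cinner (A x) y" if "x \<in> M" for x y
    using b that by simp
  show ?thesis
  proof (rule that)
    show "restrict b M \<in> bounded_ops M"
    proof (rule bounded_opsI)
      fix y assume y: "y \<in> M"
      show "norm (restrict b M y) \<le> K * norm y"
      proof (cases "b y = 0")
        case True
        then show ?thesis using order_trans[OF norm_ge_zero K[OF y]] y by simp
      next
        case False
        \<comment> \<open>Testing the defining identity with x = b y bounds norm (b y)^2 by K norm
          (b y) norm y, and one factor cancels.\<close>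
        have "(norm (b y))\<^sup>2 = Re (cinner (A (b y)) y)"
          using *[OF b(1)] by (simp add: norm_square)
        also have "\<dots> \<le> norm (A (b y)) * norm y"
          using Cauchy_Schwarz_cinner[of "A (b y)" y] complex_Re_le_cmod order_trans by blast
        also have "\<dots> \<le> K * norm (b y) * norm y"
          using K[OF b(1)] by (simp add: mult_right_mono)
        finally have "norm (b y) * norm (b y) \<le> norm (b y) * (K * norm y)"
          by (simp add: power2_eq_square ac_simps)
        then show ?thesis using False y by simp
      qed
    next
      fix x y assume "x \<in> M" "y \<in> M"
      then show "restrict b M (x + y) = restrict b M x + restrict b M y"
        by (auto intro!: cinner_eqI simp: b(1) * cinner_add_right)
    next
      fix c x assume "x \<in> M"
      then show "restrict b M (c *\<^sub>C x) = c *\<^sub>C restrict b M x"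
        by (auto intro!: cinner_eqI simp: b(1) * cinner_scaleC_right)
    qed (auto simp: b)
  qed (auto simp: b)
qed

lemma adj_on_unique:
  assumes "B \<in> bounded_ops M" "\<And>x y. x \<in> M \<Longrightarrow> y \<in> M \<Longrightarrow> cinner (A x) y = cinner x (B y)"
  shows "adj_on M A = B"
  unfolding adj_on_def
proof (rule the_equality)
  fix B' assume "B' \<in> bounded_ops M \<and> (\<forall>x\<in>M. \<forall>y\<in>M. cinner (A x) y = cinner x (B' y))"
  then show "B' = B"
    using assms by (intro bounded_ops_eqI cinner_eqI) auto
qed (use assms in auto)

lemma
  assumes "A \<in> bounded_ops M"
  shows adj_on_bounded [simp]: "adj_on M A \<in> bounded_ops M"
    and cinner_adj_on: "x \<in> M \<Longrightarrow> y \<in> M \<Longrightarrow> cinner (A x) y = cinner x (adj_on M A y)"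
    and cinner_adj_on': "x \<in> M \<Longrightarrow> y \<in> M \<Longrightarrow> cinner (adj_on M A x) y = cinner x (A y)"
proof -
  obtain B where B: "B \<in> bounded_ops M" "\<And>x y. x \<in> M \<Longrightarrow> y \<in> M \<Longrightarrow> cinner (A x) y = cinner x (B y)"
    using adj_on_exists[OF assms] by blast
  then have "adj_on M A = B" by (rule adj_on_unique)
  with B show "adj_on M A \<in> bounded_ops M"
    "x \<in> M \<Longrightarrow> y \<in> M \<Longrightarrow> cinner (A x) y = cinner x (adj_on M A y)" for x y by auto
  then show "x \<in> M \<Longrightarrow> y \<in> M \<Longrightarrow> cinner (adj_on M A x) y = cinner x (A y)"
    by (metis cinner_commute)
qed

lemma adj_on_adj_on [simp]: "A \<in> bounded_ops M \<Longrightarrow> adj_on M (adj_on M A) = A"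
  by (rule adj_on_unique) (auto simp: cinner_adj_on')

lemma adj_on_add [simp]:
  "A \<in> bounded_ops M \<Longrightarrow> B \<in> bounded_ops M \<Longrightarrow>
    adj_on M (op_add M A B) = op_add M (adj_on M A) (adj_on M B)"
  by (rule adj_on_unique) (auto simp: cinner_adj_on cinner_add_left cinner_add_right)

lemma adj_on_scale [simp]:
  "A \<in> bounded_ops M \<Longrightarrow> adj_on M (op_scale M c A) = op_scale M (cnj c) (adj_on M A)"
  by (rule adj_on_unique) (auto simp: cinner_adj_on cinner_scaleC_left cinner_scaleC_right)

lemma adj_on_diff [simp]:
  "A \<in> bounded_ops M \<Longrightarrow> B \<in> bounded_ops M \<Longrightarrow>
    adj_on M (op_diff M A B) = op_diff M (adj_on M A) (adj_on M B)"
  by (simp add: op_diff_eq)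

lemma adj_on_compose [simp]:
  "A \<in> bounded_ops M \<Longrightarrow> B \<in> bounded_ops M \<Longrightarrow>
    adj_on M (compose M A B) = compose M (adj_on M B) (adj_on M A)"
  by (rule adj_on_unique) (auto simp: cinner_adj_on)

lemma adj_on_id [simp]: "adj_on M (op_id M) = op_id M"
  by (rule adj_on_unique) auto

text \<open>Adjoints inherit bounds. Applied to differences, this carries norm convergence over to
  the adjoints.\<close>

lemma norm_adj_on_le:
  assumes A: "A \<in> bounded_ops M" and K: "\<And>x. x \<in> M \<Longrightarrow> norm (A x) \<le> K * norm x" and x: "x \<in> M"
  shows "norm (adj_on M A x) \<le> K * norm x"
proof (cases "adj_on M A x = 0")
  case True
  then show ?thesis using order_trans[OF norm_ge_zero K[OF x]] by simp
next
  case False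
  let ?y = "adj_on M A x"
  have y: "?y \<in> M" using A x by simp
  have "(norm ?y)\<^sup>2 = Re (cinner (A ?y) x)"
    using cinner_adj_on[OF A y x] by (simp add: norm_square)
  also have "\<dots> \<le> norm (A ?y) * norm x"
    using Cauchy_Schwarz_cinner[of "A ?y" x] complex_Re_le_cmod order_trans by blast
  also have "\<dots> \<le> K * norm ?y * norm x"
    using K[OF y] by (simp add: mult_right_mono)
  finally have "norm ?y * norm ?y \<le> norm ?y * (K * norm x)"
    by (simp add: power2_eq_square ac_simps)
  then show ?thesis using False by simp
qed

section \<open>Operator norm and norm limits\<close>

lemma
  assumes A: "A \<in> bounded_ops M"
  shows op_norm_nonneg: "0 \<le> op_norm M A"
    and norm_le_op_norm: "x \<in> M \<Longrightarrow> norm (A x) \<le> op_norm M A * norm x"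
proof -
  let ?B = "{x \<in> M. norm x \<le> 1}"
  obtain K where K: "K \<ge> 0" "\<And>x. x \<in> M \<Longrightarrow> norm (A x) \<le> K * norm x"
    using bounded_ops_bound[OF A] by blast
  have "norm (A x) \<le> K" if "x \<in> ?B" for x
    using K(2)[of x] mult_left_mono[of "norm x" 1 K] K(1) that by auto
  then have le: "norm (A x) \<le> op_norm M A" if "x \<in> ?B" for x
    unfolding op_norm_def using that by (intro cSUP_upper bdd_aboveI2) auto
  from le[of 0] show "0 \<le> op_norm M A" using A by simp
  show "norm (A x) \<le> op_norm M A * norm x" if "x \<in> M"
  proof (cases "x = 0")
    case False
    have "norm (A (complex_of_real (1 / norm x) *\<^sub>C x)) \<le> op_norm M A"
      using that False by (intro le) (auto simp: norm_divide)
    then show ?thesis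
      using that False by (simp add: bounded_ops_scale[OF A] norm_divide field_simps)
  qed (use A in simp)
qed

lemma op_norm_le:
  assumes "K \<ge> 0" "\<And>x. x \<in> M \<Longrightarrow> norm (A x) \<le> K * norm x"
  shows "op_norm M A \<le> K"
  unfolding op_norm_def
proof (rule cSUP_least)
  show "norm (A x) \<le> K" if "x \<in> {x \<in> M. norm x \<le> 1}" for x
    using assms(2)[of x] mult_left_mono[of "norm x" 1 K] assms(1) that by auto
qed (use M_simps(1) in force)

text \<open>Later \<open>r\<close> is the norm minus a small number and may be negative; any nonzero
  vector then serves. For nonnegative \<open>r\<close>, failure would make \<open>r\<close> a bound
  below the norm.\<close>

lemma op_norm_approx:
  assumes A: "A \<in> bounded_ops M" and "M \<noteq> {0}" "r < op_norm M A"
  obtains x where "x \<in> M" "r * norm x < norm (A x)"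
proof (cases "r < 0")
  case True
  obtain x where "x \<in> M" "x \<noteq> 0" using assms(2) M_simps(1) by blast
  then have "r * norm x < 0" using True by (simp add: mult_neg_pos)
  then show ?thesis using that[OF \<open>x \<in> M\<close>] norm_ge_zero[of "A x"] by linarith
next
  case False
  then show ?thesis
    using op_norm_le[of r A] assms(3) that by force
qed

text \<open>Translates limits in \<open>op_norm\<close> into uniform estimates on vectors, the form
  in which the limit arguments below are carried out.\<close>

lemma op_norm_tendsto_iff:
  assumes "\<And>n. R n \<in> bounded_ops M" "A \<in> bounded_ops M"
  shows "(\<lambda>n::nat. op_norm M (op_diff M (R n) A)) \<longlonglongrightarrow> 0 \<longleftrightarrow>
    (\<forall>e>0. \<exists>N. \<forall>n\<ge>N. \<forall>x\<in>M. norm (R n x - A x) \<le> e * norm x)"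
proof -
  have b: "op_diff M (R n) A \<in> bounded_ops M" for n using assms by simp
  show ?thesis
  proof (intro iffI allI impI)
    fix e :: real
    assume "(\<lambda>n::nat. op_norm M (op_diff M (R n) A)) \<longlonglongrightarrow> 0" "e > 0"
    then obtain N where N: "\<forall>n\<ge>N. op_norm M (op_diff M (R n) A) < e"
      by (auto simp: lim_sequentially dist_real_def op_norm_nonneg[OF b])
    have "norm (R n x - A x) \<le> e * norm x" if "n \<ge> N" "x \<in> M" for n x
    proof -
      have "norm (R n x - A x) \<le> op_norm M (op_diff M (R n) A) * norm x"
        using norm_le_op_norm[OF b that(2), of n] that by simp
      also have "\<dots> \<le> e * norm x" using N that by (intro mult_right_mono) auto
      finally show ?thesis .
    qed
    then show "\<exists>N. \<forall>n\<ge>N. \<forall>x\<in>M. norm (R n x - A x) \<le> e * norm x" by blast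
  next
    assume *: "\<forall>e>0. \<exists>N. \<forall>n\<ge>N. \<forall>x\<in>M. norm (R n x - A x) \<le> e * norm x"
    show "(\<lambda>n. op_norm M (op_diff M (R n) A)) \<longlonglongrightarrow> 0"
      unfolding lim_sequentially
    proof (intro allI impI)
      fix e :: real assume "e > 0"
      \<comment> \<open>Half of \<open>e\<close>, because the supremum only inherits a weak
        inequality.\<close>
      then obtain N where N: "\<forall>n\<ge>N. \<forall>x\<in>M. norm (R n x - A x) \<le> e/2 * norm x"
        using *[rule_format, of "e/2"] by auto
      have "op_norm M (op_diff M (R n) A) \<le> e/2" if "n \<ge> N" for n
        using N that \<open>e > 0\<close> by (intro op_norm_le) auto
      then show "\<exists>N. \<forall>n\<ge>N. dist (op_norm M (op_diff M (R n) A)) 0 < e"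
        using \<open>e > 0\<close> by (intro exI[of _ N]) (force simp: dist_real_def op_norm_nonneg[OF b])
    qed
  qed
qed

text \<open>Pointwise limits stay in \<open>M\<close> because \<open>M\<close> is closed, and
  letting one index of the Cauchy estimate tend to infinity makes the convergence uniform on the
  unit ball.\<close>

lemma bounded_ops_complete:
  assumes R: "\<And>n::nat. R n \<in> bounded_ops M"
    and Cauchy: "\<And>e. e > 0 \<Longrightarrow> \<exists>N. \<forall>m\<ge>N. \<forall>n\<ge>N. \<forall>x\<in>M. norm (R m x - R n x) \<le> e * norm x"
  obtains A where "A \<in> bounded_ops M"
    "\<And>e. e > 0 \<Longrightarrow> \<exists>N. \<forall>n\<ge>N. \<forall>x\<in>M. norm (R n x - A x) \<le> e * norm x"
proof -
  have "\<exists>l. (\<lambda>n. R n x) \<longlonglongrightarrow> l" if "x \<in> M" for x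
  proof -
    have "Cauchy (\<lambda>n. R n x)"
    proof (rule metric_CauchyI)
      fix e :: real assume "e > 0"
      then have "e / (norm x + 1) > 0"
        by (simp add: add_nonneg_pos)
      from Cauchy[OF this] obtain N where
        "\<forall>m\<ge>N. \<forall>n\<ge>N. \<forall>y\<in>M. norm (R m y - R n y) \<le> e / (norm x + 1) * norm y"
        by blast
      then have N: "\<forall>m\<ge>N. \<forall>n\<ge>N. norm (R m x - R n x) \<le> e / (norm x + 1) * norm x"
        using that by simp
      have "e / (norm x + 1) * norm x < e / (norm x + 1) * (norm x + 1)"
        using \<open>e / (norm x + 1) > 0\<close> by (intro mult_strict_left_mono) auto
      also have "\<dots> = e" by (simp add: add_nonneg_eq_0_iff)
      finally show "\<exists>N. \<forall>m\<ge>N. \<forall>n\<ge>N. dist (R m x) (R n x) < e"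
        using N by (intro exI[of _ N]) (auto simp: dist_norm intro: le_less_trans)
    qed
    then show ?thesis
      using Cauchy_convergent_iff convergent_def by blast
  qed
  then obtain a where a: "\<And>x. x \<in> M \<Longrightarrow> (\<lambda>n. R n x) \<longlonglongrightarrow> a x"
    by metis
  have unif: "\<exists>N. \<forall>n\<ge>N. \<forall>x\<in>M. norm (R n x - a x) \<le> e * norm x" if "e > 0" for e
  proof -
    obtain N where N: "\<forall>m\<ge>N. \<forall>n\<ge>N. \<forall>x\<in>M. norm (R m x - R n x) \<le> e * norm x"
      using Cauchy[OF \<open>e > 0\<close>] by blast
    have "norm (R n x - a x) \<le> e * norm x" if "n \<ge> N" "x \<in> M" for n x
    proof (rule Lim_bounded)
      show "(\<lambda>m. norm (R n x - R m x)) \<longlonglongrightarrow> norm (R n x - a x)"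
        by (intro tendsto_intros a that)
      show "\<forall>m\<ge>N. norm (R n x - R m x) \<le> e * norm x" using N that by blast
    qed
    then show ?thesis by blast
  qed
  \<comment> \<open>A single member at distance at most 1 supplies the bound for the limit
    operator.\<close>
  obtain N where N: "\<forall>n\<ge>N. \<forall>x\<in>M. norm (R n x - a x) \<le> 1 * norm x"
    using unif[of 1] by auto
  obtain K where K: "\<And>x. x \<in> M \<Longrightarrow> norm (R N x) \<le> K * norm x"
    using bounded_ops_bound[OF R[of N]] by blast
  have "restrict a M \<in> bounded_ops M"
  proof (rule bounded_opsI)
    fix x assume x: "x \<in> M"
    show "restrict a M x \<in> M"
      using closed_sequentially[OF closed _ a[OF x]] R x by simp
    show "norm (restrict a M x) \<le> (K + 1) * norm x"
      using norm_triangle_ineq[of "R N x" "a x - R N x"] K[OF x] N[rule_format, of N x] x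
      by (simp add: distrib_right norm_minus_commute)
  next
    fix x y assume "x \<in> M" "y \<in> M"
    then have "(\<lambda>n. R n x + R n y) \<longlonglongrightarrow> a (x + y)"
      using a[of "x + y"] R by (simp add: bounded_ops_add)
    moreover have "(\<lambda>n. R n x + R n y) \<longlonglongrightarrow> a x + a y"
      by (intro tendsto_intros a \<open>x \<in> M\<close> \<open>y \<in> M\<close>)
    ultimately show "restrict a M (x + y) = restrict a M x + restrict a M y"
      using \<open>x \<in> M\<close> \<open>y \<in> M\<close> LIMSEQ_unique by auto
  next
    fix c x assume x: "x \<in> M"
    have "(\<lambda>n. norm (c *\<^sub>C R n x - c *\<^sub>C a x)) \<longlonglongrightarrow> 0"
      using tendsto_mult_left[OF tendsto_norm[OF LIM_zero[OF a[OF x]]], of "cmod c"]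
      by (simp flip: scaleC_diff_right)
    then have "(\<lambda>n. c *\<^sub>C R n x) \<longlonglongrightarrow> c *\<^sub>C a x"
      by (rule LIM_zero_cancel[OF tendsto_norm_zero_cancel])
    moreover have "(\<lambda>n. c *\<^sub>C R n x) \<longlonglongrightarrow> a (c *\<^sub>C x)"
      using a[of "c *\<^sub>C x"] x R by (simp add: bounded_ops_scale)
    ultimately show "restrict a M (c *\<^sub>C x) = c *\<^sub>C restrict a M x"
      using x LIMSEQ_unique by auto
  qed auto
  then show ?thesis
    using that[of "restrict a M"] unif by simp
qed

section \<open>C*-subalgebras and the generated algebra\<close>

lemma cstar_subalgebraI:
  assumes "\<A> \<subseteq> bounded_ops M"
    and "\<And>A B. A \<in> \<A> \<Longrightarrow> B \<in> \<A> \<Longrightarrow> op_add M A B \<in> \<A>"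
    and "\<And>c A. A \<in> \<A> \<Longrightarrow> op_scale M c A \<in> \<A>"
    and "\<And>A B. A \<in> \<A> \<Longrightarrow> B \<in> \<A> \<Longrightarrow> compose M A B \<in> \<A>"
    and "\<And>A. A \<in> \<A> \<Longrightarrow> adj_on M A \<in> \<A>"
    and closed: "\<And>A. A \<in> bounded_ops M \<Longrightarrow>
      (\<And>e. e > 0 \<Longrightarrow> \<exists>R\<in>\<A>. \<forall>x\<in>M. norm (R x - A x) \<le> e * norm x) \<Longrightarrow> A \<in> \<A>"
  shows "cstar_subalgebra M \<A>"
  unfolding cstar_subalgebra_def
proof (intro conjI allI impI ballI)
  fix R A assume *: "(\<forall>n. R n \<in> \<A>) \<and> A \<in> bounded_ops M \<and>
        (\<lambda>n::nat. op_norm M (op_diff M (R n) A)) \<longlonglongrightarrow> 0"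
  then have "\<forall>e>0. \<exists>N. \<forall>n\<ge>N. \<forall>x\<in>M. norm (R n x - A x) \<le> e * norm x"
    using assms(1) by (subst op_norm_tendsto_iff[symmetric]) auto
  then have "\<exists>R\<in>\<A>. \<forall>x\<in>M. norm (R x - A x) \<le> e * norm x" if "e > 0" for e
    using * that by (meson order_refl)
  then show "A \<in> \<A>" using * by (intro closed) auto
qed (use assms in auto)

lemma
  assumes "cstar_subalgebra M \<A>"
  shows cstar_subalgebra_bounded: "A \<in> \<A> \<Longrightarrow> A \<in> bounded_ops M"
    and cstar_subalgebra_add: "A \<in> \<A> \<Longrightarrow> B \<in> \<A> \<Longrightarrow> op_add M A B \<in> \<A>"
    and cstar_subalgebra_scale: "A \<in> \<A> \<Longrightarrow> op_scale M c A \<in> \<A>"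
    and cstar_subalgebra_compose: "A \<in> \<A> \<Longrightarrow> B \<in> \<A> \<Longrightarrow> compose M A B \<in> \<A>"
    and cstar_subalgebra_adj: "A \<in> \<A> \<Longrightarrow> adj_on M A \<in> \<A>"
    and cstar_subalgebra_diff: "A \<in> \<A> \<Longrightarrow> B \<in> \<A> \<Longrightarrow> op_diff M A B \<in> \<A>"
  using assms unfolding cstar_subalgebra_def op_diff_eq by blast+

lemma cstar_subalgebra_closed:
  assumes \<A>: "cstar_subalgebra M \<A>" and R: "\<And>n::nat. R n \<in> \<A>" and A: "A \<in> bounded_ops M"
    and lim: "\<And>e. e > 0 \<Longrightarrow> \<exists>N. \<forall>n\<ge>N. \<forall>x\<in>M. norm (R n x - A x) \<le> e * norm x"
  shows "A \<in> \<A>"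
proof -
  have "(\<lambda>n::nat. op_norm M (op_diff M (R n) A)) \<longlonglongrightarrow> 0"
    using cstar_subalgebra_bounded[OF \<A> R] A lim by (subst op_norm_tendsto_iff) auto
  then show ?thesis using \<A> R A unfolding cstar_subalgebra_def by blast
qed

text \<open>Closedness of a subalgebra is verified with one approximant for each error; this
  recovers a sequence where values or vectors must be followed to a limit.\<close>

lemma approx_sequence:
  assumes "\<And>e. e > 0 \<Longrightarrow> \<exists>S\<in>\<S>. \<forall>x\<in>M. norm (S x - R x) \<le> e * norm x"
  shows "\<exists>S::nat \<Rightarrow> 'a \<Rightarrow> 'a. (\<forall>n. S n \<in> \<S>) \<and>
    (\<forall>e>0. \<exists>N. \<forall>n\<ge>N. \<forall>x\<in>M. norm (S n x - R x) \<le> e * norm x)"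
proof -
  have "\<exists>S\<in>\<S>. \<forall>x\<in>M. norm (S x - R x) \<le> inverse (real (Suc n)) * norm x" for n
    by (rule assms) simp
  then obtain S where S: "\<And>n. S n \<in> \<S>"
    "\<And>n x. x \<in> M \<Longrightarrow> norm (S n x - R x) \<le> inverse (real (Suc n)) * norm x"
    by metis
  have "\<exists>N. \<forall>n\<ge>N. \<forall>x\<in>M. norm (S n x - R x) \<le> e * norm x" if "e > 0" for e
  proof -
    obtain N where N: "\<forall>n\<ge>N. inverse (real (Suc n)) < e"
      using order_tendstoD(2)[OF LIMSEQ_inverse_real_of_nat \<open>e > 0\<close>]
      unfolding eventually_sequentially by blast
    have "norm (S n x - R x) \<le> e * norm x" if "n \<ge> N" "x \<in> M" for n x
      by (rule order_trans[OF S(2)[OF that(2)] mult_right_mono])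
         (use N that(1) less_imp_le in auto)
    then show ?thesis by blast
  qed
  with S(1) show ?thesis by blast
qed

lemma cstar_subalgebra_bounded_ops: "cstar_subalgebra M (bounded_ops M)"
  by (rule cstar_subalgebraI) auto

text \<open>Serves as induction over the generated algebra: \<open>\<S>\<close> is taken to be the
  set of operators with the property in question.\<close>

lemma cstar_gen_induct:
  assumes "R \<in> cstar_gen M A" "cstar_subalgebra M \<S>" "op_id M \<in> \<S>" "A \<in> \<S>" "adj_on M A \<in> \<S>"
  shows "R \<in> \<S>"
  using assms by (auto simp: cstar_gen_def)

lemma cstar_gen_subalgebra:
  assumes "A \<in> bounded_ops M"
  shows "cstar_subalgebra M (cstar_gen M A)"
proof -
  let ?F = "{\<A>. cstar_subalgebra M \<A> \<and> {op_id M, A, adj_on M A} \<subseteq> \<A>}"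
  have F: "bounded_ops M \<in> ?F"
    using assms cstar_subalgebra_bounded_ops by simp
  show ?thesis
    unfolding cstar_subalgebra_def
  proof (intro conjI allI impI ballI)
    show "cstar_gen M A \<subseteq> bounded_ops M"
      using F by (auto simp: cstar_gen_def)
  next
    fix R B assume *: "(\<forall>n. R n \<in> cstar_gen M A) \<and> B \<in> bounded_ops M \<and>
        (\<lambda>n::nat. op_norm M (op_diff M (R n) B)) \<longlonglongrightarrow> 0"
    show "B \<in> cstar_gen M A"
      unfolding cstar_gen_def
    proof
      fix \<A> assume \<A>: "\<A> \<in> ?F"
      then have "\<forall>n. R n \<in> \<A>" using * by (auto simp: cstar_gen_def)
      with * \<A> show "B \<in> \<A>" unfolding cstar_subalgebra_def by blast
    qed
  qed (auto simp: cstar_gen_def intro: cstar_subalgebra_add cstar_subalgebra_scale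
      cstar_subalgebra_compose cstar_subalgebra_adj)
qed

lemma cstar_gen_gens: "op_id M \<in> cstar_gen M A" "A \<in> cstar_gen M A" "adj_on M A \<in> cstar_gen M A"
  by (auto simp: cstar_gen_def)

text \<open>With \<open>D = 1 - S/t\<close> for large \<open>t\<close> one has \<open>\<parallel>D\<parallel> < 1\<close>, and the partial sums of the Neumann series
  of \<open>D\<close>, divided by \<open>t\<close>, stay in the algebra.\<close>

lemma coercive_inverse:
  assumes \<A>: "cstar_subalgebra M \<A>" and id: "op_id M \<in> \<A>" and S: "S \<in> \<A>"
    and c: "c > 0" "\<And>x. x \<in> M \<Longrightarrow> c * (norm x)\<^sup>2 \<le> Re (cinner (S x) x)"
  obtains V where "V \<in> \<A>" "compose M S V = op_id M" "compose M V S = op_id M"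
proof -
  have Sb: "S \<in> bounded_ops M" using \<A> S by (rule cstar_subalgebra_bounded)
  obtain K where K: "K \<ge> 0" "\<And>x. x \<in> M \<Longrightarrow> norm (S x) \<le> K * norm x"
    using bounded_ops_bound[OF Sb] by blast
  \<comment> \<open>Adding \<open>c\<close> to the bound \<open>K\<close> makes \<open>b\<close>
    positive and at least \<open>c\<close>, so that the root defining \<open>\<rho>\<close> has a
    nonnegative argument below 1.\<close>
  define b where "b = K + c"
  have b: "b > 0" "c \<le> b" using K c by (auto simp: b_def)
  have Sle: "norm (S x) \<le> b * norm x" if "x \<in> M" for x
    using K(2)[OF that] c(1) by (simp add: b_def distrib_right add_increasing2)
  \<comment> \<open>This \<open>t\<close> minimises 1 - 2 c / t + b^2 / t^2, the bound for the
    square of norm (D x) / norm x; the minimum is 1 - (c / b)^2.\<close>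
  define t where "t = b\<^sup>2 / c"
  have t: "t > 0" using b c by (simp add: t_def)
  define \<rho> where "\<rho> = sqrt (1 - (c / b)\<^sup>2)"
  have cb: "0 < c / b" "c / b \<le> 1" using b c by auto
  have \<rho>: "0 \<le> \<rho>" "\<rho> < 1" "\<rho>\<^sup>2 = 1 - (c / b)\<^sup>2"
    using cb power_le_one[of "c / b" 2] by (auto simp: \<rho>_def)
  define D where "D = op_add M (op_id M) (op_scale M (complex_of_real (- 1 / t)) S)"
  have D: "D \<in> \<A>"
    unfolding D_def using \<A> id S by (intro cstar_subalgebra_add cstar_subalgebra_scale)
  then have Db: "D \<in> bounded_ops M" using \<A> cstar_subalgebra_bounded by blast
  have D_apply: "D x = x - complex_of_real (1 / t) *\<^sub>C S x" if "x \<in> M" for x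
    using that by (simp add: D_def scaleC_minus_left)
  have Dle: "norm (D x) \<le> \<rho> * norm x" if x: "x \<in> M" for x
  proof -
    have "(norm (D x))\<^sup>2 = (norm x)\<^sup>2 - 2 / t * Re (cinner (S x) x) + (norm (S x))\<^sup>2 / t\<^sup>2"
      unfolding D_apply[OF x] norm_diff_square
      using t arg_cong[OF cinner_commute[of x "S x"], of Re]
      by (simp add: cinner_scaleC_right power_mult_distrib norm_divide power_divide)
    also have "\<dots> \<le> (norm x)\<^sup>2 - 2 / t * (c * (norm x)\<^sup>2) + (b * norm x)\<^sup>2 / t\<^sup>2"
      using c(2)[OF x] Sle[OF x] t
      by (intro add_mono diff_mono mult_left_mono divide_right_mono power_mono) auto
    also have "\<dots> = (1 - 2 / t * c + b\<^sup>2 / t\<^sup>2) * (norm x)\<^sup>2"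
      by (simp add: algebra_simps power_mult_distrib)
    also have "1 - 2 / t * c + b\<^sup>2 / t\<^sup>2 = \<rho>\<^sup>2"
      unfolding \<rho>(3) using b c(1) by (simp add: t_def field_simps power2_eq_square)
    finally have "(norm (D x))\<^sup>2 \<le> (\<rho> * norm x)\<^sup>2" by (simp only: power_mult_distrib)
    then show ?thesis
      by (rule power2_le_imp_le) (rule mult_nonneg_nonneg[OF \<rho>(1) norm_ge_zero])
  qed
  define W where "W = op_scale M (complex_of_real (1 / t)) (op_id M)"
  \<comment> \<open>Iteration towards the fixed point of B = 1 / t + D B. Its start is the zero
    operator, written as a multiple of the unit so that it lies in the algebra.\<close>
  define V where "V n = ((\<lambda>B. op_add M W (compose M D B)) ^^ n) (op_scale M 0 (op_id M))" for n
  have V: "V n \<in> \<A>" for n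
  proof (induction n)
    case 0
    show ?case unfolding V_def using \<A> id cstar_subalgebra_scale by simp
  next
    case (Suc n)
    then show ?case
      unfolding V_def W_def using \<A> id D
      by (simp add: cstar_subalgebra_add cstar_subalgebra_compose cstar_subalgebra_scale)
  qed
  have Vb: "V n \<in> bounded_ops M" for n using V \<A> cstar_subalgebra_bounded by blast
  have V0: "V 0 x = 0" if "x \<in> M" for x
    using that by (simp add: V_def)
  have VSuc: "V (Suc n) x = complex_of_real (1 / t) *\<^sub>C x + D (V n x)" if "x \<in> M" for n x
    using that by (simp add: V_def W_def)
  \<comment> \<open>Sum of the geometric series with first term 1 / t and ratio
    \<open>\<rho>\<close>; it is the fixed point of the bounds in the next induction.\<close>
  define L where "L = 1 / (t * (1 - \<rho>))"
  have L: "1 / t + \<rho> * L = L" "L \<ge> 0"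
    using t \<rho> by (auto simp: L_def field_simps)
  have Vle: "norm (V n x) \<le> L * norm x" if x: "x \<in> M" for n x
  proof (induction n)
    case (Suc n)
    have "norm (V (Suc n) x) \<le> norm (complex_of_real (1 / t) *\<^sub>C x) + norm (D (V n x))"
      unfolding VSuc[OF x] by (rule norm_triangle_ineq)
    also have "\<dots> \<le> 1 / t * norm x + \<rho> * (L * norm x)"
      using Dle[of "V n x"] Suc Vb x t \<rho>(1)
      by (intro add_mono) (auto simp: norm_divide intro: order_trans mult_left_mono)
    also have "\<dots> = (1 / t + \<rho> * L) * norm x" by (simp add: algebra_simps)
    finally show ?case using L by simp
  qed (use V0 L x in simp)
  \<comment> \<open>Each step of the recursion applies \<open>D\<close> once to the difference,
    which begins with V k - V 0.\<close>
  have Vdiff: "norm (V (n + k) x - V n x) \<le> \<rho> ^ n * L * norm x" if x: "x \<in> M" for n k x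
  proof (induction n)
    case 0
    show ?case using Vle[OF x] V0[OF x] by simp
  next
    case (Suc n)
    have "V (Suc n + k) x - V (Suc n) x = D (V (n + k) x - V n x)"
      using x Vb Db by (simp add: VSuc bounded_ops_diff)
    then have "norm (V (Suc n + k) x - V (Suc n) x) \<le> \<rho> * norm (V (n + k) x - V n x)"
      using Dle x Vb by simp
    also have "\<dots> \<le> \<rho> * (\<rho> ^ n * L * norm x)"
      using Suc \<rho>(1) by (rule mult_left_mono)
    finally show ?case by (simp add: mult.assoc)
  qed
  obtain U where U: "U \<in> bounded_ops M"
    and lim: "\<And>e. e > 0 \<Longrightarrow> \<exists>N. \<forall>n\<ge>N. \<forall>x\<in>M. norm (V n x - U x) \<le> e * norm x"
  proof (rule bounded_ops_complete[of V])
    fix e :: real assume e: "e > 0"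
    have "(\<lambda>n. \<rho> ^ n * L) \<longlonglongrightarrow> 0 * L"
      using \<rho> by (intro tendsto_mult tendsto_const LIMSEQ_power_zero) auto
    then have "\<forall>\<^sub>F n in sequentially. \<rho> ^ n * L < e / 2"
      using e by (intro order_tendstoD) auto
    then obtain N where N: "\<rho> ^ N * L < e / 2"
      using eventually_happens by fastforce
    have N': "norm (V n x - V N x) \<le> e / 2 * norm x" if "n \<ge> N" "x \<in> M" for n x
      using Vdiff[OF that(2), of N "n - N"] that(1) N
        mult_right_mono[of "\<rho> ^ N * L" "e / 2" "norm x"] by simp
    have "norm (V m x - V n x) \<le> e * norm x" if "m \<ge> N" "n \<ge> N" "x \<in> M" for m n x
      using norm_triangle_sub[of "V m x - V N x" "V n x - V N x"]
        norm_triangle_ineq4[of "V m x - V N x" "V n x - V N x"]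
        N'[OF that(1,3)] N'[OF that(2,3)] by simp
    then show "\<exists>N. \<forall>m\<ge>N. \<forall>n\<ge>N. \<forall>x\<in>M. norm (V m x - V n x) \<le> e * norm x" by blast
  qed (use Vb in auto)
  have UA: "U \<in> \<A>" using \<A> V U lim by (rule cstar_subalgebra_closed)
  have SU: "S (U x) = x" if x: "x \<in> M" for x
  proof -
    have *: "norm (x - S (U x)) \<le> e" if e: "e > 0" for e
    proof -
      \<comment> \<open>The estimate below has the factor 2 t + b in front of norm x:
        \<open>t\<close> from each of the two iterates and \<open>b\<close> from \<open>S\<close>.
        The added 1 keeps the denominator positive.\<close>
      define d where "d = e / ((t + t + b) * (norm x + 1))"
      have pos: "(t + t + b) * (norm x + 1) > 0"
        using t b by (intro mult_pos_pos) (auto intro: add_nonneg_pos)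
      then have d: "d > 0" using e by (simp add: d_def)
      obtain N where N: "\<forall>n\<ge>N. \<forall>x\<in>M. norm (V n x - U x) \<le> d * norm x"
        using lim[OF d] by blast
      define p q where "p = V N x - U x" and "q = V (Suc N) x - U x"
      have pM: "p \<in> M" "U x \<in> M" using x U Vb by (auto simp: p_def)
      have nb: "norm p \<le> d * norm x" "norm q \<le> d * norm x"
        using N x by (auto simp: p_def q_def)
      have eq: "V (Suc N) x = complex_of_real (1 / t) *\<^sub>C x + V N x - complex_of_real (1 / t) *\<^sub>C S (V N x)"
        using VSuc[OF x, of N] D_apply[of "V N x"] Vb x by simp
      have "S (V N x) = S p + S (U x)"
        using bounded_ops_add[OF Sb pM] by (simp add: p_def)
      then have "complex_of_real (1 / t) *\<^sub>C (x - S (U x)) = q - p + complex_of_real (1 / t) *\<^sub>C S p"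
        using eq by (simp add: p_def q_def scaleC_diff_right scaleC_add_right algebra_simps)
      then have "complex_of_real t *\<^sub>C complex_of_real (1 / t) *\<^sub>C (x - S (U x))
          = complex_of_real t *\<^sub>C (q - p) + complex_of_real t *\<^sub>C complex_of_real (1 / t) *\<^sub>C S p"
        by (simp only: scaleC_add_right)
      then have "x - S (U x) = complex_of_real t *\<^sub>C (q - p) + S p"
        using t by (simp add: scaleC_scaleC scaleC_one)
      then have "norm (x - S (U x)) \<le> t * norm (q - p) + norm (S p)"
        using norm_triangle_ineq[of "complex_of_real t *\<^sub>C (q - p)" "S p"] t by simp
      also have "\<dots> \<le> t * (d * norm x + d * norm x) + b * (d * norm x)"
        using nb norm_triangle_ineq4[of q p] Sle[OF pM(1)] t b
        by (intro add_mono mult_left_mono order_trans[OF Sle[OF pM(1)]]) auto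
      also have "\<dots> = (t + t + b) * norm x * d" by (simp add: algebra_simps)
      also have "\<dots> \<le> (t + t + b) * (norm x + 1) * d"
        using d t b by (intro mult_right_mono mult_left_mono) auto
      also have "\<dots> = e"
        unfolding d_def times_divide_eq_right using pos
        by (intro nonzero_mult_div_cancel_left) (rule less_imp_neq[symmetric])
      finally show ?thesis .
    qed
    have "norm (x - S (U x)) \<le> 0" using * by (rule field_le_epsilon[of _ 0, simplified])
    then show ?thesis by simp
  qed
  \<comment> \<open>Coercivity makes \<open>S\<close> injective, and by \<open>SU\<close> it maps U
    (S x) and x to the same vector.\<close>
  have US: "U (S x) = x" if x: "x \<in> M" for x
  proof -
    let ?y = "U (S x) - x"
    have y: "?y \<in> M" using x U Sb by simp
    have "S ?y = 0" using x U Sb SU[of "S x"] by (simp add: bounded_ops_diff)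
    then have "c * (norm ?y)\<^sup>2 \<le> 0" using c(2)[OF y] by simp
    then show ?thesis using c(1) by (simp add: mult_le_0_iff)
  qed
  show ?thesis
  proof (rule that[OF UA])
    show "compose M S U = op_id M" "compose M U S = op_id M"
      using SU US by (auto intro: extensionalityI[of _ M])
  qed
qed

end

section \<open>Approximate eigenvectors\<close>

text \<open>The strict inequality excludes x = 0 and thereby replaces a normalisation of the
  vectors.\<close>

definition approx_spectrum :: "'a::complex_hilbert_space set \<Rightarrow> ('a \<Rightarrow> 'a) \<Rightarrow> complex set" where
  "approx_spectrum M A = {z. \<forall>e>0. \<exists>x\<in>M. norm (A x - z *\<^sub>C x) < e * norm x}"

text \<open>Every approximate eigenvector of \<open>A\<close> for \<open>z\<close> is one of \<open>R\<close> for \<open>w\<close>. For normal \<open>A\<close> and \<open>R\<close> in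
  the C*-algebra of \<open>A\<close>, this says that the character at \<open>z\<close> maps \<open>R\<close> to \<open>w\<close>.\<close>

definition approx_value ::
    "'a::complex_hilbert_space set \<Rightarrow> ('a \<Rightarrow> 'a) \<Rightarrow> complex \<Rightarrow> ('a \<Rightarrow> 'a) \<Rightarrow> complex \<Rightarrow> bool" where
  "approx_value M A z R w \<longleftrightarrow>
     (\<forall>e>0. \<exists>C\<ge>0. \<forall>x\<in>M. norm (R x - w *\<^sub>C x) \<le> e * norm x + C * norm (A x - z *\<^sub>C x))"

lemma approx_valueE:
  assumes "approx_value M A z R w" "e > 0"
  obtains C where "C \<ge> 0"
    "\<And>x. x \<in> M \<Longrightarrow> norm (R x - w *\<^sub>C x) \<le> e * norm x + C * norm (A x - z *\<^sub>C x)"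
  using assms unfolding approx_value_def by blast

lemma approx_spectrumE:
  assumes "z \<in> approx_spectrum M A" "e > 0"
  obtains x where "x \<in> M" "norm x > 0" "norm (A x - z *\<^sub>C x) < e * norm x"
proof -
  obtain x where x: "x \<in> M" "norm (A x - z *\<^sub>C x) < e * norm x"
    using assms unfolding approx_spectrum_def by blast
  then have "norm x \<noteq> 0" by (metis mult_zero_right norm_not_less_zero)
  with x that show ?thesis by simp
qed

lemma approx_value_mono: "approx_value M A z R w \<Longrightarrow> N \<subseteq> M \<Longrightarrow> approx_value N A z R w"
  unfolding approx_value_def by (meson subsetD)

lemma approx_value_cong:
  assumes "\<And>x. x \<in> M \<Longrightarrow> A x = A' x" "\<And>x. x \<in> M \<Longrightarrow> R x = R' x"
  shows "approx_value M A z R w \<longleftrightarrow> approx_value M A' z R' w"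
  using assms by (simp add: approx_value_def)

context closed_csubspace
begin

text \<open>Let \<open>r\<close> be the largest number such that \<open>\<parallel>X x\<parallel> \<ge> (r - \<eta>) \<parallel>x\<parallel>\<close> is possible for approximate zeros
  \<open>x\<close> of \<open>q\<close>. Such \<open>x\<close> are approximate zeros of \<open>X\<^sup>2 - r\<^sup>2 = (X - r)(X + r)\<close>, so \<open>r\<close> or \<open>-r\<close> will do.\<close>

lemma selfadjoint_joint_approx:
  assumes X: "X \<in> bounded_ops M" and sa: "adj_on M X = X"
    and nonneg: "\<And>x. x \<in> M \<Longrightarrow> 0 \<le> q x"
    and q_add: "\<And>x y. x \<in> M \<Longrightarrow> y \<in> M \<Longrightarrow> q (x + y) \<le> q x + q y"
    and q_scale: "\<And>c x. x \<in> M \<Longrightarrow> q (c *\<^sub>C x) \<le> cmod c * q x"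
    and q_X: "\<And>x. x \<in> M \<Longrightarrow> q (X x) \<le> K * q x"
    and approx: "\<And>e. e > 0 \<Longrightarrow> \<exists>x\<in>M. q x < e * norm x"
  obtains s :: real
  where "\<And>e. e > 0 \<Longrightarrow> \<exists>x\<in>M. q x + norm (X x - complex_of_real s *\<^sub>C x) < e * norm x"
proof -
  obtain L where L: "L \<ge> 0" "\<And>x. x \<in> M \<Longrightarrow> norm (X x) \<le> L * norm x"
    using bounded_ops_bound[OF X] by blast
  \<comment> \<open>The bound is enlarged to be positive because the choice of \<open>f\<close>
    divides by it.\<close>
  define K' where "K' = \<bar>K\<bar> + 1"
  have K': "K' > 0" by (simp add: K'_def)
  have q_X': "q (X x) \<le> K' * q x" if "x \<in> M" for x
    using order_trans[OF q_X[OF that] mult_right_mono[of K K' "q x"]] nonneg[OF that]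
    by (auto simp: K'_def)
  have pos: "norm x > 0" if "x \<in> M" "q x < e * norm x" for x e
    using nonneg[OF that(1)] that(2) by (cases "x = 0") auto
  define P where "P r \<longleftrightarrow> (\<forall>e>0. \<exists>x\<in>M. q x < e * norm x \<and> r * norm x \<le> norm (X x))" for r
  have P0: "P 0" using approx by (auto simp: P_def)
  have P_le: "r \<le> L" if "P r" for r
  proof -
    obtain x where x: "x \<in> M" "q x < 1 * norm x" "r * norm x \<le> norm (X x)"
      using \<open>P r\<close> zero_less_one unfolding P_def by blast
    then have "r * norm x \<le> L * norm x" using L(2)[OF x(1)] by linarith
    then show ?thesis using pos[OF x(1,2)] by simp
  qed
  have P_mono: "P r'" if "P r" "r' \<le> r" for r r'
    unfolding P_def
  proof (intro allI impI)
    fix e :: real assume "e > 0"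
    then obtain x where x: "x \<in> M" "q x < e * norm x" "r * norm x \<le> norm (X x)"
      using \<open>P r\<close> unfolding P_def by blast
    have "r' * norm x \<le> r * norm x" using \<open>r' \<le> r\<close> by (simp add: mult_right_mono)
    with x show "\<exists>x\<in>M. q x < e * norm x \<and> r' * norm x \<le> norm (X x)" by force
  qed
  have bdd: "bdd_above {r. P r}" by (rule bdd_aboveI) (use P_le in simp)
  define r where "r = Sup {r. P r}"
  have "0 \<le> r" unfolding r_def using P0 bdd by (intro cSup_upper) auto
  have P_less: "P (r - d)" if "d > 0" for d
  proof -
    have "\<exists>r'\<in>{r. P r}. r - d < r'"
      using that P0 unfolding r_def by (intro less_cSupD) auto
    then show ?thesis using P_mono less_imp_le by blast
  qed
  have P_not: "\<exists>e>0. \<forall>x\<in>M. q x < e * norm x \<longrightarrow> norm (X x) < (r + d) * norm x" if "d > 0" for d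
  proof -
    have "\<not> P (r + d)"
      using cSup_upper[of "r + d" "{r. P r}"] bdd that unfolding r_def by auto
    then show ?thesis unfolding P_def by (meson not_le)
  qed
  have sq: "\<exists>x\<in>M. q x < e * norm x \<and> norm (X (X x) - complex_of_real (r\<^sup>2) *\<^sub>C x) < e * norm x"
    if e: "e > 0" for e
  \<comment> \<open>For r > 0 the upper bound \<open>P_not\<close> is applied to X x as well, which
    must then be an approximate zero of \<open>q\<close> relative to its own norm; this uses the
    lower bound on norm (X x). For r = 0 that vector is already small.\<close>
  proof (cases "r = 0")
    case True
    define d where "d = e / (L + 1)"
    have d: "d > 0" using e L(1) by (simp add: d_def)
    obtain e' where e': "e' > 0" "\<forall>x\<in>M. q x < e' * norm x \<longrightarrow> norm (X x) < (r + d) * norm x"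
      using P_not[OF d] by blast
    obtain x where x: "x \<in> M" "q x < min e e' * norm x"
      using approx[of "min e e'"] e e'(1) by auto
    have nx: "norm x > 0" using pos x by blast
    have qx: "q x < e * norm x" "q x < e' * norm x"
      using x(2) mult_right_mono[of "min e e'" e "norm x"] mult_right_mono[of "min e e'" e' "norm x"]
      by auto
    have "norm (X (X x)) \<le> L * norm (X x)" using L X x by simp
    also have "\<dots> \<le> L * (d * norm x)"
      using e'(2) x(1) qx(2) True L(1) by (intro mult_left_mono) auto
    also have "\<dots> < (L + 1) * (d * norm x)"
      using d nx by simp
    also have "\<dots> = e * norm x" using L(1) by (simp add: d_def)
    finally show ?thesis using x(1) qx(1) True by auto
  next
    case False
    then have r: "r > 0" using \<open>0 \<le> r\<close> by simp
    \<comment> \<open>F d bounds norm (X (X x) - r^2 x)^2 / norm x^2 once the bounds (r + d)^2 for X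
      (X x) and r - d for X x are inserted. It vanishes at d = 0.\<close>
    define F where "F d = ((r + d)\<^sup>2)\<^sup>2 - 2 * r\<^sup>2 * (r - d)\<^sup>2 + (r\<^sup>2)\<^sup>2" for d
    have "(F \<longlongrightarrow> F 0) (at_right 0)"
      unfolding F_def by (intro tendsto_intros)
    moreover have "F 0 < e\<^sup>2"
      using e by (simp add: F_def power2_eq_square)
    ultimately have "\<forall>\<^sub>F d in at_right 0. F d < e\<^sup>2"
      by (rule order_tendstoD)
    moreover have "\<forall>\<^sub>F d in at_right 0. d \<in> {0<..<r / 2}"
      using r by (intro eventually_at_right_real) simp
    ultimately have "\<forall>\<^sub>F d in at_right 0. F d < e\<^sup>2 \<and> d \<in> {0<..<r / 2}"
      by (rule eventually_conj)
    then obtain d where d: "F d < e\<^sup>2" "0 < d" "d < r / 2"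
      using eventually_happens'[OF trivial_limit_at_right_real] by force
    obtain e' where e': "e' > 0" "\<forall>x\<in>M. q x < e' * norm x \<longrightarrow> norm (X x) < (r + d) * norm x"
      using P_not[OF d(2)] by blast
    \<comment> \<open>The last entry gives q (X x) < e' (r / 2) norm x <= e' norm (X x), so that X x
      again qualifies for \<open>e'\<close>.\<close>
    define f where "f = min (min e e') (e' * (r / 2) / K')"
    have f: "f > 0" "f \<le> e" "f \<le> e'"
      using e e'(1) r K' by (auto simp: f_def)
    have "f \<le> e' * (r / 2) / K'" by (simp add: f_def)
    then have K'f: "K' * f \<le> e' * (r / 2)" using K' by (simp only: pos_le_divide_eq mult.commute)
    obtain x where x: "x \<in> M" "q x < f * norm x" "(r - d) * norm x \<le> norm (X x)"
      using P_less[OF d(2)] f(1) unfolding P_def by blast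
    have nx: "norm x > 0" using pos x by blast
    have qx: "q x < e * norm x" "q x < e' * norm x"
      using x(2) mult_right_mono[OF f(2), of "norm x"] mult_right_mono[OF f(3), of "norm x"] by auto
    have Xx: "norm (X x) < (r + d) * norm x" using e'(2) x(1) qx(2) by blast
    have "q (X x) \<le> K' * q x" using q_X' x(1) by blast
    also have "\<dots> < K' * (f * norm x)" using x(2) K' by simp
    also have "\<dots> \<le> e' * (r / 2) * norm x"
      using mult_right_mono[OF K'f, of "norm x"] by (simp add: mult.assoc)
    also have "\<dots> \<le> e' * ((r - d) * norm x)"
    proof -
      have "r / 2 * norm x \<le> (r - d) * norm x" using d(3) by (intro mult_right_mono) auto
      then show ?thesis using e'(1) by (simp add: mult.assoc)
    qed
    also have "\<dots> \<le> e' * norm (X x)" using x(3) e'(1) by simp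
    finally have XXx: "norm (X (X x)) < (r + d) * norm (X x)" using e'(2) X x(1) by simp
    also have "\<dots> \<le> (r + d) * ((r + d) * norm x)"
      using Xx r d(2) by (intro mult_left_mono) auto
    finally have XX: "norm (X (X x)) \<le> (r + d)\<^sup>2 * norm x"
      by (simp add: power2_eq_square)
    have inner: "cinner (X (X x)) x = complex_of_real ((norm (X x))\<^sup>2)"
      using cinner_adj_on[OF X _ x(1), of "X x"] X x(1) by (simp add: sa cinner_self)
    have "(norm (X (X x) - complex_of_real (r\<^sup>2) *\<^sub>C x))\<^sup>2
        = (norm (X (X x)))\<^sup>2 - 2 * r\<^sup>2 * (norm (X x))\<^sup>2 + (r\<^sup>2 * norm x)\<^sup>2"
      unfolding norm_diff_square cinner_scaleC_right inner by (simp add: norm_power)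
    also have "\<dots> \<le> ((r + d)\<^sup>2 * norm x)\<^sup>2 - 2 * r\<^sup>2 * ((r - d) * norm x)\<^sup>2 + (r\<^sup>2 * norm x)\<^sup>2"
      using XX x(3) d by (intro add_mono diff_mono mult_left_mono power_mono) auto
    also have "\<dots> = F d * (norm x)\<^sup>2"
      unfolding F_def power_mult_distrib by (simp add: algebra_simps)
    also have "\<dots> < e\<^sup>2 * (norm x)\<^sup>2" using d(1) nx by simp
    finally have "(norm (X (X x) - complex_of_real (r\<^sup>2) *\<^sub>C x))\<^sup>2 < (e * norm x)\<^sup>2"
      by (simp only: power_mult_distrib)
    then have "norm (X (X x) - complex_of_real (r\<^sup>2) *\<^sub>C x) < e * norm x"
      by (rule power_less_imp_less_base) (use e in simp)
    then show ?thesis using x(1) qx(1) by blast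
  qed
  let ?good = "\<lambda>s. \<forall>e>0. \<exists>x\<in>M. q x + norm (X x - complex_of_real s *\<^sub>C x) < e * norm x"
  have "?good r \<or> ?good (- r)"
  proof (rule ccontr)
    assume "\<not> (?good r \<or> ?good (- r))"
    then obtain a b where a: "a > 0" "\<And>x. x \<in> M \<Longrightarrow> a * norm x \<le> q x + norm (X x - complex_of_real r *\<^sub>C x)"
      and b: "b > 0" "\<And>x. x \<in> M \<Longrightarrow> b * norm x \<le> q x + norm (X x + complex_of_real r *\<^sub>C x)"
      by (auto simp: not_less scaleC_minus_left)
    \<comment> \<open>The denominator collects the errors: \<open>a\<close> from q x, K' + r from q
      y, and 1 from the defect of y at r.\<close>
    define e where "e = a * b / (a + K' + r + 1)"
    have den: "a + K' + r + 1 > 0" using a(1) K' \<open>0 \<le> r\<close> by simp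
    then have e: "e > 0" using a(1) b(1) by (simp add: e_def)
    obtain x where x: "x \<in> M" "q x < e * norm x"
      "norm (X (X x) - complex_of_real (r\<^sup>2) *\<^sub>C x) < e * norm x"
      using sq[OF e] by blast
    have nx: "norm x > 0" using pos x by blast
    \<comment> \<open>y = (X + r) x is nearly annihilated by X - r and by \<open>q\<close>, so
      \<open>a\<close> forces it to be small, while \<open>b\<close> applied to x keeps it away from
      0.\<close>
    define y where "y = X x + complex_of_real r *\<^sub>C x"
    have y: "y \<in> M" using X x(1) by (simp add: y_def)
    have "X y - complex_of_real r *\<^sub>C y = X (X x) - complex_of_real (r\<^sup>2) *\<^sub>C x"
      using X x(1) unfolding y_def
      by (simp add: bounded_ops_linear scaleC_add_right scaleC_scaleC power2_eq_square)
    then have y1: "norm (X y - complex_of_real r *\<^sub>C y) < e * norm x" using x(3) by simp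
    have "q y \<le> q (X x) + q (complex_of_real r *\<^sub>C x)"
      unfolding y_def using X x(1) by (intro q_add) auto
    also have "\<dots> \<le> K' * q x + r * q x"
      using q_X'[OF x(1)] q_scale[OF x(1), of "complex_of_real r"] \<open>0 \<le> r\<close> by simp
    also have "\<dots> = (K' + r) * q x" by (simp add: algebra_simps)
    also have "\<dots> \<le> (K' + r) * (e * norm x)"
      using x(2) K' \<open>0 \<le> r\<close> by (intro mult_left_mono) auto
    finally have qy: "q y \<le> (K' + r) * (e * norm x)" .
    have "b * norm x \<le> q x + norm y" using b(2)[OF x(1)] by (simp add: y_def)
    then have "a * (b * norm x) \<le> a * (q x + norm y)" using a(1) by simp
    also have "\<dots> \<le> a * (e * norm x) + a * norm y" using x(2) a(1) by (simp add: distrib_left)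
    also have "\<dots> \<le> a * (e * norm x) + (q y + norm (X y - complex_of_real r *\<^sub>C y))"
      using a(2)[OF y] by simp
    also have "\<dots> < a * (e * norm x) + ((K' + r) * (e * norm x) + e * norm x)"
      using qy y1 by linarith
    also have "\<dots> = (a + K' + r + 1) * e * norm x" by (simp add: algebra_simps)
    also have "(a + K' + r + 1) * e = a * b" using den by (simp add: e_def)
    finally show False by simp
  qed
  then show ?thesis using that by blast
qed

text \<open>At a vector where norm (N x) exceeds (n - d) norm x, the expansion of the squared defect
  nearly cancels: n^4 - 2 n^2 (n^2 - 2 n d) + n^4 = 4 n^3 d.\<close>

lemma op_norm_approx_eigen:
  assumes N: "N \<in> bounded_ops M" and nontrivial: "M \<noteq> {0}" and e: "e > 0"
  shows "\<exists>x\<in>M. norm (adj_on M N (N x) - complex_of_real ((op_norm M N)\<^sup>2) *\<^sub>C x) < e * norm x"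
proof -
  define n where "n = op_norm M N"
  have n: "n \<ge> 0" "\<And>x. x \<in> M \<Longrightarrow> norm (N x) \<le> n * norm x"
    using op_norm_nonneg[OF N] norm_le_op_norm[OF N] by (auto simp: n_def)
  have n': "norm (adj_on M N x) \<le> n * norm x" if "x \<in> M" for x
    using N n(2) that by (rule norm_adj_on_le)
  \<comment> \<open>The remainder 4 n^3 d must stay below e^2; the added 1 covers n = 0.\<close>
  define d where "d = e\<^sup>2 / (4 * n ^ 3 + 1)"
  have den: "4 * n ^ 3 + 1 > 0" using n(1) by (intro add_nonneg_pos) auto
  have d: "d > 0" using den e by (simp add: d_def)
  obtain x where x: "x \<in> M" "(n - d) * norm x < norm (N x)"
    using op_norm_approx[OF N nontrivial, of "n - d"] d by (auto simp: n_def)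
  have nx: "norm x > 0" using x(2) N by (cases "x = 0") auto
  let ?y = "adj_on M N (N x)"
  have NN: "norm ?y \<le> n * (n * norm x)"
    using n'[of "N x"] mult_left_mono[OF n(2)[OF x(1)] n(1)] N x(1) by simp
  have inner: "cinner ?y x = complex_of_real ((norm (N x))\<^sup>2)"
    using N x(1) by (simp add: cinner_adj_on' cinner_self)
  have lower: "(n\<^sup>2 - 2 * n * d) * (norm x)\<^sup>2 \<le> (norm (N x))\<^sup>2"
  \<comment> \<open>Squaring the inequality for \<open>x\<close> requires n - d to be nonnegative;
    otherwise the left-hand side is not positive.\<close>
  proof (cases "d \<le> n")
    case True
    have "(n\<^sup>2 - 2 * n * d) * (norm x)\<^sup>2 \<le> ((n - d) * norm x)\<^sup>2"
      unfolding power_mult_distrib by (intro mult_right_mono) (auto simp: power2_diff)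
    also have "\<dots> \<le> (norm (N x))\<^sup>2"
      using x(2) True by (intro power_mono) auto
    finally show ?thesis .
  next
    case False
    then have "n * (n - 2 * d) \<le> 0" using n(1) d by (intro mult_nonneg_nonpos) auto
    then have "(n\<^sup>2 - 2 * n * d) * (norm x)\<^sup>2 \<le> 0"
      by (intro mult_nonpos_nonneg) (auto simp: power2_eq_square algebra_simps)
    then show ?thesis by (meson order_trans zero_le_power2)
  qed
  have "(norm (?y - complex_of_real (n\<^sup>2) *\<^sub>C x))\<^sup>2
      = (norm ?y)\<^sup>2 - 2 * n\<^sup>2 * (norm (N x))\<^sup>2 + (n\<^sup>2 * norm x)\<^sup>2"
    unfolding norm_diff_square cinner_scaleC_right inner by (simp add: norm_power)
  also have "\<dots> \<le> (n * (n * norm x))\<^sup>2 - 2 * n\<^sup>2 * ((n\<^sup>2 - 2 * n * d) * (norm x)\<^sup>2) + (n\<^sup>2 * norm x)\<^sup>2"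
    using NN lower by (intro add_mono diff_mono mult_left_mono power_mono) auto
  also have "\<dots> = 4 * n ^ 3 * d * (norm x)\<^sup>2"
    by (simp add: power_mult_distrib algebra_simps power2_eq_square power3_eq_cube)
  also have "\<dots> < (4 * n ^ 3 + 1) * d * (norm x)\<^sup>2"
    using d nx by simp
  also have "\<dots> = (e * norm x)\<^sup>2"
    using den by (simp add: d_def power_mult_distrib)
  finally have "norm (?y - complex_of_real (n\<^sup>2) *\<^sub>C x) < e * norm x"
    by (rule power_less_imp_less_base) (use e in simp)
  then show ?thesis using x(1) by (auto simp: n_def)
qed

section \<open>Arithmetic of approximate values\<close>

lemma approx_value_add:
  assumes "approx_value M A z R w" "approx_value M A z S v"
  shows "approx_value M A z (op_add M R S) (w + v)"
  unfolding approx_value_def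
proof (intro allI impI)
  fix e :: real assume "e > 0"
  then have e: "e / 2 > 0" by simp
  obtain C where C: "C \<ge> 0"
    "\<And>x. x \<in> M \<Longrightarrow> norm (R x - w *\<^sub>C x) \<le> e / 2 * norm x + C * norm (A x - z *\<^sub>C x)"
    using approx_valueE[OF assms(1) e] by blast
  obtain D where D: "D \<ge> 0"
    "\<And>x. x \<in> M \<Longrightarrow> norm (S x - v *\<^sub>C x) \<le> e / 2 * norm x + D * norm (A x - z *\<^sub>C x)"
    using approx_valueE[OF assms(2) e] by blast
  have "norm (op_add M R S x - (w + v) *\<^sub>C x) \<le> e * norm x + (C + D) * norm (A x - z *\<^sub>C x)"
    if x: "x \<in> M" for x
  proof -
    have "op_add M R S x - (w + v) *\<^sub>C x = (R x - w *\<^sub>C x) + (S x - v *\<^sub>C x)"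
      using x by (simp add: scaleC_add_left)
    then have "norm (op_add M R S x - (w + v) *\<^sub>C x) \<le> norm (R x - w *\<^sub>C x) + norm (S x - v *\<^sub>C x)"
      by (metis norm_triangle_ineq)
    also have "\<dots> \<le> (e / 2 * norm x + C * norm (A x - z *\<^sub>C x)) + (e / 2 * norm x + D * norm (A x - z *\<^sub>C x))"
      using C(2)[OF x] D(2)[OF x] by (rule add_mono)
    also have "\<dots> = e * norm x + (C + D) * norm (A x - z *\<^sub>C x)"
      by (simp add: algebra_simps)
    finally show ?thesis .
  qed
  then show "\<exists>C\<ge>0. \<forall>x\<in>M. norm (op_add M R S x - (w + v) *\<^sub>C x) \<le> e * norm x + C * norm (A x - z *\<^sub>C x)"
    using C(1) D(1) by (intro exI[of _ "C + D"]) simp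
qed

lemma approx_value_id: "approx_value M A z (op_id M) 1"
  unfolding approx_value_def by (intro allI impI exI[of _ 0]) (simp add: scaleC_one)

lemma approx_value_self: "approx_value M A z A z"
  unfolding approx_value_def by (intro allI impI exI[of _ 1]) simp

lemma approx_value_compose:
  assumes R: "R \<in> bounded_ops M" and S: "S \<in> bounded_ops M"
    and "approx_value M A z R w" "approx_value M A z S v"
  shows "approx_value M A z (compose M R S) (w * v)"
  unfolding approx_value_def
proof (intro allI impI)
  fix e :: real assume e: "e > 0"
  obtain K where K: "K \<ge> 0" "\<And>x. x \<in> M \<Longrightarrow> norm (R x) \<le> K * norm x"
    using bounded_ops_bound[OF R] by blast
  \<comment> \<open>R (S - v) contributes K a and v (R - w) contributes cmod v times a; the added 1
    makes the denominator positive.\<close>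
  define a where "a = e / (K + cmod v + 1)"
  have den: "K + cmod v + 1 > 0" using K(1) by (simp add: add_nonneg_pos)
  then have a: "a > 0" using e by (simp add: a_def)
  obtain C where C: "C \<ge> 0"
    "\<And>x. x \<in> M \<Longrightarrow> norm (R x - w *\<^sub>C x) \<le> a * norm x + C * norm (A x - z *\<^sub>C x)"
    using approx_valueE[OF assms(3) a] by blast
  obtain D where D: "D \<ge> 0"
    "\<And>x. x \<in> M \<Longrightarrow> norm (S x - v *\<^sub>C x) \<le> a * norm x + D * norm (A x - z *\<^sub>C x)"
    using approx_valueE[OF assms(4) a] by blast
  define E where "E = K * D + cmod v * C"
  have "norm (compose M R S x - (w * v) *\<^sub>C x) \<le> e * norm x + E * norm (A x - z *\<^sub>C x)"
    if x: "x \<in> M" for x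
  proof -
    let ?d = "norm (A x - z *\<^sub>C x)"
    have "compose M R S x - (w * v) *\<^sub>C x = R (S x - v *\<^sub>C x) + v *\<^sub>C (R x - w *\<^sub>C x)"
      using x R S by (simp add: bounded_ops_linear scaleC_diff_right scaleC_scaleC mult.commute)
    then have "norm (compose M R S x - (w * v) *\<^sub>C x)
        \<le> norm (R (S x - v *\<^sub>C x)) + cmod v * norm (R x - w *\<^sub>C x)"
      by (metis norm_triangle_ineq norm_scaleC)
    also have "\<dots> \<le> K * (a * norm x + D * ?d) + cmod v * (a * norm x + C * ?d)"
      using K C(2)[OF x] D(2)[OF x] x S
      by (intro add_mono mult_left_mono order_trans[OF K(2)]) auto
    also have "\<dots> = (K + cmod v) * a * norm x + E * ?d"
      by (simp add: E_def algebra_simps)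
    also have "\<dots> \<le> (K + cmod v + 1) * a * norm x + E * ?d"
      using a by (intro add_right_mono mult_right_mono) auto
    also have "(K + cmod v + 1) * a = e" using den by (simp add: a_def)
    finally show ?thesis .
  qed
  moreover have "E \<ge> 0" using K C D by (simp add: E_def)
  ultimately show "\<exists>C\<ge>0. \<forall>x\<in>M. norm (compose M R S x - (w * v) *\<^sub>C x) \<le> e * norm x + C * norm (A x - z *\<^sub>C x)"
    by blast
qed

lemma approx_value_scale:
  assumes "R \<in> bounded_ops M" "approx_value M A z R w"
  shows "approx_value M A z (op_scale M c R) (c * w)"
proof -
  have "approx_value M A z (op_scale M c (op_id M)) c"
    unfolding approx_value_def by (intro allI impI exI[of _ 0]) simp
  from approx_value_compose[OF _ assms(1) this assms(2)]
  have "approx_value M A z (compose M (op_scale M c (op_id M)) R) (c * w)" by simp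
  moreover have "compose M (op_scale M c (op_id M)) R = op_scale M c R"
    using assms(1) by (auto intro: extensionalityI[of _ M])
  ultimately show ?thesis by simp
qed

lemma approx_value_diff:
  assumes "S \<in> bounded_ops M" "approx_value M A z R w" "approx_value M A z S v"
  shows "approx_value M A z (op_diff M R S) (w - v)"
  using approx_value_add[OF assms(2) approx_value_scale[OF assms(1,3), of "-1"]]
  by (simp add: op_diff_eq)

lemma approx_value_limit:
  assumes av: "\<And>n::nat. approx_value M A z (R n) (w n)" and "w \<longlonglongrightarrow> v"
    and lim: "\<And>e. e > 0 \<Longrightarrow> \<exists>N. \<forall>n\<ge>N. \<forall>x\<in>M. norm (R n x - S x) \<le> e * norm x"
  shows "approx_value M A z S v"
  unfolding approx_value_def
proof (intro allI impI)
  fix e :: real assume "e > 0"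
  then have e: "e / 3 > 0" by simp
  obtain N where N: "\<forall>n\<ge>N. \<forall>x\<in>M. norm (R n x - S x) \<le> e / 3 * norm x"
    using lim[OF e] by blast
  obtain N' where N': "\<forall>n\<ge>N'. cmod (w n - v) < e / 3"
    using \<open>w \<longlonglongrightarrow> v\<close> e unfolding LIMSEQ_iff by blast
  define n where "n = max N N'"
  obtain C where C: "C \<ge> 0"
    "\<And>x. x \<in> M \<Longrightarrow> norm (R n x - w n *\<^sub>C x) \<le> e / 3 * norm x + C * norm (A x - z *\<^sub>C x)"
    using approx_valueE[OF av[of n] e] by blast
  have "norm (S x - v *\<^sub>C x) \<le> e * norm x + C * norm (A x - z *\<^sub>C x)" if x: "x \<in> M" for x
  proof -
    have "S x - v *\<^sub>C x = (R n x - w n *\<^sub>C x) + (w n - v) *\<^sub>C x - (R n x - S x)"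
      by (simp add: scaleC_diff_left)
    then have "norm (S x - v *\<^sub>C x)
        \<le> norm (R n x - w n *\<^sub>C x) + norm ((w n - v) *\<^sub>C x) + norm (R n x - S x)"
      using order_trans[OF norm_triangle_ineq4 add_right_mono[OF norm_triangle_ineq]] by metis
    also have "\<dots> \<le> (e / 3 * norm x + C * norm (A x - z *\<^sub>C x)) + e / 3 * norm x + e / 3 * norm x"
    proof (intro add_mono C(2)[OF x])
      show "norm ((w n - v) *\<^sub>C x) \<le> e / 3 * norm x"
        unfolding norm_scaleC using N'[rule_format, of n]
        by (intro mult_right_mono) (auto simp: n_def less_imp_le)
      show "norm (R n x - S x) \<le> e / 3 * norm x"
        using N x by (simp add: n_def)
    qed
    finally show ?thesis by simp
  qed
  then show "\<exists>C\<ge>0. \<forall>x\<in>M. norm (S x - v *\<^sub>C x) \<le> e * norm x + C * norm (A x - z *\<^sub>C x)"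
    using C(1) by blast
qed

text \<open>On vectors that are nearly eigenvectors both of \<open>A\<close> at z and of
  \<open>R\<close> at v, \<open>R\<close> acts nearly as w and as v at once. This identifies a
  number found by joint approximation with the value given by the relation.\<close>

lemma approx_value_joint_eq:
  assumes w: "approx_value M A z R w"
    and joint: "\<And>e. e > 0 \<Longrightarrow> \<exists>x\<in>M. norm (A x - z *\<^sub>C x) + norm (R x - v *\<^sub>C x) < e * norm x"
  shows "w = v"
proof -
  have "cmod (w - v) \<le> e" if e: "e > 0" for e
  proof -
    obtain C where C: "C \<ge> 0"
      "\<And>x. x \<in> M \<Longrightarrow> norm (R x - w *\<^sub>C x) \<le> e / 2 * norm x + C * norm (A x - z *\<^sub>C x)"
      using approx_valueE[OF w, of "e / 2"] e by auto
    define a where "a = e / 2 / (C + 1)"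
    have a: "a > 0" using e C(1) by (simp add: a_def)
    have Ca: "(C + 1) * a = e / 2"
      unfolding a_def using C(1) by (metis add_nonneg_eq_0_iff nonzero_mult_div_cancel_left
          times_divide_eq_right zero_le_one zero_neq_one)
    obtain x where x: "x \<in> M" "norm (A x - z *\<^sub>C x) + norm (R x - v *\<^sub>C x) < a * norm x"
      using joint[OF a] by blast
    let ?p = "norm (A x - z *\<^sub>C x)" and ?q = "norm (R x - v *\<^sub>C x)"
    have nx: "norm x > 0"
    proof -
      have "a * norm x > 0" using x(2) norm_ge_zero[of "A x - z *\<^sub>C x"] norm_ge_zero[of "R x - v *\<^sub>C x"]
        by linarith
      then show ?thesis using a by (simp add: zero_less_mult_iff)
    qed
    have "cmod (w - v) * norm x = norm ((R x - v *\<^sub>C x) - (R x - w *\<^sub>C x))"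
      by (simp flip: norm_scaleC add: scaleC_diff_left)
    also have "\<dots> \<le> ?q + norm (R x - w *\<^sub>C x)" by (rule norm_triangle_ineq4)
    also have "\<dots> \<le> ?q + (e / 2 * norm x + C * ?p)" using C(2)[OF x(1)] by simp
    also have "\<dots> \<le> e / 2 * norm x + (C + 1) * (?p + ?q)"
      using C(1) by (simp add: algebra_simps)
    also have "\<dots> \<le> e / 2 * norm x + (C + 1) * (a * norm x)"
      using C(1) x(2) by (intro add_left_mono mult_left_mono) auto
    also have "\<dots> = e / 2 * norm x + (C + 1) * a * norm x" by simp
    also have "\<dots> = e * norm x" unfolding Ca by simp
    finally show ?thesis using nx by simp
  qed
  then have "cmod (w - v) \<le> 0" by (rule field_le_epsilon[of _ 0, simplified])
  then show ?thesis by simp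
qed

text \<open>Evaluate the relation on an approximate eigenvector of \<open>A\<close>. This
  contractivity yields uniqueness of values and their convergence along norm limits.\<close>

lemma approx_value_le:
  assumes z: "z \<in> approx_spectrum M A" and av: "approx_value M A z R w"
    and K: "\<And>x. x \<in> M \<Longrightarrow> norm (R x) \<le> K * norm x"
  shows "cmod w \<le> K"
proof (rule field_le_epsilon)
  fix e :: real assume "e > 0"
  then have e: "e / 2 > 0" by simp
  obtain C where C: "C \<ge> 0"
    "\<And>x. x \<in> M \<Longrightarrow> norm (R x - w *\<^sub>C x) \<le> e / 2 * norm x + C * norm (A x - z *\<^sub>C x)"
    using approx_valueE[OF av e] by blast
  define a where "a = e / 2 / (C + 1)"
  have a: "a > 0" using e C(1) by (simp add: a_def)
  have Ca: "(C + 1) * a = e / 2"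
    unfolding a_def using C(1) by (metis add_nonneg_eq_0_iff nonzero_mult_div_cancel_left
        times_divide_eq_right zero_le_one zero_neq_one)
  obtain x where x: "x \<in> M" "norm x > 0" "norm (A x - z *\<^sub>C x) < a * norm x"
    using approx_spectrumE[OF z a] by blast
  have "cmod w * norm x \<le> norm (R x) + norm (R x - w *\<^sub>C x)"
    using norm_triangle_sub[of "w *\<^sub>C x" "R x"] by (simp add: norm_minus_commute)
  also have "\<dots> \<le> K * norm x + (e / 2 * norm x + C * (a * norm x))"
    using K[OF x(1)] C(2)[OF x(1)] mult_left_mono[OF less_imp_le[OF x(3)] C(1)] by simp
  also have "\<dots> \<le> K * norm x + (e / 2 * norm x + (C + 1) * a * norm x)"
    using a by (simp add: algebra_simps)
  also have "\<dots> = (K + e) * norm x" unfolding Ca by (simp add: algebra_simps)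
  finally show "cmod w \<le> K + e" using x(2) by simp
qed

text \<open>The zero operator R - R has the value w - v, and the preceding bound holds with K =
  0.\<close>

lemma approx_value_unique:
  assumes z: "z \<in> approx_spectrum M A" and R: "R \<in> bounded_ops M"
    and "approx_value M A z R w" "approx_value M A z R v"
  shows "w = v"
  using approx_value_le[OF z approx_value_diff[OF R assms(3,4)], of 0] by simp

end

section \<open>The Gelfand isomorphism of a normal operator\<close>

lemma character_apply:
  assumes "h \<in> characters M \<A>"
  shows "A \<in> \<A> \<Longrightarrow> B \<in> \<A> \<Longrightarrow> h (op_add M A B) = h A + h B"
    "A \<in> \<A> \<Longrightarrow> h (op_scale M c A) = c * h A"
    "A \<in> \<A> \<Longrightarrow> B \<in> \<A> \<Longrightarrow> h (compose M A B) = h A * h B"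
    "\<exists>A\<in>\<A>. h A \<noteq> 0" "h \<in> extensional \<A>"
  using assms by (auto simp: characters_def)

locale normal_operator = closed_csubspace M for M :: "'a::complex_hilbert_space set" +
  fixes A :: "'a \<Rightarrow> 'a"
  assumes nontrivial: "M \<noteq> {0}" and A [simp]: "A \<in> bounded_ops M"
    and normal: "compose M A (adj_on M A) = compose M (adj_on M A) A"
begin

abbreviation \<A> where "\<A> \<equiv> cstar_gen M A"

abbreviation \<sigma> where "\<sigma> \<equiv> approx_spectrum M A"

lemmas \<A>_subalgebra = cstar_gen_subalgebra[OF A]

lemmas \<A>_closed [simp, intro] = cstar_gen_gens
  cstar_subalgebra_add[OF \<A>_subalgebra] cstar_subalgebra_scale[OF \<A>_subalgebra]
  cstar_subalgebra_compose[OF \<A>_subalgebra] cstar_subalgebra_adj[OF \<A>_subalgebra]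
  cstar_subalgebra_diff[OF \<A>_subalgebra] cstar_subalgebra_bounded[OF \<A>_subalgebra]

lemma normal_apply: "x \<in> M \<Longrightarrow> A (adj_on M A x) = adj_on M A (A x)"
  using fun_cong[OF normal, of x] by simp

text \<open>Commuting with \<open>A\<close> alone is not visibly stable under adjoints without
  Fuglede's theorem; commuting with \<open>A\<close> and its adjoint is, and normality puts both
  generators into this commutant.\<close>

lemma commute:
  assumes "R \<in> \<A>"
  shows "x \<in> M \<Longrightarrow> R (A x) = A (R x)" "x \<in> M \<Longrightarrow> R (adj_on M A x) = adj_on M A (R x)"
proof -
  define \<S> where "\<S> = {R \<in> bounded_ops M.
    (\<forall>x\<in>M. R (A x) = A (R x)) \<and> (\<forall>x\<in>M. R (adj_on M A x) = adj_on M A (R x))}"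
  have lim: "R (B x) = B (R x)" if R: "R \<in> bounded_ops M" and B: "B \<in> bounded_ops M" and x: "x \<in> M"
    and ap: "\<And>e. e > 0 \<Longrightarrow> \<exists>S\<in>\<S>. \<forall>x\<in>M. norm (S x - R x) \<le> e * norm x"
    and \<S>: "\<And>S. S \<in> \<S> \<Longrightarrow> S (B x) = B (S x)" for R B x
  proof -
    obtain K where K: "K \<ge> 0" "\<And>x. x \<in> M \<Longrightarrow> norm (B x) \<le> K * norm x"
      using bounded_ops_bound[OF B] by blast
    have "norm (R (B x) - B (R x)) \<le> e" if e: "e > 0" for e
    proof -
      define d where "d = e / (2 * K * norm x + 1)"
      have den: "2 * K * norm x + 1 > 0" using K(1) by (simp add: add_nonneg_pos)
      then have d: "d > 0" using e by (simp add: d_def)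
      obtain S where S: "S \<in> \<S>" "\<forall>x\<in>M. norm (S x - R x) \<le> d * norm x"
        using ap[OF d] by blast
      have Sb: "S \<in> bounded_ops M" using S(1) by (simp add: \<S>_def)
      \<comment> \<open>As \<open>S\<close> commutes with \<open>B\<close>, the commutator of
        \<open>R\<close> with \<open>B\<close> equals that of R - S, which is small.\<close>
      have "R (B x) - B (R x) = B (S x - R x) - (S (B x) - R (B x))"
        using \<S>[OF S(1)] Sb R B x by (simp add: bounded_ops_diff)
      then have "norm (R (B x) - B (R x)) \<le> norm (B (S x - R x)) + norm (S (B x) - R (B x))"
        using norm_triangle_ineq4 by metis
      also have "\<dots> \<le> K * (d * norm x) + d * (K * norm x)"
        using S(2) K d Sb R B x
        by (intro add_mono order_trans[OF K(2)] order_trans[OF S(2)[rule_format]] mult_left_mono) auto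
      also have "\<dots> \<le> (2 * K * norm x + 1) * d" using d by (simp add: algebra_simps)
      also have "\<dots> = e" using den by (simp add: d_def)
      finally show ?thesis .
    qed
    then have "norm (R (B x) - B (R x)) \<le> 0" by (rule field_le_epsilon[of _ 0, simplified])
    then show ?thesis by simp
  qed
  have "cstar_subalgebra M \<S>"
  proof (rule cstar_subalgebraI)
    fix R assume R: "R \<in> \<S>"
    then have Rb: "R \<in> bounded_ops M" by (simp add: \<S>_def)
    have "adj_on M R (A x) = A (adj_on M R x) \<and> adj_on M R (adj_on M A x) = adj_on M A (adj_on M R x)"
      if x: "x \<in> M" for x
    proof (intro conjI; rule cinner_eqI)
      fix y assume y: "y \<in> M"
      show "cinner y (adj_on M R (A x)) = cinner y (A (adj_on M R x))"
        using R Rb x y by (simp add: cinner_adj_on[symmetric] cinner_adj_on'[symmetric] \<S>_def)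
      show "cinner y (adj_on M R (adj_on M A x)) = cinner y (adj_on M A (adj_on M R x))"
        using R Rb x y by (simp add: cinner_adj_on[symmetric] \<S>_def)
    qed (use Rb x in auto)
    with Rb show "adj_on M R \<in> \<S>" by (simp add: \<S>_def)
  next
    fix R assume R: "R \<in> bounded_ops M"
      "\<And>e. e > 0 \<Longrightarrow> \<exists>S\<in>\<S>. \<forall>x\<in>M. norm (S x - R x) \<le> e * norm x"
    have "\<And>x. x \<in> M \<Longrightarrow> R (A x) = A (R x)" "\<And>x. x \<in> M \<Longrightarrow> R (adj_on M A x) = adj_on M A (R x)"
      by (rule lim[OF R(1) _ _ R(2)]; simp add: \<S>_def)+
    with R(1) show "R \<in> \<S>" by (simp add: \<S>_def)
  qed (auto simp: \<S>_def bounded_ops_linear)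
  then have "R \<in> \<S>"
    by (rule cstar_gen_induct[OF assms]) (auto simp: \<S>_def normal_apply)
  then show "x \<in> M \<Longrightarrow> R (A x) = A (R x)" "x \<in> M \<Longrightarrow> R (adj_on M A x) = adj_on M A (R x)"
    by (auto simp: \<S>_def)
qed

text \<open>A normal operator and its adjoint have equal norms on every vector, and the cross terms
  with \<open>z\<close> have the same real part. This makes cnj z the value of the adjoint.\<close>

lemma norm_adj_diff:
  assumes "x \<in> M"
  shows "norm (adj_on M A x - cnj z *\<^sub>C x) = norm (A x - z *\<^sub>C x)"
proof -
  have "(norm (adj_on M A x))\<^sup>2 = (norm (A x))\<^sup>2"
    using assms by (simp add: norm_square cinner_adj_on cinner_adj_on' normal_apply)
  moreover have "Re (cinner (adj_on M A x) (cnj z *\<^sub>C x)) = Re (cinner (A x) (z *\<^sub>C x))"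
    using assms arg_cong[OF cinner_commute[of x "A x"], of Re] arg_cong[OF cinner_commute[of x "A x"], of Im]
    by (simp add: cinner_scaleC_right cinner_adj_on')
  ultimately have "(norm (adj_on M A x - cnj z *\<^sub>C x))\<^sup>2 = (norm (A x - z *\<^sub>C x))\<^sup>2"
    unfolding norm_diff_square by simp
  then show ?thesis by (simp add: power2_eq_iff_nonneg)
qed

lemma approx_value_adj_self: "approx_value M A z (adj_on M A) (cnj z)"
  unfolding approx_value_def by (intro allI impI exI[of _ 1]) (simp add: norm_adj_diff)

text \<open>The value of the adjoint is part of the induction because the set of operators with a
  value must be closed under adjoints to be a C*-subalgebra.\<close>

lemma approx_value_exists:
  assumes z: "z \<in> \<sigma>" and "R \<in> \<A>"
  obtains w where "approx_value M A z R w" "approx_value M A z (adj_on M R) (cnj w)"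
proof -
  define \<S> where "\<S> = {R \<in> bounded_ops M.
    \<exists>w. approx_value M A z R w \<and> approx_value M A z (adj_on M R) (cnj w)}"
  have "cstar_subalgebra M \<S>"
  proof (rule cstar_subalgebraI)
    fix R S assume "R \<in> \<S>" "S \<in> \<S>"
    then obtain w v where *: "R \<in> bounded_ops M" "S \<in> bounded_ops M"
      "approx_value M A z R w" "approx_value M A z (adj_on M R) (cnj w)"
      "approx_value M A z S v" "approx_value M A z (adj_on M S) (cnj v)"
      by (auto simp: \<S>_def)
    then have "approx_value M A z (op_add M R S) (w + v)"
      "approx_value M A z (adj_on M (op_add M R S)) (cnj (w + v))"
      by (auto intro: approx_value_add)
    with * show "op_add M R S \<in> \<S>" unfolding \<S>_def by auto
    have "approx_value M A z (compose M R S) (w * v)" using * by (intro approx_value_compose)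
    moreover have "approx_value M A z (adj_on M (compose M R S)) (cnj (w * v))"
      using approx_value_compose[OF _ _ *(6) *(4)] * by (simp add: mult.commute)
    ultimately show "compose M R S \<in> \<S>" using * unfolding \<S>_def by auto
  next
    fix c R assume "R \<in> \<S>"
    then obtain w where *: "R \<in> bounded_ops M"
      "approx_value M A z R w" "approx_value M A z (adj_on M R) (cnj w)"
      by (auto simp: \<S>_def)
    then have "approx_value M A z (op_scale M c R) (c * w)"
      "approx_value M A z (adj_on M (op_scale M c R)) (cnj (c * w))"
      by (auto intro: approx_value_scale)
    with * show "op_scale M c R \<in> \<S>" unfolding \<S>_def by auto
  next
    fix R assume "R \<in> \<S>"
    then obtain w where "R \<in> bounded_ops M"
      "approx_value M A z R w" "approx_value M A z (adj_on M R) (cnj w)"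
      by (auto simp: \<S>_def)
    then show "adj_on M R \<in> \<S>"
      unfolding \<S>_def by (auto intro!: exI[of _ "cnj w"])
  next
    fix R assume R: "R \<in> bounded_ops M"
      and ap: "\<And>e. e > 0 \<Longrightarrow> \<exists>S\<in>\<S>. \<forall>x\<in>M. norm (S x - R x) \<le> e * norm x"
    have "\<exists>S::nat \<Rightarrow> 'a \<Rightarrow> 'a. (\<forall>n. S n \<in> \<S>) \<and>
      (\<forall>e>0. \<exists>N. \<forall>n\<ge>N. \<forall>x\<in>M. norm (S n x - R x) \<le> e * norm x)"
      by (rule approx_sequence) (rule ap)
    then obtain S where S': "(\<forall>n. S n \<in> \<S>) \<and>
      (\<forall>e>0. \<exists>N. \<forall>n\<ge>N. \<forall>x\<in>M. norm (S (n::nat) x - R x) \<le> e * norm x)" ..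
    note S = S'[THEN conjunct1, rule_format] S'[THEN conjunct2, rule_format]
    have Sb: "S n \<in> bounded_ops M" for n using S(1) by (simp add: \<S>_def)
    have "\<forall>n. \<exists>w. approx_value M A z (S n) w \<and> approx_value M A z (adj_on M (S n)) (cnj w)"
      using S(1) by (auto simp: \<S>_def)
    then obtain w where w: "\<And>n. approx_value M A z (S n) (w n)"
      "\<And>n. approx_value M A z (adj_on M (S n)) (cnj (w n))"
      by metis
    have S_adj: "\<exists>N. \<forall>n\<ge>N. \<forall>x\<in>M. norm (adj_on M (S n) x - adj_on M R x) \<le> e * norm x"
      if e: "e > 0" for e
    proof -
      obtain N where N: "\<forall>n\<ge>N. \<forall>x\<in>M. norm (S n x - R x) \<le> e * norm x"
        using S(2)[OF e] by blast
      have "norm (adj_on M (S n) x - adj_on M R x) \<le> e * norm x" if "n \<ge> N" "x \<in> M" for n x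
        using norm_adj_on_le[of "op_diff M (S n) R" e x] N Sb R that by simp
      then show ?thesis by blast
    qed
    \<comment> \<open>A difference of approximants has the difference of their values as its value,
      and at spectral points values are bounded by norms.\<close>
    have "Cauchy w"
    proof (rule metric_CauchyI)
      fix e :: real assume "e > 0"
      then have "e / 3 > 0" by simp
      then obtain N where N: "\<forall>n\<ge>N. \<forall>x\<in>M. norm (S n x - R x) \<le> e / 3 * norm x"
        using S(2) by blast
      have "dist (w m) (w n) < e" if mn: "m \<ge> N" "n \<ge> N" for m n
      proof -
        have "cmod (w m - w n) \<le> 2 * e / 3"
        proof (rule approx_value_le[OF z approx_value_diff[OF Sb w(1) w(1)]])
          fix x assume x: "x \<in> M"
          have "norm (op_diff M (S m) (S n) x) \<le> norm (S m x - R x) + norm (S n x - R x)"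
            using x norm_triangle_ineq4[of "S m x - R x" "S n x - R x"] by simp
          also have "\<dots> \<le> e / 3 * norm x + e / 3 * norm x"
            by (intro add_mono N[rule_format] mn x)
          finally show "norm (op_diff M (S m) (S n) x) \<le> 2 * e / 3 * norm x" by simp
        qed
        then show ?thesis using \<open>e > 0\<close> by (simp add: dist_norm)
      qed
      then show "\<exists>N. \<forall>m\<ge>N. \<forall>n\<ge>N. dist (w m) (w n) < e" by blast
    qed
    then obtain v where v: "w \<longlonglongrightarrow> v"
      using Cauchy_convergent_iff convergent_def by blast
    have "approx_value M A z R v"
      using w(1) v S(2) by (rule approx_value_limit)
    moreover have "approx_value M A z (adj_on M R) (cnj v)"
      using w(2) tendsto_cnj[OF v] S_adj by (rule approx_value_limit)
    ultimately show "R \<in> \<S>" using R by (auto simp: \<S>_def)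
  qed (auto simp: \<S>_def)
  moreover have "op_id M \<in> \<S>" "A \<in> \<S>" "adj_on M A \<in> \<S>"
    using approx_value_id[of A z] approx_value_self[of A z] approx_value_adj_self[of z]
    by (auto simp: \<S>_def intro: exI[of _ 1] exI[of _ z] exI[of _ "cnj z"])
  ultimately have "R \<in> \<S>"
    using assms(2) by (blast intro: cstar_gen_induct)
  then show ?thesis using that by (auto simp: \<S>_def)
qed

lemma approx_value_adj:
  assumes "z \<in> \<sigma>" "R \<in> \<A>" "approx_value M A z R w"
  shows "approx_value M A z (adj_on M R) (cnj w)"
proof -
  obtain v where v: "approx_value M A z R v" "approx_value M A z (adj_on M R) (cnj v)"
    using approx_value_exists[OF assms(1,2)] .
  moreover have "w = v"
    using approx_value_unique[OF assms(1) _ assms(3) v(1)] assms(2) by blast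
  ultimately show ?thesis by simp
qed

lemma norm_attained:
  assumes R: "R \<in> \<A>"
  obtains z w where "z \<in> \<sigma>" "approx_value M A z R w" "cmod w = op_norm M R"
proof -
  define n where "n = op_norm M R"
  have Rb: "R \<in> bounded_ops M" using R by blast
  define Q where "Q = op_diff M (compose M (adj_on M R) R) (op_scale M (complex_of_real (n\<^sup>2)) (op_id M))"
  have Q: "Q \<in> \<A>" unfolding Q_def using R by simp
  then have Qb: "Q \<in> bounded_ops M" by blast
  have Q_approx: "\<exists>x\<in>M. norm (Q x) < e * norm x" if "e > 0" for e
    using op_norm_approx_eigen[OF Rb nontrivial that] by (auto simp: Q_def n_def)
  define X where "X = op_scale M (1 / 2) (op_add M A (adj_on M A))"
  define Y where "Y = op_scale M (1 / (2 * \<i>)) (op_diff M A (adj_on M A))"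
  have XY: "X \<in> \<A>" "Y \<in> \<A>" unfolding X_def Y_def by auto
  then have XYb: "X \<in> bounded_ops M" "Y \<in> bounded_ops M" by auto
  have X_sa: "adj_on M X = X"
    unfolding X_def by (auto intro!: extensionalityI[of _ M] simp: add.commute)
  have Y_sa: "adj_on M Y = Y"
    unfolding Y_def
    by (auto intro!: extensionalityI[of _ M] simp: scaleC_diff_right scaleC_minus_left)
  have AXY: "A x = X x + \<i> *\<^sub>C Y x" if "x \<in> M" for x
    using that by (simp add: X_def Y_def scaleC_scaleC scaleC_diff_right scaleC_add_right)
       (simp flip: scaleC_add_left add: scaleC_one)
  have comm: "S (X x) = X (S x)" "S (Y x) = Y (S x)" if "S \<in> \<A>" "x \<in> M" for S x
  proof -
    have "S \<in> bounded_ops M" using that by blast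
    then show "S (X x) = X (S x)" "S (Y x) = Y (S x)"
      using commute[OF that(1) that(2)] that(2) unfolding X_def Y_def
      by (simp_all add: bounded_ops_linear)
  qed
  obtain K where K: "K \<ge> 0" "\<And>x. x \<in> M \<Longrightarrow> norm (X x) \<le> K * norm x"
    using bounded_ops_bound[OF XYb(1)] by blast
  obtain L where L: "L \<ge> 0" "\<And>x. x \<in> M \<Longrightarrow> norm (Y x) \<le> L * norm x"
    using bounded_ops_bound[OF XYb(2)] by blast
  obtain s where s: "\<And>e. e > 0 \<Longrightarrow>
      \<exists>x\<in>M. norm (Q x) + norm (X x - complex_of_real s *\<^sub>C x) < e * norm x"
  proof (rule selfadjoint_joint_approx[OF XYb(1) X_sa, of "\<lambda>x. norm (Q x)" K])
    show "norm (Q (X x)) \<le> K * norm (Q x)" if "x \<in> M" for x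
      using K(2)[of "Q x"] comm(1)[OF Q that] Qb that by simp
  qed (use Qb Q_approx in \<open>auto simp: bounded_ops_linear norm_triangle_ineq\<close>)
  \<comment> \<open>The second application starts from vectors with small \<open>Q\<close> and
    \<open>X\<close> defects; \<open>q\<close> is stable under \<open>Y\<close> because
    \<open>Y\<close> commutes with \<open>Q\<close> and with \<open>X\<close>.\<close>
  define q where "q x = norm (Q x) + norm (X x - complex_of_real s *\<^sub>C x)" for x
  obtain t where t: "\<And>e. e > 0 \<Longrightarrow> \<exists>x\<in>M. q x + norm (Y x - complex_of_real t *\<^sub>C x) < e * norm x"
  proof (rule selfadjoint_joint_approx[OF XYb(2) Y_sa, of q L])
    fix x assume x: "x \<in> M"
    have "Q (Y x) = Y (Q x)" "X (Y x) - complex_of_real s *\<^sub>C Y x = Y (X x - complex_of_real s *\<^sub>C x)"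
      using comm(2)[OF Q x] comm(2)[OF XY(1) x] XYb x by (simp_all add: bounded_ops_linear)
    then show "q (Y x) \<le> L * q x"
      using L(2)[of "Q x"] L(2)[of "X x - complex_of_real s *\<^sub>C x"] Qb XYb x
      by (simp add: q_def distrib_left)
    fix c
    have "X (c *\<^sub>C x) - complex_of_real s *\<^sub>C c *\<^sub>C x = c *\<^sub>C (X x - complex_of_real s *\<^sub>C x)"
      using XYb x by (simp add: bounded_ops_linear scaleC_diff_right scaleC_scaleC mult.commute)
    then show "q (c *\<^sub>C x) \<le> cmod c * q x"
      using Qb x by (simp add: q_def bounded_ops_linear distrib_left)
  next
    fix x y assume x: "x \<in> M" and y: "y \<in> M"
    have "X (x + y) - complex_of_real s *\<^sub>C (x + y)
        = (X x - complex_of_real s *\<^sub>C x) + (X y - complex_of_real s *\<^sub>C y)"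
      using XYb x y by (simp add: bounded_ops_linear scaleC_add_right)
    then show "q (x + y) \<le> q x + q y"
      using norm_triangle_ineq[of "Q x" "Q y"]
        norm_triangle_ineq[of "X x - complex_of_real s *\<^sub>C x" "X y - complex_of_real s *\<^sub>C y"]
        Qb x y by (simp add: q_def bounded_ops_linear)
  next
    show "\<exists>x\<in>M. q x < e * norm x" if "e > 0" for e using s[OF that] by (simp add: q_def)
  qed (auto simp: q_def)
  define z where "z = Complex s t"
  have joint: "\<exists>x\<in>M. norm (Q x) + norm (A x - z *\<^sub>C x) < e * norm x" if e: "e > 0" for e
  proof -
    obtain x where x: "x \<in> M" "q x + norm (Y x - complex_of_real t *\<^sub>C x) < e * norm x"
      using t[OF e] by blast
    have "z = complex_of_real s + \<i> * complex_of_real t"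
      by (simp add: z_def complex_eq_iff)
    then have "A x - z *\<^sub>C x
        = (X x - complex_of_real s *\<^sub>C x) + \<i> *\<^sub>C (Y x - complex_of_real t *\<^sub>C x)"
      using x(1) by (simp add: AXY scaleC_diff_right scaleC_add_left scaleC_scaleC)
    then have "norm (A x - z *\<^sub>C x)
        \<le> norm (X x - complex_of_real s *\<^sub>C x) + norm (Y x - complex_of_real t *\<^sub>C x)"
      using norm_triangle_ineq[of "X x - complex_of_real s *\<^sub>C x" "\<i> *\<^sub>C (Y x - complex_of_real t *\<^sub>C x)"]
      by simp
    with x show ?thesis unfolding q_def by (intro bexI[of _ x]) auto
  qed
  have z: "z \<in> \<sigma>"
    unfolding approx_spectrum_def
  proof (intro CollectI allI impI)
    fix e :: real assume "e > 0"
    then obtain x where "x \<in> M" "norm (Q x) + norm (A x - z *\<^sub>C x) < e * norm x" using joint by blast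
    then show "\<exists>x\<in>M. norm (A x - z *\<^sub>C x) < e * norm x"
      using norm_ge_zero[of "Q x"] by (intro bexI[of _ x]) linarith+
  qed
  obtain w where w: "approx_value M A z R w" "approx_value M A z (adj_on M R) (cnj w)"
    using approx_value_exists[OF z R] .
  \<comment> \<open>Arithmetic gives \<open>Q\<close> the value cmod w^2 - n^2 at z, while the joint
    approximation gives it the value 0; hence cmod w = n.\<close>
  define v where "v = cnj w * w - complex_of_real (n\<^sup>2)"
  have "approx_value M A z (op_scale M (complex_of_real (n\<^sup>2)) (op_id M)) (complex_of_real (n\<^sup>2) * 1)"
    by (intro approx_value_scale approx_value_id) simp
  then have v: "approx_value M A z Q v"
    unfolding Q_def v_def using w Rb
    by (intro approx_value_diff approx_value_compose) auto
  have "v = 0"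
    using v by (rule approx_value_joint_eq) (use joint in \<open>simp add: add.commute\<close>)
  then have "complex_of_real ((cmod w)\<^sup>2) = complex_of_real (n\<^sup>2)"
    by (simp add: v_def complex_norm_square mult.commute del: of_real_power)
  then have "(cmod w)\<^sup>2 = n\<^sup>2" by (simp only: of_real_eq_iff)
  then have "cmod w = n"
    using op_norm_nonneg[OF Rb] by (simp add: power2_eq_iff_nonneg n_def)
  with z w(1) that show ?thesis by (simp add: n_def)
qed

text \<open>Off the approximate spectrum z - A is bounded below, so its adjoint times itself is
  coercive. The inverse of that product yields a left inverse, which normality makes
  two-sided.\<close>

lemma spectral_inverse:
  assumes z: "z \<notin> \<sigma>"
  shows "invertible_in M (bounded_ops M) (op_diff M (op_scale M z (op_id M)) A)"
proof -
  define B where "B = op_diff M (op_scale M z (op_id M)) A"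
  have B: "B \<in> \<A>" unfolding B_def by simp
  then have Bb [simp]: "B \<in> bounded_ops M" by blast
  have B_apply: "B x = - (A x - z *\<^sub>C x)" if "x \<in> M" for x
    using that by (simp add: B_def)
  obtain e where e: "e > 0" "\<And>x. x \<in> M \<Longrightarrow> e * norm x \<le> norm (B x)"
    using z unfolding approx_spectrum_def by (auto simp: not_less B_apply simp del: minus_diff_eq)
  define S where "S = compose M (adj_on M B) B"
  have S: "S \<in> \<A>" unfolding S_def using B by simp
  have coercive: "e\<^sup>2 * (norm x)\<^sup>2 \<le> Re (cinner (S x) x)" if x: "x \<in> M" for x
  proof -
    have "(e * norm x)\<^sup>2 \<le> (norm (B x))\<^sup>2" using e x by (intro power_mono) auto
    then show ?thesis using x by (simp add: S_def cinner_adj_on' norm_square power_mult_distrib)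
  qed
  obtain V where V: "V \<in> \<A>" "compose M S V = op_id M" "compose M V S = op_id M"
    using coercive_inverse[OF \<A>_subalgebra \<A>_closed(1) S _ coercive] e(1) by auto
  then have Vb [simp]: "V \<in> bounded_ops M" by blast
  have SV: "S (V x) = x" and VS: "V (S x) = x" if "x \<in> M" for x
    using fun_cong[OF V(2), of x] fun_cong[OF V(3), of x] that by simp_all
  have BB: "B (adj_on M B x) = S x" if x: "x \<in> M" for x
  proof -
    have "adj_on M B = op_diff M (op_scale M (cnj z) (op_id M)) (adj_on M A)"
      by (simp add: B_def)
    then show ?thesis
      using x commute[OF B] unfolding S_def by (simp add: bounded_ops_linear)
  qed
  define W where "W = compose M V (adj_on M B)"
  have W: "W \<in> bounded_ops M" by (simp add: W_def)
  have WB: "W (B x) = x" if "x \<in> M" for x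
    using VS[OF that] that by (simp add: W_def S_def)
  \<comment> \<open>\<open>B\<close> commutes with its adjoint, so it maps this right-hand side to S
    (V x) = x; applying the left inverse \<open>W\<close> identifies W x.\<close>
  have "W x = adj_on M B (V x)" if x: "x \<in> M" for x
    using WB[of "adj_on M B (V x)"] BB[of "V x"] SV[OF x] x by simp
  then have BW: "B (W x) = x" if "x \<in> M" for x
    using BB[of "V x"] SV[OF that] that by simp
  have "compose M W B = op_id M" "compose M B W = op_id M"
    using WB BW by (auto intro: extensionalityI[of _ M])
  then show ?thesis unfolding invertible_in_def B_def[symmetric] using W by blast
qed

text \<open>By \<open>spectral_inverse\<close> every spectral point is an approximate eigenvalue;
  conversely an inverse with bound K excludes relative defects below 1 / (K + 1).\<close>

lemma op_spectrum_eq: "op_spectrum M A = \<sigma>"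
proof
  show "op_spectrum M A \<subseteq> \<sigma>"
    using spectral_inverse by (auto simp: op_spectrum_def spectrum_in_def)
  show "\<sigma> \<subseteq> op_spectrum M A"
  proof
    fix z assume z: "z \<in> \<sigma>"
    have False if "invertible_in M (bounded_ops M) (op_diff M (op_scale M z (op_id M)) A)"
    proof -
      obtain S where S: "S \<in> bounded_ops M"
        "compose M S (op_diff M (op_scale M z (op_id M)) A) = op_id M"
        using \<open>invertible_in _ _ _\<close> unfolding invertible_in_def by blast
      obtain K where K: "K \<ge> 0" "\<And>x. x \<in> M \<Longrightarrow> norm (S x) \<le> K * norm x"
        using bounded_ops_bound[OF S(1)] by blast
      obtain x where x: "x \<in> M" "norm x > 0" "norm (A x - z *\<^sub>C x) < 1 / (K + 1) * norm x"
        using approx_spectrumE[OF z, of "1 / (K + 1)"] K(1) by auto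
      have "S (z *\<^sub>C x - A x) = x"
        using fun_cong[OF S(2), of x] x(1) by simp
      then have "norm x \<le> K * norm (A x - z *\<^sub>C x)"
        using K(2)[of "z *\<^sub>C x - A x"] x(1) by (simp add: norm_minus_commute)
      also have "\<dots> \<le> K * (1 / (K + 1) * norm x)"
        using K(1) x(3) by (intro mult_left_mono) auto
      also have "\<dots> < norm x" using K(1) x(2) by (simp add: field_simps)
      finally show False by simp
    qed
    then show "z \<in> op_spectrum M A" by (auto simp: op_spectrum_def spectrum_in_def)
  qed
qed

lemma compact_spectrum: "compact \<sigma>"
proof -
  obtain K where K: "K \<ge> 0" "\<And>x. x \<in> M \<Longrightarrow> norm (A x) \<le> K * norm x"
    using bounded_ops_bound[OF A] by blast
  have "cmod z \<le> K" if "z \<in> \<sigma>" for z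
    using that approx_value_self K(2) by (rule approx_value_le)
  then have "bounded \<sigma>" by (auto simp: bounded_iff)
  moreover have "closed \<sigma>"
    unfolding closed_sequential_limits
  proof (intro allI impI)
    fix u z assume *: "(\<forall>n. u n \<in> \<sigma>) \<and> u \<longlonglongrightarrow> z"
    show "z \<in> \<sigma>"
      unfolding approx_spectrum_def
    proof (intro CollectI allI impI)
      fix e :: real assume "e > 0"
      then have e: "e / 2 > 0" by simp
      obtain n where n: "cmod (u n - z) < e / 2"
        using * e unfolding LIMSEQ_iff by blast
      have "u n \<in> \<sigma>" using * by blast
      then obtain x where x: "x \<in> M" "norm x > 0" "norm (A x - u n *\<^sub>C x) < e / 2 * norm x"
        using approx_spectrumE e by blast
      have "norm (A x - z *\<^sub>C x) \<le> norm (A x - u n *\<^sub>C x) + norm ((u n - z) *\<^sub>C x)"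
        using norm_triangle_ineq[of "A x - u n *\<^sub>C x" "(u n - z) *\<^sub>C x"]
        by (simp add: scaleC_diff_left)
      also have "\<dots> < e / 2 * norm x + e / 2 * norm x"
        using n x by (intro add_strict_mono) auto
      finally show "\<exists>x\<in>M. norm (A x - z *\<^sub>C x) < e * norm x" using x(1) by auto
    qed
  qed
  ultimately show ?thesis by (simp add: compact_eq_bounded_closed)
qed

text \<open>Otherwise the element \<open>(A - z)\<^sup>*(A - z) + (R - w)\<^sup>*(R - w)\<close> of the kernel of the character would be
  invertible.\<close>

lemma character_joint_approx:
  assumes h: "h \<in> characters M \<A>" and R: "R \<in> \<A>" and e: "e > 0"
  shows "\<exists>x\<in>M. norm (A x - h A *\<^sub>C x) + norm (R x - h R *\<^sub>C x) < e * norm x"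
proof (rule ccontr)
  assume contra: "\<not> ?thesis"
  note h' = character_apply[OF h]
  define D where "D S = op_diff M S (op_scale M (h S) (op_id M))" for S
  have D: "D S \<in> \<A>" if "S \<in> \<A>" for S unfolding D_def using that by simp
  have D_apply: "D S x = S x - h S *\<^sub>C x" if "x \<in> M" for S x using that by (simp add: D_def)
  define Q where "Q S = compose M (adj_on M (D S)) (D S)" for S
  have Q: "Q S \<in> \<A>" if "S \<in> \<A>" for S unfolding Q_def using D[OF that] by simp
  have Q_inner: "cinner (Q S x) x = complex_of_real ((norm (D S x))\<^sup>2)" if "S \<in> \<A>" "x \<in> M" for S x
  proof -
    have "D S \<in> bounded_ops M" using D that by blast
    then show ?thesis using that(2) by (simp add: Q_def cinner_adj_on' cinner_self)
  qed
  \<comment> \<open>\<open>characters\<close> only demands that h is nonzero somewhere;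
    multiplicativity then forces the value 1 at the unit.\<close>
  have id: "h (op_id M) = 1"
  proof -
    obtain B where B: "B \<in> \<A>" "h B \<noteq> 0" using h'(4) by blast
    then have "compose M B (op_id M) = B"
      by (intro extensionalityI[of _ M]) (auto simp: bounded_ops_extensional)
    then show ?thesis using h'(3)[OF B(1) \<A>_closed(1)] B(2) by simp
  qed
  have hD: "h (D S) = 0" if "S \<in> \<A>" for S
    using that by (simp add: D_def op_diff_eq h' id)
  \<comment> \<open>Multiplicativity suffices: the factor D S already has value 0, whatever h does
    to its adjoint.\<close>
  have hQ: "h (Q S) = 0" if "S \<in> \<A>" for S
    using that D[OF that] hD[OF that] by (simp add: Q_def h')
  define S where "S = op_add M (Q A) (Q R)"
  have S: "S \<in> \<A>" unfolding S_def using Q R by simp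
  have hS: "h S = 0" using hQ R Q by (simp add: S_def h')
  \<comment> \<open>The factor 1 / 2 comes from (a + b)^2 <= 2 (a^2 + b^2).\<close>
  have "e\<^sup>2 / 2 * (norm x)\<^sup>2 \<le> Re (cinner (S x) x)" if x: "x \<in> M" for x
  proof -
    let ?a = "norm (D A x)" and ?b = "norm (D R x)"
    have "e * norm x \<le> ?a + ?b"
      using contra x by (auto simp: D_apply not_less)
    then have "(e * norm x)\<^sup>2 \<le> (?a + ?b)\<^sup>2" using e by (intro power_mono) auto
    also have "\<dots> \<le> 2 * (?a\<^sup>2 + ?b\<^sup>2)"
      using zero_le_power2[of "?a - ?b"] unfolding power2_sum power2_diff by simp
    also have "?a\<^sup>2 + ?b\<^sup>2 = Re (cinner (S x) x)"
      using x R by (simp add: S_def cinner_add_left Q_inner)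
    finally show ?thesis by (simp add: power_mult_distrib)
  qed
  then obtain V where "V \<in> \<A>" "compose M S V = op_id M"
    using coercive_inverse[OF \<A>_subalgebra \<A>_closed(1) S, of "e\<^sup>2 / 2"] e by auto
  then show False using h'(3)[OF S, of V] hS id by simp
qed

text \<open>Taking R = A in the joint approximation puts h A into the spectrum; a general R then
  shows that its value there is h R. So a character is determined by its value at
  \<open>A\<close>.\<close>

lemma
  assumes h: "h \<in> characters M \<A>"
  shows character_in_spectrum: "h A \<in> \<sigma>"
    and character_approx_value: "R \<in> \<A> \<Longrightarrow> approx_value M A (h A) R (h R)"
proof -
  show z: "h A \<in> \<sigma>"
    unfolding approx_spectrum_def
  proof (intro CollectI allI impI)
    fix e :: real assume "e > 0"
    then obtain x where "x \<in> M" "norm (A x - h A *\<^sub>C x) + norm (A x - h A *\<^sub>C x) < e * norm x"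
      using character_joint_approx[OF h \<A>_closed(2)] by blast
    then show "\<exists>x\<in>M. norm (A x - h A *\<^sub>C x) < e * norm x"
      using norm_ge_zero[of "A x - h A *\<^sub>C x"] by (intro bexI[of _ x]) linarith+
  qed
  assume R: "R \<in> \<A>"
  obtain w where w: "approx_value M A (h A) R w"
    using approx_value_exists[OF z R] .
  have "w = h R"
    using w character_joint_approx[OF h R] by (rule approx_value_joint_eq)
  then show "approx_value M A (h A) R (h R)" using w by simp
qed

text \<open>Values exist and are unique at spectral points, so they form a function, and the
  arithmetic of \<open>approx_value\<close> makes it a character.\<close>

lemma character_exists:
  assumes z: "z \<in> \<sigma>"
  obtains h where "h \<in> characters M \<A>" "h A = z"
proof -
  have "\<forall>R\<in>\<A>. \<exists>w. approx_value M A z R w"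
    using approx_value_exists[OF z] by metis
  then obtain v where v: "\<And>R. R \<in> \<A> \<Longrightarrow> approx_value M A z R (v R)" by metis
  have eq: "v R = w" if "R \<in> \<A>" "approx_value M A z R w" for R w
    using approx_value_unique[OF z _ v that(2)] that(1) by blast
  have "restrict v \<A> \<in> characters M \<A>"
    unfolding characters_def
  proof (intro CollectI conjI ballI allI)
    fix R S assume RS: "R \<in> \<A>" "S \<in> \<A>"
    then show "restrict v \<A> (op_add M R S) = restrict v \<A> R + restrict v \<A> S"
      using approx_value_add[OF v v] by (simp add: eq)
    have "approx_value M A z (compose M R S) (v R * v S)"
      using RS by (intro approx_value_compose v) auto
    with RS show "restrict v \<A> (compose M R S) = restrict v \<A> R * restrict v \<A> S"
      by (simp add: eq)
  next
    fix c R assume R: "R \<in> \<A>"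
    have "approx_value M A z (op_scale M c R) (c * v R)"
      using R by (intro approx_value_scale v) auto
    with R show "restrict v \<A> (op_scale M c R) = c * restrict v \<A> R" by (simp add: eq)
  next
    have "v (op_id M) = 1" by (rule eq[OF \<A>_closed(1) approx_value_id])
    then show "\<exists>R\<in>\<A>. restrict v \<A> R \<noteq> 0"
      by (intro bexI[of _ "op_id M"]) auto
  qed simp
  moreover have "restrict v \<A> A = z"
    using eq[OF \<A>_closed(2) approx_value_self] by simp
  ultimately show ?thesis using that by blast
qed

text \<open>Resolves the definite description in \<open>gelfand\<close>; afterwards the values of
  the transform are handled through \<open>approx_value\<close> only.\<close>

lemma approx_value_gelfand:
  assumes z: "z \<in> \<sigma>" and R: "R \<in> \<A>"
  shows "approx_value M A z R (gelfand M A R z)"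
proof -
  obtain h where h: "h \<in> characters M \<A>" "h A = z" using character_exists[OF z] .
  have "(THE h. h \<in> characters M \<A> \<and> h A = z) = h"
  proof (rule the_equality)
    fix g assume g: "g \<in> characters M \<A> \<and> g A = z"
    show "g = h"
    proof (rule extensionalityI)
      fix S assume S: "S \<in> \<A>"
      show "g S = h S"
        using approx_value_unique[OF z _ _ character_approx_value[OF h(1) S, unfolded h(2)]]
          character_approx_value[of g S] g S by blast
    qed (use g h in \<open>auto dest: character_apply(5)\<close>)
  qed (use h in simp)
  then have "gelfand M A R z = h R"
    using z by (simp add: gelfand_def op_spectrum_eq)
  then show ?thesis using character_approx_value[OF h(1) R] h(2) by simp
qed

lemma gelfand_eqI:
  assumes "R \<in> \<A>" "f \<in> extensional \<sigma>" "\<And>z. z \<in> \<sigma> \<Longrightarrow> approx_value M A z R (f z)"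
  shows "gelfand M A R = f"
proof (rule extensionalityI)
  show "gelfand M A R \<in> extensional \<sigma>" by (simp add: gelfand_def op_spectrum_eq)
  show "gelfand M A R z = f z" if "z \<in> \<sigma>" for z
    using approx_value_unique[OF that _ approx_value_gelfand[OF that assms(1)] assms(3)[OF that]]
      assms(1) by blast
qed (rule assms)

text \<open>Because the norm is attained as the modulus of a value, estimates on the spectrum turn
  into operator estimates. Injectivity and the Cauchy estimate for surjectivity both rest on
  this.\<close>

lemma norm_le_spectral:
  assumes R: "R \<in> \<A>" and K: "\<And>z w. z \<in> \<sigma> \<Longrightarrow> approx_value M A z R w \<Longrightarrow> cmod w \<le> K" and x: "x \<in> M"
  shows "norm (R x) \<le> K * norm x"
proof -
  obtain z w where "z \<in> \<sigma>" "approx_value M A z R w" "cmod w = op_norm M R"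
    using norm_attained[OF R] .
  then have "op_norm M R \<le> K" using K by metis
  then have "op_norm M R * norm x \<le> K * norm x" by (simp add: mult_right_mono)
  then show ?thesis using norm_le_op_norm[of R x] R x by force
qed

lemma gelfand_inj:
  assumes "R \<in> \<A>" "S \<in> \<A>"
    and "\<And>z. z \<in> \<sigma> \<Longrightarrow> approx_value M A z R (f z)" "\<And>z. z \<in> \<sigma> \<Longrightarrow> approx_value M A z S (f z)"
  shows "R = S"
proof (rule bounded_ops_eqI)
  show b: "R \<in> bounded_ops M" "S \<in> bounded_ops M" using assms by auto
  fix x assume x: "x \<in> M"
  have D: "op_diff M R S \<in> \<A>" using assms by simp
  have "norm (op_diff M R S x) \<le> 0 * norm x"
    using D
  proof (rule norm_le_spectral)
    fix z w assume z: "z \<in> \<sigma>" and w: "approx_value M A z (op_diff M R S) w"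
    have "approx_value M A z (op_diff M R S) (f z - f z)"
      using z b assms by (intro approx_value_diff) auto
    then have "w = 0" using approx_value_unique[OF z _ w] D by fastforce
    then show "cmod w \<le> 0" by simp
  qed (rule x)
  then show "R x = S x" using x by simp
qed

section \<open>Surjectivity of the Gelfand transform\<close>

lemma approx_value_real_polynomial:
  assumes "real_polynomial_function p"
  shows "\<exists>R\<in>\<A>. \<forall>z\<in>\<sigma>. approx_value M A z R (complex_of_real (p z))"
  using assms
proof (induction p rule: real_polynomial_function.induct)
  case (linear p)
  \<comment> \<open>A real-linear \<open>p\<close> is a Re z + b Im z; inserting Re z = (z + cnj z)
    / 2 and Im z = (z - cnj z) / (2 i) gives the coefficients of \<open>R\<close>.\<close>
  define a b where "a = complex_of_real (p 1)" and "b = complex_of_real (p \<i>)"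
  define R where "R = op_add M (op_scale M ((a - \<i> * b) / 2) A) (op_scale M ((a + \<i> * b) / 2) (adj_on M A))"
  have "approx_value M A z R (complex_of_real (p z))" for z
  proof -
    have "p z = p (Re z *\<^sub>R 1 + Im z *\<^sub>R \<i>)"
      by (rule arg_cong[of _ _ p]) (simp add: complex_eq_iff)
    also have "\<dots> = Re z * p 1 + Im z * p \<i>"
      using linear by (simp add: linear_add linear_scale bounded_linear.linear)
    finally have eq: "complex_of_real (p z) = (a - \<i> * b) / 2 * z + (a + \<i> * b) / 2 * cnj z"
      by (simp add: a_def b_def complex_eq_iff field_simps)
    then show ?thesis
      unfolding R_def eq
      by (intro approx_value_add approx_value_scale approx_value_self approx_value_adj_self) auto
  qed
  moreover have "R \<in> \<A>" unfolding R_def by simp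
  ultimately show ?case by blast
next
  case (const c)
  have "approx_value M A z (op_scale M (complex_of_real c) (op_id M)) (complex_of_real c)" for z
    using approx_value_scale[OF _ approx_value_id, of A z "complex_of_real c"] by simp
  then show ?case by (intro bexI[of _ "op_scale M (complex_of_real c) (op_id M)"]) auto
next
  case (add f g)
  then obtain R S where "R \<in> \<A>" "S \<in> \<A>" "\<forall>z\<in>\<sigma>. approx_value M A z R (complex_of_real (f z))"
    "\<forall>z\<in>\<sigma>. approx_value M A z S (complex_of_real (g z))" by blast
  then show ?case
    by (intro bexI[of _ "op_add M R S"]) (auto intro!: approx_value_add)
next
  case (mult f g)
  then obtain R S where "R \<in> \<A>" "S \<in> \<A>" "\<forall>z\<in>\<sigma>. approx_value M A z R (complex_of_real (f z))"
    "\<forall>z\<in>\<sigma>. approx_value M A z S (complex_of_real (g z))" by blast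
  then show ?case
    by (intro bexI[of _ "compose M R S"]) (auto intro!: approx_value_compose)
qed

lemma approx_value_dense:
  assumes f: "continuous_on \<sigma> f" and e: "e > 0"
  obtains R g where "R \<in> \<A>" "\<And>z. z \<in> \<sigma> \<Longrightarrow> approx_value M A z R (g z)"
    "\<And>z. z \<in> \<sigma> \<Longrightarrow> cmod (g z - f z) < e"
proof -
  \<comment> \<open>Stone-Weierstrass is applied to real and imaginary parts separately, each with
    half the error.\<close>
  have e2: "e / 2 > 0" using e by simp
  obtain p where p: "real_polynomial_function p" "\<And>z. z \<in> \<sigma> \<Longrightarrow> \<bar>Re (f z) - p z\<bar> < e / 2"
    using Stone_Weierstrass_real_polynomial_function[OF compact_spectrum continuous_on_Re[OF f] e2] by blast
  obtain q where q: "real_polynomial_function q" "\<And>z. z \<in> \<sigma> \<Longrightarrow> \<bar>Im (f z) - q z\<bar> < e / 2"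
    using Stone_Weierstrass_real_polynomial_function[OF compact_spectrum continuous_on_Im[OF f] e2] by blast
  obtain R S where RS: "R \<in> \<A>" "S \<in> \<A>" "\<forall>z\<in>\<sigma>. approx_value M A z R (complex_of_real (p z))"
    "\<forall>z\<in>\<sigma>. approx_value M A z S (complex_of_real (q z))"
    using approx_value_real_polynomial[OF p(1)] approx_value_real_polynomial[OF q(1)] by blast
  show ?thesis
  proof (rule that)
    show "op_add M R (op_scale M \<i> S) \<in> \<A>" using RS by simp
    fix z assume z: "z \<in> \<sigma>"
    show "approx_value M A z (op_add M R (op_scale M \<i> S)) (complex_of_real (p z) + \<i> * complex_of_real (q z))"
      using RS z by (intro approx_value_add approx_value_scale) auto
    have "cmod (complex_of_real (p z) + \<i> * complex_of_real (q z) - f z)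
        \<le> \<bar>p z - Re (f z)\<bar> + \<bar>q z - Im (f z)\<bar>"
      using cmod_le[of "complex_of_real (p z) + \<i> * complex_of_real (q z) - f z"] by simp
    then show "cmod (complex_of_real (p z) + \<i> * complex_of_real (q z) - f z) < e"
      using p(2)[OF z] q(2)[OF z] by (simp add: abs_minus_commute)
  qed
qed

lemma gelfand_surj:
  assumes f: "continuous_on \<sigma> f"
  obtains R where "R \<in> \<A>" "\<And>z. z \<in> \<sigma> \<Longrightarrow> approx_value M A z R (f z)"
proof -
  have "\<exists>R g. R \<in> \<A> \<and> (\<forall>z\<in>\<sigma>. approx_value M A z R (g z) \<and> cmod (g z - f z) < 1 / Suc n)" for n
    using approx_value_dense[OF f, of "1 / Suc n"] by (metis of_nat_0_less_iff zero_less_Suc zero_less_divide_1_iff)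
  then obtain R g where R: "\<And>n. R n \<in> \<A>" "\<And>n z. z \<in> \<sigma> \<Longrightarrow> approx_value M A z (R n) (g n z)"
    "\<And>n z. z \<in> \<sigma> \<Longrightarrow> cmod (g n z - f z) < 1 / Suc n" by metis
  have Rb: "R n \<in> bounded_ops M" for n using R(1) by blast
  have small: "\<exists>N. \<forall>n\<ge>N. 1 / real (Suc n) < e" if "e > 0" for e :: real
    using order_tendstoD(2)[OF LIMSEQ_inverse_real_of_nat that]
    by (simp add: eventually_sequentially inverse_eq_divide)
  \<comment> \<open>The values of R m - R n are differences of functions close to \<open>f\<close>,
    so the norm estimate from the spectrum makes the operators a Cauchy sequence.\<close>
  have Cauchy: "\<exists>N. \<forall>m\<ge>N. \<forall>n\<ge>N. \<forall>x\<in>M. norm (R m x - R n x) \<le> e * norm x"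
    if "e > 0" for e
  proof -
    obtain N where N: "\<forall>n\<ge>N. 1 / real (Suc n) < e / 2"
      using small[of "e / 2"] \<open>e > 0\<close> by auto
    have "norm (R m x - R n x) \<le> e * norm x" if mn: "m \<ge> N" "n \<ge> N" and x: "x \<in> M" for m n x
    proof -
      have D: "op_diff M (R m) (R n) \<in> \<A>" using R(1) by simp
      have "norm (op_diff M (R m) (R n) x) \<le> e * norm x"
        using D
      proof (rule norm_le_spectral)
        fix z w assume z: "z \<in> \<sigma>" and w: "approx_value M A z (op_diff M (R m) (R n)) w"
        have "approx_value M A z (op_diff M (R m) (R n)) (g m z - g n z)"
          using z Rb R(2) by (intro approx_value_diff) auto
        then have "w = g m z - g n z" using approx_value_unique[OF z _ w] D by blast
        then have "cmod w \<le> cmod (g m z - f z) + cmod (g n z - f z)"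
          using norm_triangle_ineq4[of "g m z - f z" "g n z - f z"] by simp
        also have "\<dots> \<le> e / 2 + e / 2"
          using R(3)[OF z, of m] R(3)[OF z, of n] N[rule_format, OF mn(1)] N[rule_format, OF mn(2)]
          by linarith
        finally show "cmod w \<le> e" by simp
      qed (rule x)
      then show ?thesis using x by simp
    qed
    then show ?thesis by blast
  qed
  obtain S where S: "S \<in> bounded_ops M"
    "\<And>e. e > 0 \<Longrightarrow> \<exists>N. \<forall>n\<ge>N. \<forall>x\<in>M. norm (R n x - S x) \<le> e * norm x"
    by (rule bounded_ops_complete[OF Rb Cauchy]) auto
  have "S \<in> \<A>" using \<A>_subalgebra R(1) S by (rule cstar_subalgebra_closed)
  moreover have "approx_value M A z S (f z)" if z: "z \<in> \<sigma>" for z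
  proof (rule approx_value_limit[OF R(2)[OF z] _ S(2)])
    show "(\<lambda>n. g n z) \<longlonglongrightarrow> f z"
      unfolding LIMSEQ_iff
    proof (intro allI impI)
      fix e :: real assume "e > 0"
      then obtain N where N: "\<forall>n\<ge>N. 1 / real (Suc n) < e" using small by blast
      then show "\<exists>N. \<forall>n\<ge>N. cmod (g n z - f z) < e"
        using R(3)[OF z] by (intro exI[of _ N] allI impI) (rule less_trans, blast+)
    qed
  qed
  ultimately show ?thesis using that by blast
qed

text \<open>\<open>inv_into\<close> merely chooses a preimage; injectivity makes it the given
  \<open>R\<close>. Identities of the functional calculus are proved from here on by exhibiting an
  operator with the right values.\<close>

lemma gelfand_inv_eqI:
  assumes R: "R \<in> \<A>" and f: "f \<in> extensional \<sigma>" "\<And>z. z \<in> \<sigma> \<Longrightarrow> approx_value M A z R (f z)"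
  shows "gelfand_inv M A f = R"
proof -
  have eq: "gelfand M A R = f" using R f by (rule gelfand_eqI)
  then have "f \<in> gelfand M A ` \<A>" using R by blast
  then have S: "inv_into \<A> (gelfand M A) f \<in> \<A>" "gelfand M A (inv_into \<A> (gelfand M A) f) = f"
    by (rule inv_into_into, rule f_inv_into_f)
  then have "inv_into \<A> (gelfand M A) f = R"
    using approx_value_gelfand[OF _ S(1)] f(2) R by (intro gelfand_inj[of _ _ f]) auto
  then show ?thesis by (simp add: gelfand_inv_def)
qed

lemma
  assumes "f \<in> C_on \<sigma>"
  shows gelfand_inv_in: "gelfand_inv M A f \<in> \<A>"
    and approx_value_gelfand_inv: "z \<in> \<sigma> \<Longrightarrow> approx_value M A z (gelfand_inv M A f) (f z)"
proof -
  have f: "f \<in> extensional \<sigma>" "continuous_on \<sigma> f" using assms by (auto simp: C_on_def)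
  obtain R where R: "R \<in> \<A>" "\<And>z. z \<in> \<sigma> \<Longrightarrow> approx_value M A z R (f z)"
    using gelfand_surj[OF f(2)] by blast
  have "gelfand_inv M A f = R" using R(1) f(1) R(2) by (rule gelfand_inv_eqI)
  with R show "gelfand_inv M A f \<in> \<A>" "z \<in> \<sigma> \<Longrightarrow> approx_value M A z (gelfand_inv M A f) (f z)"
    by auto
qed

lemma op_norm_gelfand_inv:
  assumes "f \<in> C_on \<sigma>"
  shows "op_norm M (gelfand_inv M A f) = sup_norm_on \<sigma> f"
proof -
  note R = gelfand_inv_in[OF assms]
  then have Rb: "gelfand_inv M A f \<in> bounded_ops M" by blast
  obtain z w where z: "z \<in> \<sigma>" "approx_value M A z (gelfand_inv M A f) w"
    "cmod w = op_norm M (gelfand_inv M A f)"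
    using norm_attained[OF R] .
  then have "w = f z"
    using approx_value_unique[OF z(1) Rb z(2) approx_value_gelfand_inv[OF assms z(1)]] by simp
  then have attained: "cmod (f z) = op_norm M (gelfand_inv M A f)" using z by simp
  have le: "cmod (f y) \<le> op_norm M (gelfand_inv M A f)" if "y \<in> \<sigma>" for y
    by (rule approx_value_le[OF that approx_value_gelfand_inv[OF assms that]])
       (rule norm_le_op_norm[OF Rb])
  show ?thesis
  proof (rule antisym)
    show "op_norm M (gelfand_inv M A f) \<le> sup_norm_on \<sigma> f"
      unfolding sup_norm_on_def attained[symmetric] using z(1) le
      by (intro cSUP_upper bdd_aboveI2)
    show "sup_norm_on \<sigma> f \<le> op_norm M (gelfand_inv M A f)"
      unfolding sup_norm_on_def using le z(1) by (intro cSUP_least) auto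
  qed
qed

lemma gelfand_inv_star_hom:
  "star_hom \<sigma> (C_on \<sigma>) M \<A> (adj_on M) (gelfand_inv M A)"
  unfolding star_hom_def linear_fun_op_def
proof (intro conjI ballI allI)
  note [simp] = gelfand_inv_in
  show "gelfand_inv M A \<in> C_on \<sigma> \<rightarrow> \<A>" by simp
  have b [simp]: "gelfand_inv M A f \<in> bounded_ops M" if "f \<in> C_on \<sigma>" for f
    using gelfand_inv_in[OF that] by blast
  fix f g assume "f \<in> C_on \<sigma>" "g \<in> C_on \<sigma>"
  then show "gelfand_inv M A (\<lambda>z\<in>\<sigma>. f z + g z) = op_add M (gelfand_inv M A f) (gelfand_inv M A g)"
    "gelfand_inv M A (\<lambda>z\<in>\<sigma>. f z * g z) = compose M (gelfand_inv M A f) (gelfand_inv M A g)"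
    by (auto intro!: gelfand_inv_eqI approx_value_add approx_value_compose approx_value_gelfand_inv)
next
  note [simp] = gelfand_inv_in
  have b [simp]: "gelfand_inv M A f \<in> bounded_ops M" if "f \<in> C_on \<sigma>" for f
    using gelfand_inv_in[OF that] by blast
  fix f c assume "f \<in> C_on \<sigma>"
  then show "gelfand_inv M A (\<lambda>z\<in>\<sigma>. c * f z) = op_scale M c (gelfand_inv M A f)"
    "gelfand_inv M A (\<lambda>z\<in>\<sigma>. cnj (f z)) = adj_on M (gelfand_inv M A f)"
    by (auto intro!: gelfand_inv_eqI approx_value_scale approx_value_adj approx_value_gelfand_inv)
qed

section \<open>Polynomials in a normal operator, self-adjointness and unitarity\<close>

lemma
  assumes "R \<in> \<A>"
  shows approx_value_funpow: "approx_value M A z R w \<Longrightarrow>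
      approx_value M A z (restrict (R ^^ n) M) (w ^ n)"
    and funpow_in: "restrict (R ^^ n) M \<in> \<A>"
    and funpow_maps: "x \<in> M \<Longrightarrow> (R ^^ n) x \<in> M"
proof -
  have R: "R \<in> bounded_ops M" using assms by blast
  show maps: "x \<in> M \<Longrightarrow> (R ^^ n) x \<in> M" for n x
    by (induction n) (use R in auto)
  \<comment> \<open>\<open>R ^^ n\<close> is a function on the whole space; it is its restriction to
    \<open>M\<close> that belongs to the algebra.\<close>
  have restrict_Suc: "restrict (R ^^ Suc n) M = compose M R (restrict (R ^^ n) M)" for n
    by (auto simp: compose_def)
  have restrict_0: "restrict (R ^^ 0) M = op_id M" by (auto simp: op_id_def)
  show in_\<A>: "restrict (R ^^ n) M \<in> \<A>" for n
    by (induction n) (use assms in \<open>simp_all only: restrict_0 restrict_Suc \<A>_closed\<close>)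
  show "approx_value M A z (restrict (R ^^ n) M) (w ^ n)" if "approx_value M A z R w"
  proof (induction n)
    case (Suc n)
    show ?case
      unfolding restrict_Suc power_Suc using R in_\<A>[of n] that Suc
      by (intro approx_value_compose) blast+
  qed (unfold restrict_0, simp add: approx_value_id)
qed

lemma op_sum_closed:
  assumes "finite I" "\<And>i. i \<in> I \<Longrightarrow> (\<lambda>x\<in>M. R i x) \<in> \<A>"
    and "\<And>i. i \<in> I \<Longrightarrow> approx_value M A z (\<lambda>x\<in>M. R i x) (w i)"
  shows "(\<lambda>x\<in>M. \<Sum>i\<in>I. R i x) \<in> \<A> \<and> approx_value M A z (\<lambda>x\<in>M. \<Sum>i\<in>I. R i x) (\<Sum>i\<in>I. w i)"
  using assms
proof (induction I rule: finite_induct)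
  case empty
  have "(\<lambda>x\<in>M. \<Sum>i\<in>{}. R i x) = op_scale M 0 (op_id M)"
    by (rule extensionalityI[of _ M]) auto
  moreover have "approx_value M A z (op_scale M 0 (op_id M)) (0 * 1)"
    by (intro approx_value_scale approx_value_id) simp
  ultimately show ?case by simp
next
  case (insert i I)
  have "(\<lambda>x\<in>M. \<Sum>i\<in>insert i I. R i x) = op_add M (\<lambda>x\<in>M. R i x) (\<lambda>x\<in>M. \<Sum>i\<in>I. R i x)"
    using insert by (intro extensionalityI[of _ M]) auto
  moreover have "(\<lambda>x\<in>M. \<Sum>i\<in>I. R i x) \<in> \<A> \<and>
      approx_value M A z (\<lambda>x\<in>M. \<Sum>i\<in>I. R i x) (\<Sum>i\<in>I. w i)"
    by (rule insert.IH; rule insert.prems; rule insertI2)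
  ultimately show ?case
    unfolding sum.insert[OF insert.hyps]
    by (auto intro: approx_value_add insert.prems[OF insertI1])
qed

text \<open>At z the values of \<open>A\<close> and of its adjoint are z and cnj z, and an operator
  of the algebra is determined by its values.\<close>

lemma selfadjoint_iff: "adj_on M A = A \<longleftrightarrow> \<sigma> \<subseteq> \<real>"
proof
  assume "adj_on M A = A"
  then show "\<sigma> \<subseteq> \<real>"
    using approx_value_unique[OF _ A approx_value_self] approx_value_adj_self
    by (metis Reals_cnj_iff subsetI)
next
  assume "\<sigma> \<subseteq> \<real>"
  then show "adj_on M A = A"
    using approx_value_adj_self approx_value_self
    by (intro gelfand_inj[of _ _ "\<lambda>z. z"]) (auto, metis Reals_cnj_iff subsetD)
qed

text \<open>The product of \<open>A\<close> and its adjoint has the value z cnj z, the square of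
  cmod z, and the unit has the value 1.\<close>

lemma unitary_iff: "compose M A (adj_on M A) = op_id M \<longleftrightarrow> \<sigma> \<subseteq> sphere 0 1"
proof -
  have av: "approx_value M A z (compose M A (adj_on M A)) (z * cnj z)" for z
    by (intro approx_value_compose approx_value_self approx_value_adj_self) auto
  have circle: "z * cnj z = 1 \<longleftrightarrow> z \<in> sphere 0 1" for z
  proof -
    have "z * cnj z = 1 \<longleftrightarrow> (cmod z)\<^sup>2 = 1"
      unfolding complex_norm_square[symmetric] by (metis of_real_1 of_real_eq_iff of_real_power)
    also have "\<dots> \<longleftrightarrow> cmod z = 1" by (simp add: power2_eq_1_iff) (smt (verit) norm_ge_zero)
    finally show ?thesis by simp
  qed
  show ?thesis
  proof
    assume *: "compose M A (adj_on M A) = op_id M"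
    show "\<sigma> \<subseteq> sphere 0 1"
    proof
      fix z assume "z \<in> \<sigma>"
      then have "z * cnj z = 1"
        using approx_value_unique[OF _ op_id_bounded av[unfolded *] approx_value_id] by blast
      then show "z \<in> sphere 0 1" by (simp only: circle)
    qed
  next
    assume *: "\<sigma> \<subseteq> sphere 0 1"
    show "compose M A (adj_on M A) = op_id M"
    proof (rule gelfand_inj[of _ _ "\<lambda>z. 1"])
      fix z assume "z \<in> \<sigma>"
      then have "z * cnj z = 1" unfolding circle using * by blast
      then show "approx_value M A z (compose M A (adj_on M A)) 1" using av[of z] by simp
    qed (auto simp: approx_value_id)
  qed
qed

lemma op_poly2_gelfand:
  shows "op_poly2 M P A (adj_on M A) \<in> \<A>"
    and "approx_value M A z (op_poly2 M P A (adj_on M A)) (poly2 P z (cnj z))"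
proof -
  define B where "B = adj_on M A"
  have B: "B \<in> \<A>" by (simp add: B_def)
  have monomial: "(\<lambda>x\<in>M. c *\<^sub>C (A ^^ i) ((B ^^ j) x)) \<in> \<A> \<and>
      approx_value M A z (\<lambda>x\<in>M. c *\<^sub>C (A ^^ i) ((B ^^ j) x)) (c * z ^ i * cnj z ^ j)" for c i j
  proof -
    have eq: "(\<lambda>x\<in>M. c *\<^sub>C (A ^^ i) ((B ^^ j) x))
        = op_scale M c (compose M (restrict (A ^^ i) M) (restrict (B ^^ j) M))"
      using funpow_maps[OF B] by (intro extensionalityI[of _ M]) auto
    have in_\<A>: "restrict (A ^^ i) M \<in> \<A>" "restrict (B ^^ j) M \<in> \<A>"
      using funpow_in B by auto
    moreover have "approx_value M A z (restrict (A ^^ i) M) (z ^ i)"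
      "approx_value M A z (restrict (B ^^ j) M) (cnj z ^ j)"
      using approx_value_funpow B approx_value_self approx_value_adj_self by (auto simp: B_def)
    ultimately have "approx_value M A z (\<lambda>x\<in>M. c *\<^sub>C (A ^^ i) ((B ^^ j) x)) (c * (z ^ i * cnj z ^ j))"
      unfolding eq by (intro approx_value_scale approx_value_compose) auto
    with in_\<A> show ?thesis unfolding eq by (simp add: mult.assoc)
  qed
  have "(\<lambda>x\<in>M. \<Sum>j\<le>degree (coeff P i). coeff (coeff P i) j *\<^sub>C (A ^^ i) ((B ^^ j) x)) \<in> \<A> \<and>
      approx_value M A z (\<lambda>x\<in>M. \<Sum>j\<le>degree (coeff P i). coeff (coeff P i) j *\<^sub>C (A ^^ i) ((B ^^ j) x))
        (\<Sum>j\<le>degree (coeff P i). coeff (coeff P i) j * z ^ i * cnj z ^ j)" for i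
    using monomial by (intro op_sum_closed) auto
  then have "op_poly2 M P A B \<in> \<A> \<and> approx_value M A z (op_poly2 M P A B) (poly2 P z (cnj z))"
    unfolding op_poly2_def poly2_def by (intro op_sum_closed) auto
  then show "op_poly2 M P A (adj_on M A) \<in> \<A>"
    "approx_value M A z (op_poly2 M P A (adj_on M A)) (poly2 P z (cnj z))"
    by (auto simp: B_def)
qed

end

section \<open>Restriction to a reducing subspace\<close>

locale nested_subspaces = closed_csubspace M + N: closed_csubspace N
  for M N :: "'a::complex_hilbert_space set" +
  assumes subset: "M \<subseteq> N"
begin

lemma restrict_bounded:
  assumes R: "R \<in> bounded_ops N" and maps: "\<And>x. x \<in> M \<Longrightarrow> R x \<in> M"
  shows "restrict R M \<in> bounded_ops M"
proof -
  obtain K where K: "\<And>x. x \<in> N \<Longrightarrow> norm (R x) \<le> K * norm x"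
    using N.bounded_ops_bound[OF R] by blast
  show ?thesis
    by (rule bounded_opsI[where K = K])
       (use R maps K subset in \<open>auto simp: N.bounded_ops_linear subset_iff\<close>)
qed

lemma adj_on_restrict:
  assumes R: "R \<in> bounded_ops N" and "\<And>x. x \<in> M \<Longrightarrow> R x \<in> M" "\<And>x. x \<in> M \<Longrightarrow> adj_on N R x \<in> M"
  shows "adj_on M (restrict R M) = restrict (adj_on N R) M"
proof (rule adj_on_unique)
  show "restrict (adj_on N R) M \<in> bounded_ops M"
    using R assms(3) by (intro restrict_bounded) auto
qed (use R N.cinner_adj_on[OF R] subset in auto)

text \<open>Prepared for \<open>cstar_gen_induct\<close> on the larger space. Invariance under the
  adjoint is built into the set because the adjoint of a restriction is the restriction of the
  adjoint when \<open>M\<close> reduces the operator.\<close>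

lemma cstar_subalgebra_reducing:
  assumes \<C>: "cstar_subalgebra M \<C>"
  shows "cstar_subalgebra N {R \<in> bounded_ops N.
    (\<forall>x\<in>M. R x \<in> M \<and> adj_on N R x \<in> M) \<and> restrict R M \<in> \<C>}" (is "cstar_subalgebra N ?S")
proof (rule N.cstar_subalgebraI)
  have [simp]: "x \<in> N" if "x \<in> M" for x using that subset by blast
  fix R S assume R: "R \<in> ?S" and S: "S \<in> ?S"
  have "restrict (op_add N R S) M = op_add M (restrict R M) (restrict S M)"
    "restrict (compose N R S) M = compose M (restrict R M) (restrict S M)"
    using S by (auto intro!: extensionalityI[of _ M])
  then show "op_add N R S \<in> ?S" "compose N R S \<in> ?S"
    using R S \<C> by (auto intro: cstar_subalgebra_add cstar_subalgebra_compose)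
next
  have [simp]: "x \<in> N" if "x \<in> M" for x using that subset by blast
  fix c R assume R: "R \<in> ?S"
  have "restrict (op_scale N c R) M = op_scale M c (restrict R M)"
    by (auto intro!: extensionalityI[of _ M])
  then show "op_scale N c R \<in> ?S"
    using R \<C> by (auto intro: cstar_subalgebra_scale)
next
  fix R assume R: "R \<in> ?S"
  then have "adj_on M (restrict R M) = restrict (adj_on N R) M"
    by (intro adj_on_restrict) auto
  then have "restrict (adj_on N R) M \<in> \<C>"
    using R cstar_subalgebra_adj[OF \<C>, of "restrict R M"] by simp
  then show "adj_on N R \<in> ?S" using R by simp
next
  fix R assume R: "R \<in> bounded_ops N"
    and ap: "\<And>e. e > 0 \<Longrightarrow> \<exists>S\<in>?S. \<forall>x\<in>N. norm (S x - R x) \<le> e * norm x"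
  have "\<exists>S::nat \<Rightarrow> 'a \<Rightarrow> 'a. (\<forall>n. S n \<in> ?S) \<and>
    (\<forall>e>0. \<exists>k. \<forall>n\<ge>k. \<forall>x\<in>N. norm (S n x - R x) \<le> e * norm x)"
    by (rule N.approx_sequence) (rule ap)
  then obtain S where S': "(\<forall>n. S n \<in> ?S) \<and>
    (\<forall>e>0. \<exists>k. \<forall>n\<ge>k. \<forall>x\<in>N. norm (S (n::nat) x - R x) \<le> e * norm x)" ..
  note S = S'[THEN conjunct1, rule_format] S'[THEN conjunct2, rule_format]
  have Sb: "S n \<in> bounded_ops N" and S_maps: "x \<in> M \<Longrightarrow> S n x \<in> M" "x \<in> M \<Longrightarrow> adj_on N (S n) x \<in> M"
    and S_\<C>: "restrict (S n) M \<in> \<C>" for n x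
    using S(1)[of n] by auto
  \<comment> \<open>Uses that \<open>M\<close> is closed; the error is rescaled by |K| + 1 since
    \<open>K\<close> may vanish and the distance must be strictly below e.\<close>
  have limit_in: "v \<in> M" if "\<And>e. e > 0 \<Longrightarrow> \<exists>n. u n \<in> M \<and> norm (u n - v) \<le> e * K"
    for u :: "nat \<Rightarrow> 'a" and v and K :: real
  proof -
    have "\<exists>y\<in>M. dist y v < e" if e: "e > 0" for e
    proof -
      define d where "d = e / (\<bar>K\<bar> + 1)"
      have d: "d > 0" using e by (simp add: d_def)
      obtain n where n: "u n \<in> M" "norm (u n - v) \<le> d * K"
        using \<open>\<And>e. e > 0 \<Longrightarrow> \<exists>n. u n \<in> M \<and> norm (u n - v) \<le> e * K\<close>[OF d] by blast
      have "d * K < d * (\<bar>K\<bar> + 1)" using d by (intro mult_strict_left_mono) auto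
      also have "\<dots> = e" by (simp add: d_def)
      finally show ?thesis using n by (intro bexI[of _ "u n"]) (auto simp: dist_norm)
    qed
    then show ?thesis using closed_approachable[OF closed] by blast
  qed
  have "R x \<in> M \<and> adj_on N R x \<in> M" if x: "x \<in> M" for x
  proof
    have xN: "x \<in> N" using x subset by blast
    show "R x \<in> M"
      by (rule limit_in[of "\<lambda>n. S n x" _ "norm x"]) (use S(2) S_maps(1)[OF x] xN in blast)
    show "adj_on N R x \<in> M"
    proof (rule limit_in[of "\<lambda>n. adj_on N (S n) x" _ "norm x"])
      fix e :: real assume "e > 0"
      then obtain n where "\<forall>x\<in>N. norm (S n x - R x) \<le> e * norm x" using S(2) by blast
      then have "norm (adj_on N (S n) x - adj_on N R x) \<le> e * norm x"
        using N.norm_adj_on_le[of "op_diff N (S n) R" e x] Sb R xN by simp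
      then show "\<exists>n. adj_on N (S n) x \<in> M \<and> norm (adj_on N (S n) x - adj_on N R x) \<le> e * norm x"
        using S_maps(2)[OF x] by blast
    qed
  qed
  moreover from this have "restrict R M \<in> \<C>"
  proof (intro cstar_subalgebra_closed[OF \<C> S_\<C>] restrict_bounded[OF R])
    fix e :: real assume "e > 0"
    then show "\<exists>k. \<forall>n\<ge>k. \<forall>x\<in>M. norm (restrict (S n) M x - restrict R M x) \<le> e * norm x"
      using S(2)[of e] subset by (auto simp: subset_iff)
  qed auto
  ultimately show "R \<in> ?S" using R by simp
qed auto

end

section \<open>Operators on a quantized domain\<close>

context quantized_domain
begin

sublocale H: closed_csubspace "Hs \<alpha>" for \<alpha>
  by unfold_locales (rule Hs_csubspace, rule Hs_closed)

abbreviation \<D> where "\<D> \<equiv> dom_E Hs"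

lemma \<D>_E:
  assumes "x \<in> \<D>"
  obtains \<alpha> where "x \<in> Hs \<alpha>"
  using assms by (auto simp: dom_E_def)

lemma \<D>_E2:
  assumes "x \<in> \<D>" "y \<in> \<D>"
  obtains \<alpha> where "x \<in> Hs \<alpha>" "y \<in> Hs \<alpha>"
  using assms directed Hs_mono unfolding dom_E_def by (metis UN_E subsetD)

lemma Hs_\<D> [simp, intro]: "x \<in> Hs \<alpha> \<Longrightarrow> x \<in> \<D>"
  by (auto simp: dom_E_def)

lemma \<D>_eqI:
  assumes "f \<in> extensional \<D>" "g \<in> extensional \<D>" "\<And>\<alpha> x. x \<in> Hs \<alpha> \<Longrightarrow> f x = g x"
  shows "f = g"
  using assms by (auto intro!: extensionalityI[of _ \<D>] elim: \<D>_E)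

lemma \<D>_op_extensional [simp]:
  "op_id \<D> \<in> extensional \<D>" "op_add \<D> A B \<in> extensional \<D>" "op_diff \<D> A B \<in> extensional \<D>"
  "op_scale \<D> c A \<in> extensional \<D>" "compose \<D> A B \<in> extensional \<D>"
  by (auto simp: op_id_def op_add_def op_diff_def op_scale_def compose_def)

lemma \<D>_op_apply [simp]:
  assumes "x \<in> Hs \<alpha>"
  shows "op_id \<D> x = x" "op_add \<D> A B x = A x + B x" "op_diff \<D> A B x = A x - B x"
    "op_scale \<D> c A x = c *\<^sub>C A x" "compose \<D> A B x = A (B x)"
  using Hs_\<D>[OF assms] by (auto simp: op_id_def op_add_def op_diff_def op_scale_def compose_def)

lemma
  assumes "T \<in> cstar_E Hs"
  shows cstar_E_restrict [simp]: "restrict T (Hs \<alpha>) \<in> bounded_ops (Hs \<alpha>)"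
    and cstar_E_in [simp]: "x \<in> Hs \<alpha> \<Longrightarrow> T x \<in> Hs \<alpha>"
    and cstar_E_extensional: "T \<in> extensional \<D>"
    and cstar_E_orth_proj: "x \<in> \<D> \<Longrightarrow> orth_proj (Hs \<alpha>) (T x) = T (orth_proj (Hs \<alpha>) x)"
proof -
  show *: "restrict T (Hs \<alpha>) \<in> bounded_ops (Hs \<alpha>)" for \<alpha>
    using assms by (simp add: cstar_E_def)
  show "x \<in> Hs \<alpha> \<Longrightarrow> T x \<in> Hs \<alpha>"
    using H.bounded_ops_in[OF *, of x \<alpha>] by simp
qed (use assms in \<open>auto simp: cstar_E_def PiE_def\<close>)

lemma cstar_E_eqI:
  assumes "S \<in> cstar_E Hs" "T \<in> cstar_E Hs" "\<And>\<alpha>. restrict S (Hs \<alpha>) = restrict T (Hs \<alpha>)"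
  shows "S = T"
proof (rule \<D>_eqI)
  show "S x = T x" if "x \<in> Hs \<alpha>" for \<alpha> x
    using fun_cong[OF assms(3)[of \<alpha>], of x] that by simp
qed (use assms cstar_E_extensional in auto)

text \<open>For z in Hs \<alpha> and p the projection of x, <S x - S p, z> = <x - p, S' z> with S'
  the adjoint on Hs \<beta>, and this vanishes once S' z lies in Hs \<alpha>. So the projection
  condition reduces to invariance under adjoints.\<close>

lemma cstar_E_I:
  assumes ext: "S \<in> extensional \<D>"
    and b: "\<And>\<alpha>. restrict S (Hs \<alpha>) \<in> bounded_ops (Hs \<alpha>)"
    and adj: "\<And>\<alpha> \<beta> x. \<alpha> \<le> \<beta> \<Longrightarrow> x \<in> Hs \<alpha> \<Longrightarrow> adj_on (Hs \<beta>) (restrict S (Hs \<beta>)) x \<in> Hs \<alpha>"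
  shows "S \<in> cstar_E Hs"
proof -
  have maps: "S x \<in> Hs \<alpha>" if "x \<in> Hs \<alpha>" for \<alpha> x
    using H.bounded_ops_in[OF b that] that by simp
  have "clinear_on \<D> S"
    unfolding clinear_on_def
  proof (intro conjI ballI allI)
    fix x y assume "x \<in> \<D>" "y \<in> \<D>"
    then obtain \<alpha> where "x \<in> Hs \<alpha>" "y \<in> Hs \<alpha>" by (rule \<D>_E2)
    then show "S (x + y) = S x + S y"
      using H.bounded_ops_add[OF b, of x \<alpha> y] by simp
  next
    fix c x assume "x \<in> \<D>"
    then obtain \<alpha> where "x \<in> Hs \<alpha>" by (rule \<D>_E)
    then show "S (c *\<^sub>C x) = c *\<^sub>C S x"
      using H.bounded_ops_scale[OF b, of x \<alpha> c] by simp
  qed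
  moreover have "orth_proj (Hs \<alpha>) (S x) = S (orth_proj (Hs \<alpha>) x)" if "x \<in> \<D>" for \<alpha> x
  proof -
    obtain \<gamma> where "x \<in> Hs \<gamma>" using \<open>x \<in> \<D>\<close> by (rule \<D>_E)
    \<comment> \<open>Adjoints are available on the single subspaces, so x and Hs \<alpha> are
      placed inside a common one.\<close>
    then obtain \<beta> where \<beta>: "\<alpha> \<le> \<beta>" "x \<in> Hs \<beta>"
      using directed[of \<alpha> \<gamma>] Hs_mono by blast
    define p where "p = orth_proj (Hs \<alpha>) x"
    have p: "p \<in> Hs \<alpha>" "p \<in> Hs \<beta>" using Hs_mono[OF \<beta>(1)] by (auto simp: p_def)
    show ?thesis
      unfolding p_def[symmetric]
    proof (rule H.orth_proj_unique)
      show "S p \<in> Hs \<alpha>" using maps p by simp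
      fix z assume z: "z \<in> Hs \<alpha>"
      let ?y = "adj_on (Hs \<beta>) (restrict S (Hs \<beta>)) z"
      have y: "?y \<in> Hs \<alpha>" using adj[OF \<beta>(1) z] .
      have zb: "z \<in> Hs \<beta>" using z Hs_mono[OF \<beta>(1)] by blast
      have "cinner (S x - S p) z = cinner x ?y - cinner p ?y"
        using H.cinner_adj_on[OF b \<beta>(2) zb] H.cinner_adj_on[OF b p(2) zb] \<beta>(2) p(2)
        by (simp add: cinner_diff_left)
      also have "\<dots> = 0" using H.orth_proj_cinner[OF y] by (simp add: p_def)
      finally show "cinner (S x - S p) z = 0" .
    qed
  qed
  moreover have "S \<in> \<D> \<rightarrow>\<^sub>E \<D>"
    using ext maps by (auto simp: PiE_def elim!: \<D>_E)
  ultimately show ?thesis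
    using b unfolding cstar_E_def by simp
qed

lemma
  assumes b: "\<And>\<alpha>. R \<alpha> \<in> bounded_ops (Hs \<alpha>)"
    and compat: "\<And>\<alpha> \<beta> x. \<alpha> \<le> \<beta> \<Longrightarrow> x \<in> Hs \<alpha> \<Longrightarrow> R \<beta> x = R \<alpha> x"
    and adj: "\<And>\<alpha> \<beta> x. \<alpha> \<le> \<beta> \<Longrightarrow> x \<in> Hs \<alpha> \<Longrightarrow> adj_on (Hs \<beta>) (R \<beta>) x \<in> Hs \<alpha>"
  shows proj_lim_in: "proj_lim Hs R \<in> cstar_E Hs"
    and proj_lim_restrict: "restrict (proj_lim Hs R) (Hs \<alpha>) = R \<alpha>"
proof -
  \<comment> \<open>Any index whose subspace contains x may be chosen: by directedness and
    compatibility the value does not depend on it.\<close>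
  define S where "S = (\<lambda>x\<in>\<D>. R (SOME \<alpha>. x \<in> Hs \<alpha>) x)"
  have S_apply: "S x = R \<alpha> x" if x: "x \<in> Hs \<alpha>" for \<alpha> x
  proof -
    define \<gamma> where "\<gamma> = (SOME \<alpha>. x \<in> Hs \<alpha>)"
    have \<gamma>: "x \<in> Hs \<gamma>" unfolding \<gamma>_def using x by (rule someI)
    obtain \<beta> where "\<alpha> \<le> \<beta>" "\<gamma> \<le> \<beta>" using directed by blast
    then have "R \<gamma> x = R \<alpha> x" using compat \<gamma> x by metis
    then show ?thesis using Hs_\<D>[OF x] by (simp add: S_def \<gamma>_def)
  qed
  have S_restrict: "restrict S (Hs \<alpha>) = R \<alpha>" for \<alpha>
    using S_apply H.bounded_ops_extensional[OF b] by (intro extensionalityI[of _ "Hs \<alpha>"]) auto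
  have S: "S \<in> cstar_E Hs"
  proof (rule cstar_E_I)
    show "S \<in> extensional \<D>" by (simp add: S_def)
  qed (use b adj in \<open>auto simp: S_restrict\<close>)
  have "proj_lim Hs R = S"
    unfolding proj_lim_def
  proof (rule the_equality)
    fix S' assume S': "S' \<in> cstar_E Hs \<and> (\<forall>\<alpha>. restrict S' (Hs \<alpha>) = R \<alpha>)"
    then have "restrict S' (Hs \<alpha>) = restrict S (Hs \<alpha>)" for \<alpha>
      by (simp only: S_restrict)
    with S' S show "S' = S" by (blast intro: cstar_E_eqI)
  qed (use S in \<open>auto simp: S_restrict\<close>)
  with S S_restrict show "proj_lim Hs R \<in> cstar_E Hs" "restrict (proj_lim Hs R) (Hs \<alpha>) = R \<alpha>"
    by auto
qed

section \<open>The involution on the algebra of the domain\<close>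

lemma nested: "\<alpha> \<le> \<beta> \<Longrightarrow> nested_subspaces (Hs \<alpha>) (Hs \<beta>)"
  by unfold_locales (rule Hs_mono)

text \<open>As \<open>T\<close> commutes with the projection onto Hs \<alpha>, pairing T u with x in
  Hs \<alpha> only sees the projection of u, so the adjoint on Hs \<beta> already takes its value in
  Hs \<alpha>.\<close>

lemma adj_on_compat:
  assumes T: "T \<in> cstar_E Hs" and "\<alpha> \<le> \<beta>" and x: "x \<in> Hs \<alpha>"
  shows "adj_on (Hs \<beta>) (restrict T (Hs \<beta>)) x = adj_on (Hs \<alpha>) (restrict T (Hs \<alpha>)) x"
proof -
  have sub: "y \<in> Hs \<beta>" if "y \<in> Hs \<alpha>" for y using that Hs_mono[OF \<open>\<alpha> \<le> \<beta>\<close>] by blast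
  let ?y = "adj_on (Hs \<alpha>) (restrict T (Hs \<alpha>)) x"
  have y: "?y \<in> Hs \<alpha>" using T x by simp
  show ?thesis
  proof (rule H.cinner_eqI[of _ \<beta>])
    fix u assume u: "u \<in> Hs \<beta>"
    let ?p = "orth_proj (Hs \<alpha>) u"
    have "cinner u (adj_on (Hs \<beta>) (restrict T (Hs \<beta>)) x) = cinner (T u) x"
      using H.cinner_adj_on[OF cstar_E_restrict[OF T] u sub[OF x]] u by simp
    also have "\<dots> = cinner (T ?p) x"
      using H.orth_proj_cinner[OF x, of "T u"] cstar_E_orth_proj[OF T, of u \<alpha>] u by auto
    also have "\<dots> = cinner ?p ?y"
      using H.cinner_adj_on[OF cstar_E_restrict[OF T] _ x, of ?p] by simp
    also have "\<dots> = cinner u ?y" using y by (rule H.orth_proj_cinner)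
    finally show "cinner u (adj_on (Hs \<beta>) (restrict T (Hs \<beta>)) x) = cinner u ?y" .
  qed (use T sub x y in auto)
qed

lemma
  assumes T: "T \<in> cstar_E Hs"
  shows star_E_in: "star_E Hs T \<in> cstar_E Hs"
    and star_E_restrict: "restrict (star_E Hs T) (Hs \<alpha>) = adj_on (Hs \<alpha>) (restrict T (Hs \<alpha>))"
proof -
  let ?R = "\<lambda>\<alpha>. adj_on (Hs \<alpha>) (restrict T (Hs \<alpha>))"
  have b: "?R \<alpha> \<in> bounded_ops (Hs \<alpha>)" for \<alpha> using T by simp
  have adj: "adj_on (Hs \<beta>) (?R \<beta>) x \<in> Hs \<alpha>" if "\<alpha> \<le> \<beta>" "x \<in> Hs \<alpha>" for \<alpha> \<beta> x
  proof -
    have "x \<in> Hs \<beta>" using that Hs_mono by blast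
    then show ?thesis using T that by simp
  qed
  show "star_E Hs T \<in> cstar_E Hs" "restrict (star_E Hs T) (Hs \<alpha>) = ?R \<alpha>"
    unfolding star_E_def
    by (rule proj_lim_in[of ?R] proj_lim_restrict[of ?R]; fact b adj adj_on_compat[OF T])+
qed

lemma star_E_apply:
  assumes "T \<in> cstar_E Hs" "x \<in> Hs \<alpha>"
  shows "star_E Hs T x = adj_on (Hs \<alpha>) (restrict T (Hs \<alpha>)) x"
  using fun_cong[OF star_E_restrict[OF assms(1), of \<alpha>], of x] assms(2) by simp

end

section \<open>Functional calculus of a normal operator on a quantized domain\<close>

locale normal_on_domain = quantized_domain Hs for Hs :: "'i::order \<Rightarrow> 'a::complex_hilbert_space set" +
  fixes T :: "'a \<Rightarrow> 'a"
  assumes T [simp]: "T \<in> cstar_E Hs" and normal_T: "normal_E Hs T"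
begin

abbreviation T\<alpha> where "T\<alpha> \<alpha> \<equiv> restrict T (Hs \<alpha>)"

lemma normal_apply: "x \<in> Hs \<alpha> \<Longrightarrow> T (star_E Hs T x) = star_E Hs T (T x)"
  using fun_cong[OF normal_T[unfolded normal_E_def], of x] by simp

sublocale N: normal_operator "Hs \<alpha>" "T\<alpha> \<alpha>" for \<alpha>
proof
  show "Hs \<alpha> \<noteq> {0}" by (rule Hs_nonzero)
  show "compose (Hs \<alpha>) (T\<alpha> \<alpha>) (adj_on (Hs \<alpha>) (T\<alpha> \<alpha>)) = compose (Hs \<alpha>) (adj_on (Hs \<alpha>) (T\<alpha> \<alpha>)) (T\<alpha> \<alpha>)"
  proof (rule extensionalityI[of _ "Hs \<alpha>"])
    fix x assume x: "x \<in> Hs \<alpha>"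
    then have "adj_on (Hs \<alpha>) (T\<alpha> \<alpha>) x \<in> Hs \<alpha>" "T x \<in> Hs \<alpha>" by simp_all
    with x show "compose (Hs \<alpha>) (T\<alpha> \<alpha>) (adj_on (Hs \<alpha>) (T\<alpha> \<alpha>)) x
        = compose (Hs \<alpha>) (adj_on (Hs \<alpha>) (T\<alpha> \<alpha>)) (T\<alpha> \<alpha>) x"
      using normal_apply[OF x] by (simp add: star_E_apply[OF T])
  qed auto
qed simp

section \<open>Local spectrum and its continuous functions\<close>

lemma spec_at_eq: "spec_at Hs T \<alpha> = approx_spectrum (Hs \<alpha>) (T\<alpha> \<alpha>)"
  by (simp add: spec_at_def N.op_spectrum_eq)

lemma spec_at_mono: "\<alpha> \<le> \<beta> \<Longrightarrow> spec_at Hs T \<alpha> \<subseteq> spec_at Hs T \<beta>"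
  unfolding spec_at_eq approx_spectrum_def using Hs_mono[of \<alpha> \<beta>] by (force simp: subset_iff)

text \<open>Two-sided inverses on nested subspaces agree by uniqueness. As z - T commutes with the
  projections, so does its inverse, and hence the adjoint of the inverse leaves the smaller subspace
  invariant, as gluing requires.\<close>

lemma inverse_compat:
  assumes S: "\<And>\<alpha>. S \<alpha> \<in> bounded_ops (Hs \<alpha>)"
    and left: "\<And>\<alpha> x. x \<in> Hs \<alpha> \<Longrightarrow> S \<alpha> (z *\<^sub>C x - T x) = x"
    and right: "\<And>\<alpha> x. x \<in> Hs \<alpha> \<Longrightarrow> z *\<^sub>C S \<alpha> x - T (S \<alpha> x) = x"
    and "\<alpha> \<le> \<beta>" "x \<in> Hs \<alpha>"
  shows "S \<beta> x = S \<alpha> x" "adj_on (Hs \<beta>) (S \<beta>) x \<in> Hs \<alpha>"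
proof -
  have sub: "y \<in> Hs \<beta>" if "y \<in> Hs \<alpha>" for y using that Hs_mono[OF \<open>\<alpha> \<le> \<beta>\<close>] by blast
  have S_in: "S \<alpha> y \<in> Hs \<alpha>" if "y \<in> Hs \<alpha>" for y using S that by simp
  have compat: "S \<beta> y = S \<alpha> y" if y: "y \<in> Hs \<alpha>" for y
    using left[OF sub[OF S_in[OF y]]] right[OF y] by simp
  then show "S \<beta> x = S \<alpha> x" using \<open>x \<in> Hs \<alpha>\<close> .
  have proj: "orth_proj (Hs \<alpha>) (S \<beta> y) = S \<beta> (orth_proj (Hs \<alpha>) y)" if y: "y \<in> Hs \<beta>" for y
  proof -
    let ?s = "S \<beta> y"
    have s: "?s \<in> Hs \<beta>" using S y by simp
    let ?p = "orth_proj (Hs \<alpha>) ?s"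
    have p: "z *\<^sub>C ?p - T ?p \<in> Hs \<alpha>" by simp
    \<comment> \<open>Project y = (z - T) (S y) and move the projection past \<open>T\<close>; the
      inverse on Hs \<beta> then gives the claim.\<close>
    have "orth_proj (Hs \<alpha>) y = z *\<^sub>C ?p - T ?p"
    proof (rule H.orth_proj_unique[OF p])
      fix u assume u: "u \<in> Hs \<alpha>"
      have "T ?p = orth_proj (Hs \<alpha>) (T ?s)"
        using cstar_E_orth_proj[OF T, of ?s \<alpha>] s by auto
      then have "cinner (z *\<^sub>C ?p - T ?p) u = cinner (z *\<^sub>C ?s - T ?s) u"
        using H.orth_proj_cinner[OF u] by (simp add: cinner_diff_left cinner_scaleC_left)
      then show "cinner (y - (z *\<^sub>C ?p - T ?p)) u = 0"
        using right[OF y] by (simp add: cinner_diff_left)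
    qed
    then show ?thesis using left[of ?p \<beta>] sub by simp
  qed
  let ?v = "adj_on (Hs \<beta>) (S \<beta>) x"
  have x\<beta>: "x \<in> Hs \<beta>" using \<open>x \<in> Hs \<alpha>\<close> sub by simp
  have "orth_proj (Hs \<alpha>) ?v = ?v"
  proof (rule H.cinner_eqI[of _ \<beta>])
    fix u assume u: "u \<in> Hs \<beta>"
    have "cinner u (orth_proj (Hs \<alpha>) ?v) = cinner (orth_proj (Hs \<alpha>) u) (orth_proj (Hs \<alpha>) ?v)"
      by (rule H.orth_proj_cinner[symmetric]) simp
    also have "\<dots> = cinner (orth_proj (Hs \<alpha>) u) ?v"
      using H.orth_proj_cinner[of "orth_proj (Hs \<alpha>) u" \<alpha> ?v] by (metis H.orth_proj_in cinner_commute)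
    also have "\<dots> = cinner (S \<beta> (orth_proj (Hs \<alpha>) u)) x"
      using H.cinner_adj_on[OF S _ x\<beta>, of "orth_proj (Hs \<alpha>) u"] sub by simp
    also have "\<dots> = cinner (S \<beta> u) x"
      using proj[OF u] H.orth_proj_cinner[OF \<open>x \<in> Hs \<alpha>\<close>, of "S \<beta> u"] by simp
    also have "\<dots> = cinner u ?v" by (rule H.cinner_adj_on[OF S u x\<beta>])
    finally show "cinner u (orth_proj (Hs \<alpha>) ?v) = cinner u ?v" .
  qed (use S x\<beta> sub in auto)
  then show "?v \<in> Hs \<alpha>" by (metis H.orth_proj_in)
qed

text \<open>Restricting an inverse gives local inverses; conversely local inverses, one for each
  index, glue by \<open>inverse_compat\<close> to an element of \<open>cstar_E\<close>.\<close>

lemma loc_spectrum_eq: "loc_spectrum Hs T = (\<Union>\<alpha>. spec_at Hs T \<alpha>)"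
proof -
  let ?B = "\<lambda>z. op_diff \<D> (op_scale \<D> z (op_id \<D>)) T"
  let ?B\<alpha> = "\<lambda>z \<alpha>. op_diff (Hs \<alpha>) (op_scale (Hs \<alpha>) z (op_id (Hs \<alpha>))) (T\<alpha> \<alpha>)"
  have "invertible_in \<D> (cstar_E Hs) (?B z) \<longleftrightarrow>
    (\<forall>\<alpha>. invertible_in (Hs \<alpha>) (bounded_ops (Hs \<alpha>)) (?B\<alpha> z \<alpha>))" for z
  proof
    assume "invertible_in \<D> (cstar_E Hs) (?B z)"
    then obtain S where S: "S \<in> cstar_E Hs"
      "compose \<D> S (?B z) = op_id \<D>" "compose \<D> (?B z) S = op_id \<D>"
      unfolding invertible_in_def by blast
    show "\<forall>\<alpha>. invertible_in (Hs \<alpha>) (bounded_ops (Hs \<alpha>)) (?B\<alpha> z \<alpha>)"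
    proof
      fix \<alpha>
      have "compose (Hs \<alpha>) (restrict S (Hs \<alpha>)) (?B\<alpha> z \<alpha>) x = op_id (Hs \<alpha>) x"
        "compose (Hs \<alpha>) (?B\<alpha> z \<alpha>) (restrict S (Hs \<alpha>)) x = op_id (Hs \<alpha>) x"
        if x: "x \<in> Hs \<alpha>" for x
      proof -
        have "S x \<in> Hs \<alpha>" using S(1) x by simp
        then show "compose (Hs \<alpha>) (restrict S (Hs \<alpha>)) (?B\<alpha> z \<alpha>) x = op_id (Hs \<alpha>) x"
          "compose (Hs \<alpha>) (?B\<alpha> z \<alpha>) (restrict S (Hs \<alpha>)) x = op_id (Hs \<alpha>) x"
          using fun_cong[OF S(2), of x] fun_cong[OF S(3), of x] x by simp_all
      qed
      then have "compose (Hs \<alpha>) (restrict S (Hs \<alpha>)) (?B\<alpha> z \<alpha>) = op_id (Hs \<alpha>)"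
        "compose (Hs \<alpha>) (?B\<alpha> z \<alpha>) (restrict S (Hs \<alpha>)) = op_id (Hs \<alpha>)"
        by (auto intro: extensionalityI[of _ "Hs \<alpha>"])
      then show "invertible_in (Hs \<alpha>) (bounded_ops (Hs \<alpha>)) (?B\<alpha> z \<alpha>)"
        unfolding invertible_in_def using cstar_E_restrict[OF S(1)] by blast
    qed
  next
    assume "\<forall>\<alpha>. invertible_in (Hs \<alpha>) (bounded_ops (Hs \<alpha>)) (?B\<alpha> z \<alpha>)"
    then have "\<forall>\<alpha>. \<exists>S. S \<in> bounded_ops (Hs \<alpha>) \<and> compose (Hs \<alpha>) S (?B\<alpha> z \<alpha>) = op_id (Hs \<alpha>)
        \<and> compose (Hs \<alpha>) (?B\<alpha> z \<alpha>) S = op_id (Hs \<alpha>)"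
      unfolding invertible_in_def by blast
    from choice[OF this] obtain S where S: "\<forall>\<alpha>. S \<alpha> \<in> bounded_ops (Hs \<alpha>)
        \<and> compose (Hs \<alpha>) (S \<alpha>) (?B\<alpha> z \<alpha>) = op_id (Hs \<alpha>)
        \<and> compose (Hs \<alpha>) (?B\<alpha> z \<alpha>) (S \<alpha>) = op_id (Hs \<alpha>)" ..
    then have Sb: "S \<alpha> \<in> bounded_ops (Hs \<alpha>)" for \<alpha> by blast
    have left: "S \<alpha> (z *\<^sub>C x - T x) = x" and right: "z *\<^sub>C S \<alpha> x - T (S \<alpha> x) = x" if x: "x \<in> Hs \<alpha>" for \<alpha> x
    proof -
      have "compose (Hs \<alpha>) (S \<alpha>) (?B\<alpha> z \<alpha>) x = op_id (Hs \<alpha>) x"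
        "compose (Hs \<alpha>) (?B\<alpha> z \<alpha>) (S \<alpha>) x = op_id (Hs \<alpha>) x" using S by auto
      then show "S \<alpha> (z *\<^sub>C x - T x) = x" "z *\<^sub>C S \<alpha> x - T (S \<alpha> x) = x" using x Sb by simp_all
    qed
    note compat = inverse_compat[of S z, OF Sb left right]
    have U: "proj_lim Hs S \<in> cstar_E Hs" "restrict (proj_lim Hs S) (Hs \<alpha>) = S \<alpha>" for \<alpha>
      by (rule proj_lim_in[of S, OF Sb compat] proj_lim_restrict[of S, OF Sb compat]; assumption)+
    have U_apply: "proj_lim Hs S x = S \<alpha> x" if "x \<in> Hs \<alpha>" for \<alpha> x
      using fun_cong[OF U(2), of \<alpha> x] that by simp
    have "compose \<D> (proj_lim Hs S) (?B z) = op_id \<D>" "compose \<D> (?B z) (proj_lim Hs S) = op_id \<D>"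
    proof (rule_tac [!] \<D>_eqI)
      fix \<alpha> x assume x: "x \<in> Hs \<alpha>"
      then have y: "z *\<^sub>C x - T x \<in> Hs \<alpha>" "S \<alpha> x \<in> Hs \<alpha>" using Sb by simp_all
      with x show "compose \<D> (proj_lim Hs S) (?B z) x = op_id \<D> x"
        "compose \<D> (?B z) (proj_lim Hs S) x = op_id \<D> x"
        using left[OF x] right[OF x] by (simp_all add: U_apply[OF x] U_apply[OF y(1)])
    qed auto
    then show "invertible_in \<D> (cstar_E Hs) (?B z)"
      unfolding invertible_in_def using U(1) by blast
  qed
  then show ?thesis
    by (auto simp: loc_spectrum_def spec_at_def op_spectrum_def spectrum_in_def)
qed

text \<open>A set is open in the inductive limit topology when its traces on all
  \<open>spec_at\<close> are, so preimages of open sets are tested level by level.\<close>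

lemma C_loc_iff:
  "f \<in> C_loc Hs T \<longleftrightarrow> f \<in> extensional (loc_spectrum Hs T) \<and> (\<forall>\<alpha>. continuous_on (spec_at Hs T \<alpha>) f)"
proof -
  let ?X = "loc_spectrum_topology Hs T" and ?L = "loc_spectrum Hs T"
  have sub: "spec_at Hs T \<alpha> \<subseteq> ?L" for \<alpha> by (auto simp: loc_spectrum_eq)
  then have "openin ?X ?L"
    by (simp add: openin_loc_spectrum_topology Int_absorb1)
  then have top: "topspace ?X = ?L"
    by (metis openin_loc_spectrum_topology openin_subset openin_topspace subset_antisym)
  have *: "{x \<in> ?L. f x \<in> U} \<inter> spec_at Hs T \<alpha> = spec_at Hs T \<alpha> \<inter> f -` U" for U \<alpha>
    using sub by blast
  have "continuous_map ?X euclidean f \<longleftrightarrow>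
    (\<forall>U. open U \<longrightarrow> (\<forall>\<alpha>. openin (top_of_set (spec_at Hs T \<alpha>)) (spec_at Hs T \<alpha> \<inter> f -` U)))"
    by (simp add: continuous_map_def top openin_loc_spectrum_topology * flip: open_openin)
  then show ?thesis
    by (auto simp: C_loc_def continuous_openin_preimage_eq)
qed

lemma C_loc_restrict:
  assumes "f \<in> C_loc Hs T"
  shows "restrict f (spec_at Hs T \<alpha>) \<in> C_on (approx_spectrum (Hs \<alpha>) (T\<alpha> \<alpha>))"
  using assms by (auto simp: C_loc_iff C_on_def spec_at_eq)

lemma C_loc_I:
  assumes "\<And>\<alpha>. continuous_on (spec_at Hs T \<alpha>) f"
  shows "restrict f (loc_spectrum Hs T) \<in> C_loc Hs T"
  unfolding C_loc_iff
proof (intro conjI allI)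
  show "continuous_on (spec_at Hs T \<alpha>) (restrict f (loc_spectrum Hs T))" for \<alpha>
    using assms[of \<alpha>] by (rule continuous_on_eq) (auto simp: loc_spectrum_eq)
qed simp

lemma restrict_spec_at: "restrict (restrict f (loc_spectrum Hs T)) (spec_at Hs T \<alpha>) = restrict f (spec_at Hs T \<alpha>)"
  by (rule extensionalityI[of _ "spec_at Hs T \<alpha>"]) (auto simp: loc_spectrum_eq)

text \<open>The generators are reduced by Hs \<alpha> and restrict to the generators there;
  \<open>cstar_subalgebra_reducing\<close> passes this on to the generated algebra.\<close>

lemma cstar_gen_reduce:
  assumes "\<alpha> \<le> \<beta>" and R: "R \<in> cstar_gen (Hs \<beta>) (T\<alpha> \<beta>)"
  shows "x \<in> Hs \<alpha> \<Longrightarrow> adj_on (Hs \<beta>) R x \<in> Hs \<alpha>"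
    and "restrict R (Hs \<alpha>) \<in> cstar_gen (Hs \<alpha>) (T\<alpha> \<alpha>)"
proof -
  interpret nested_subspaces "Hs \<alpha>" "Hs \<beta>" using \<open>\<alpha> \<le> \<beta>\<close> by (rule nested)
  let ?\<A> = "cstar_gen (Hs \<alpha>) (T\<alpha> \<alpha>)"
  have [simp]: "x \<in> Hs \<beta>" if "x \<in> Hs \<alpha>" for x using that subset by blast
  have adj: "adj_on (Hs \<beta>) (T\<alpha> \<beta>) x = adj_on (Hs \<alpha>) (T\<alpha> \<alpha>) x" if "x \<in> Hs \<alpha>" for x
    using T \<open>\<alpha> \<le> \<beta>\<close> that by (rule adj_on_compat)
  have "restrict (adj_on (Hs \<beta>) (T\<alpha> \<beta>)) (Hs \<alpha>) = adj_on (Hs \<alpha>) (T\<alpha> \<alpha>)"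
    by (rule extensionalityI[of _ "Hs \<alpha>"]) (auto simp: adj H.bounded_ops_extensional)
  moreover have "restrict (op_id (Hs \<beta>)) (Hs \<alpha>) = op_id (Hs \<alpha>)"
    by (rule extensionalityI[of _ "Hs \<alpha>"]) auto
  ultimately have "R \<in> {R \<in> bounded_ops (Hs \<beta>).
    (\<forall>x\<in>Hs \<alpha>. R x \<in> Hs \<alpha> \<and> adj_on (Hs \<beta>) R x \<in> Hs \<alpha>) \<and> restrict R (Hs \<alpha>) \<in> ?\<A>}"
    by (intro H.cstar_gen_induct[OF R] cstar_subalgebra_reducing N.\<A>_subalgebra)
       (auto simp: adj Int_absorb1[OF subset])
  then show "x \<in> Hs \<alpha> \<Longrightarrow> adj_on (Hs \<beta>) R x \<in> Hs \<alpha>" "restrict R (Hs \<alpha>) \<in> ?\<A>" by auto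
qed

lemma approx_value_restrict:
  assumes "\<alpha> \<le> \<beta>" "approx_value (Hs \<beta>) (T\<alpha> \<beta>) z R w"
  shows "approx_value (Hs \<alpha>) (T\<alpha> \<alpha>) z (restrict R (Hs \<alpha>)) w"
proof -
  have "approx_value (Hs \<alpha>) (T\<alpha> \<beta>) z R w"
    using assms(2) Hs_mono[OF assms(1)] by (rule approx_value_mono)
  then show ?thesis
    using Hs_mono[OF assms(1)] by (subst approx_value_cong[where A' = "T\<alpha> \<beta>" and R' = R]) auto
qed

section \<open>The functional calculus on the domain\<close>

abbreviation calc where
  "calc f \<alpha> \<equiv> gelfand_inv (Hs \<alpha>) (T\<alpha> \<alpha>) (restrict f (spec_at Hs T \<alpha>))"

text \<open>A value on Hs \<beta> is a value of the restriction on Hs \<alpha>, so the restricted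
  operator has the values of \<open>f\<close> on the smaller spectrum and
  \<open>gelfand_inv_eqI\<close> identifies it.\<close>

lemma calc_compat:
  assumes f: "f \<in> C_loc Hs T" and "\<alpha> \<le> \<beta>"
  shows "calc f \<alpha> = restrict (calc f \<beta>) (Hs \<alpha>)"
proof (rule N.gelfand_inv_eqI)
  note R = N.gelfand_inv_in[OF C_loc_restrict[OF f, of \<beta>]]
  show "restrict (calc f \<beta>) (Hs \<alpha>) \<in> cstar_gen (Hs \<alpha>) (T\<alpha> \<alpha>)"
    using \<open>\<alpha> \<le> \<beta>\<close> R by (rule cstar_gen_reduce)
  fix z assume z: "z \<in> approx_spectrum (Hs \<alpha>) (T\<alpha> \<alpha>)"
  then have z\<beta>: "z \<in> approx_spectrum (Hs \<beta>) (T\<alpha> \<beta>)"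
    using spec_at_mono[OF \<open>\<alpha> \<le> \<beta>\<close>] by (auto simp: spec_at_eq)
  show "approx_value (Hs \<alpha>) (T\<alpha> \<alpha>) z (restrict (calc f \<beta>) (Hs \<alpha>)) (restrict f (spec_at Hs T \<alpha>) z)"
    using approx_value_restrict[OF \<open>\<alpha> \<le> \<beta>\<close> N.approx_value_gelfand_inv[OF C_loc_restrict[OF f] z\<beta>]] z z\<beta>
    by (simp add: spec_at_eq)
qed (simp add: spec_at_eq)

lemma
  assumes f: "f \<in> C_loc Hs T"
  shows func_calc_in: "func_calc Hs T f \<in> cstar_E Hs"
    and func_calc_restrict: "restrict (func_calc Hs T f) (Hs \<alpha>) = calc f \<alpha>"
proof -
  note R = N.gelfand_inv_in[OF C_loc_restrict[OF f]]
  have b: "calc f \<alpha> \<in> bounded_ops (Hs \<alpha>)" for \<alpha> using R by blast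
  have compat: "calc f \<beta> x = calc f \<alpha> x" if "\<alpha> \<le> \<beta>" "x \<in> Hs \<alpha>" for \<alpha> \<beta> x
    using calc_compat[OF f that(1)] that(2) by simp
  have adj: "adj_on (Hs \<beta>) (calc f \<beta>) x \<in> Hs \<alpha>" if "\<alpha> \<le> \<beta>" "x \<in> Hs \<alpha>" for \<alpha> \<beta> x
    using that(1) R that(2) by (rule cstar_gen_reduce)
  show "func_calc Hs T f \<in> cstar_E Hs" "restrict (func_calc Hs T f) (Hs \<alpha>) = calc f \<alpha>"
    unfolding func_calc_def
    by (rule proj_lim_in[of "calc f"] proj_lim_restrict[of "calc f"]; fact b compat adj)+
qed

lemma func_calc_apply:
  assumes "f \<in> C_loc Hs T" "x \<in> Hs \<alpha>"
  shows "func_calc Hs T f x = calc f \<alpha> x"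
  using fun_cong[OF func_calc_restrict[OF assms(1), of \<alpha>], of x] assms(2) by simp

lemma func_calc_in_A_alg: "f \<in> C_loc Hs T \<Longrightarrow> func_calc Hs T f \<in> A_alg Hs T"
  by (simp add: A_alg_def func_calc_in func_calc_restrict N.gelfand_inv_in C_loc_restrict)

text \<open>Identities on the domain are checked on one subspace at a time, where they are those of
  \<open>gelfand_inv_star_hom\<close>.\<close>

lemma func_calc_star_hom:
  "star_hom (loc_spectrum Hs T) (C_loc Hs T) \<D> (A_alg Hs T) (star_E Hs) (func_calc Hs T)"
proof -
  let ?L = "loc_spectrum Hs T"
  note hom = N.gelfand_inv_star_hom[unfolded star_hom_def linear_fun_op_def]
  have ext [simp]: "func_calc Hs T f \<in> extensional \<D>" if "f \<in> C_loc Hs T" for f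
    using func_calc_in[OF that] by (rule cstar_E_extensional)
  have cont: "continuous_on (spec_at Hs T \<alpha>) f" if "f \<in> C_loc Hs T" for f \<alpha>
    using that by (simp add: C_loc_iff)
  have calc_in: "calc f \<alpha> x \<in> Hs \<alpha>" if "f \<in> C_loc Hs T" "x \<in> Hs \<alpha>" for f \<alpha> x
    using func_calc_in[OF that(1)] func_calc_apply[OF that] that(2) by (metis cstar_E_in)
  show ?thesis
    unfolding star_hom_def linear_fun_op_def
  proof (intro conjI ballI allI)
    show "func_calc Hs T \<in> C_loc Hs T \<rightarrow> A_alg Hs T" using func_calc_in_A_alg by blast
  next
    fix f g assume f: "f \<in> C_loc Hs T" and g: "g \<in> C_loc Hs T"
    have fg: "(\<lambda>z\<in>?L. f z + g z) \<in> C_loc Hs T"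
      using f g by (intro C_loc_I continuous_intros cont)
    show "func_calc Hs T (\<lambda>z\<in>?L. f z + g z) = op_add \<D> (func_calc Hs T f) (func_calc Hs T g)"
    proof (rule \<D>_eqI)
      fix \<alpha> x assume x: "x \<in> Hs \<alpha>"
      have "restrict (\<lambda>z\<in>?L. f z + g z) (spec_at Hs T \<alpha>)
          = (\<lambda>z\<in>N.\<sigma> \<alpha>. restrict f (spec_at Hs T \<alpha>) z + restrict g (spec_at Hs T \<alpha>) z)"
        unfolding restrict_spec_at unfolding spec_at_eq by (rule restrict_ext) simp
      then have "calc (\<lambda>z\<in>?L. f z + g z) \<alpha> = op_add (Hs \<alpha>) (calc f \<alpha>) (calc g \<alpha>)"
        using hom[of \<alpha>] C_loc_restrict[OF f, of \<alpha>] C_loc_restrict[OF g, of \<alpha>]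
        by (simp only:)
      then show "func_calc Hs T (\<lambda>z\<in>?L. f z + g z) x = op_add \<D> (func_calc Hs T f) (func_calc Hs T g) x"
        using x f g fg by (simp add: func_calc_apply)
    qed (use fg in auto)
    have fg: "(\<lambda>z\<in>?L. f z * g z) \<in> C_loc Hs T"
      using f g by (intro C_loc_I continuous_intros cont)
    show "func_calc Hs T (\<lambda>z\<in>?L. f z * g z) = compose \<D> (func_calc Hs T f) (func_calc Hs T g)"
    proof (rule \<D>_eqI)
      fix \<alpha> x assume x: "x \<in> Hs \<alpha>"
      have "restrict (\<lambda>z\<in>?L. f z * g z) (spec_at Hs T \<alpha>)
          = (\<lambda>z\<in>N.\<sigma> \<alpha>. restrict f (spec_at Hs T \<alpha>) z * restrict g (spec_at Hs T \<alpha>) z)"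
        unfolding restrict_spec_at unfolding spec_at_eq by (rule restrict_ext) simp
      then have "calc (\<lambda>z\<in>?L. f z * g z) \<alpha> = compose (Hs \<alpha>) (calc f \<alpha>) (calc g \<alpha>)"
        using hom[of \<alpha>] C_loc_restrict[OF f, of \<alpha>] C_loc_restrict[OF g, of \<alpha>]
        by (simp only:)
      then show "func_calc Hs T (\<lambda>z\<in>?L. f z * g z) x = compose \<D> (func_calc Hs T f) (func_calc Hs T g) x"
        using x f g fg calc_in[OF g x] by (simp add: func_calc_apply)
    qed (use fg in auto)
  next
    fix c f assume f: "f \<in> C_loc Hs T"
    have cf: "(\<lambda>z\<in>?L. c * f z) \<in> C_loc Hs T"
      using f by (intro C_loc_I continuous_intros cont)
    show "func_calc Hs T (\<lambda>z\<in>?L. c * f z) = op_scale \<D> c (func_calc Hs T f)"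
    proof (rule \<D>_eqI)
      fix \<alpha> x assume x: "x \<in> Hs \<alpha>"
      have "restrict (\<lambda>z\<in>?L. c * f z) (spec_at Hs T \<alpha>)
          = (\<lambda>z\<in>N.\<sigma> \<alpha>. c * restrict f (spec_at Hs T \<alpha>) z)"
        unfolding restrict_spec_at unfolding spec_at_eq by (rule restrict_ext) simp
      then have "calc (\<lambda>z\<in>?L. c * f z) \<alpha> = op_scale (Hs \<alpha>) c (calc f \<alpha>)"
        using hom[of \<alpha>] C_loc_restrict[OF f, of \<alpha>]
        by (simp only:)
      then show "func_calc Hs T (\<lambda>z\<in>?L. c * f z) x = op_scale \<D> c (func_calc Hs T f) x"
        using x f cf by (simp add: func_calc_apply)
    qed (use cf in auto)
  next
    fix f assume f: "f \<in> C_loc Hs T"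
    have cf: "(\<lambda>z\<in>?L. cnj (f z)) \<in> C_loc Hs T"
      using f by (intro C_loc_I continuous_intros cont)
    show "func_calc Hs T (\<lambda>z\<in>?L. cnj (f z)) = star_E Hs (func_calc Hs T f)"
    \<comment> \<open>The involution on the domain is known through its restrictions, so the two
      sides are compared as restricted operators instead of vector by vector.\<close>
    proof (rule cstar_E_eqI[OF func_calc_in[OF cf] star_E_in[OF func_calc_in[OF f]]])
      fix \<alpha>
      have "restrict (\<lambda>z\<in>?L. cnj (f z)) (spec_at Hs T \<alpha>)
          = (\<lambda>z\<in>N.\<sigma> \<alpha>. cnj (restrict f (spec_at Hs T \<alpha>) z))"
        unfolding restrict_spec_at unfolding spec_at_eq by (rule restrict_ext) simp
      then have "calc (\<lambda>z\<in>?L. cnj (f z)) \<alpha> = adj_on (Hs \<alpha>) (calc f \<alpha>)"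
        using hom[of \<alpha>] C_loc_restrict[OF f, of \<alpha>]
        by (simp only:)
      then show "restrict (func_calc Hs T (\<lambda>z\<in>?L. cnj (f z))) (Hs \<alpha>)
          = restrict (star_E Hs (func_calc Hs T f)) (Hs \<alpha>)"
        by (simp add: star_E_restrict func_calc_in f cf func_calc_restrict)
    qed
  qed
qed

lemma func_calc_coherent: "coherent Hs T (func_calc Hs T)"
  unfolding coherent_def
proof (intro exI[of _ "\<lambda>\<alpha>. gelfand_inv (Hs \<alpha>) (T\<alpha> \<alpha>)"] allI conjI ballI)
  show "linear_fun_op (spec_at Hs T \<alpha>) (C_on (spec_at Hs T \<alpha>)) (Hs \<alpha>) (cstar_gen (Hs \<alpha>) (T\<alpha> \<alpha>))
      (gelfand_inv (Hs \<alpha>) (T\<alpha> \<alpha>))" for \<alpha>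
    using N.gelfand_inv_star_hom[of \<alpha>] by (simp add: star_hom_def spec_at_eq)
qed (rule func_calc_restrict)

lemma func_calc_isometric: "local_isometric Hs T (func_calc Hs T)"
  unfolding local_isometric_def
  using N.op_norm_gelfand_inv[OF C_loc_restrict] by (simp add: func_calc_restrict spec_at_eq)

text \<open>Index by index the polynomial operator has the values of the polynomial function, so
  both sides are projective limits of the same family.\<close>

lemma func_calc_poly2:
  shows "(\<lambda>z\<in>loc_spectrum Hs T. poly2 P z (cnj z)) \<in> C_loc Hs T"
    and "func_calc Hs T (\<lambda>z\<in>loc_spectrum Hs T. poly2 P z (cnj z)) =
      proj_lim Hs (\<lambda>\<alpha>. op_poly2 (Hs \<alpha>) P (T\<alpha> \<alpha>) (adj_on (Hs \<alpha>) (T\<alpha> \<alpha>)))"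
proof -
  show "(\<lambda>z\<in>loc_spectrum Hs T. poly2 P z (cnj z)) \<in> C_loc Hs T"
    unfolding poly2_def by (intro C_loc_I continuous_intros)
  have "calc (\<lambda>z\<in>loc_spectrum Hs T. poly2 P z (cnj z)) \<alpha>
      = op_poly2 (Hs \<alpha>) P (T\<alpha> \<alpha>) (adj_on (Hs \<alpha>) (T\<alpha> \<alpha>))" for \<alpha>
    unfolding restrict_spec_at
    by (rule N.gelfand_inv_eqI) (auto simp: spec_at_eq N.op_poly2_gelfand)
  then show "func_calc Hs T (\<lambda>z\<in>loc_spectrum Hs T. poly2 P z (cnj z)) =
      proj_lim Hs (\<lambda>\<alpha>. op_poly2 (Hs \<alpha>) P (T\<alpha> \<alpha>) (adj_on (Hs \<alpha>) (T\<alpha> \<alpha>)))"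
    by (simp only: func_calc_def)
qed

lemma func_calc_id:
  shows "(\<lambda>z\<in>loc_spectrum Hs T. z) \<in> C_loc Hs T"
    and "func_calc Hs T (\<lambda>z\<in>loc_spectrum Hs T. z) = T"
proof -
  show id: "(\<lambda>z\<in>loc_spectrum Hs T. z) \<in> C_loc Hs T"
    by (intro C_loc_I continuous_intros)
  show "func_calc Hs T (\<lambda>z\<in>loc_spectrum Hs T. z) = T"
  proof (rule cstar_E_eqI[OF func_calc_in[OF id] T])
    fix \<alpha>
    show "restrict (func_calc Hs T (\<lambda>z\<in>loc_spectrum Hs T. z)) (Hs \<alpha>) = T\<alpha> \<alpha>"
      unfolding func_calc_restrict[OF id] restrict_spec_at
      by (rule N.gelfand_inv_eqI) (auto simp: spec_at_eq H.approx_value_self)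
  qed
qed

lemma selfadjoint_E_iff: "selfadjoint_E Hs T \<longleftrightarrow> loc_spectrum Hs T \<subseteq> \<real>"
proof -
  have "selfadjoint_E Hs T \<longleftrightarrow> (\<forall>\<alpha>. adj_on (Hs \<alpha>) (T\<alpha> \<alpha>) = T\<alpha> \<alpha>)"
    unfolding selfadjoint_E_def
    by (metis T cstar_E_eqI star_E_in star_E_restrict)
  then show ?thesis
    by (auto simp: N.selfadjoint_iff loc_spectrum_eq spec_at_eq)
qed

lemma unitary_E_iff: "unitary_E Hs T \<longleftrightarrow> loc_spectrum Hs T \<subseteq> sphere 0 1"
proof -
  \<comment> \<open>For normal \<open>T\<close> the two equations in \<open>unitary_E\<close>
    coincide.\<close>
  have "unitary_E Hs T \<longleftrightarrow> compose \<D> T (star_E Hs T) = op_id \<D>"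
    using normal_T unfolding unitary_E_def normal_E_def by metis
  also have "\<dots> \<longleftrightarrow> (\<forall>\<alpha>. \<forall>x\<in>Hs \<alpha>. T (star_E Hs T x) = x)"
  proof
    assume *: "compose \<D> T (star_E Hs T) = op_id \<D>"
    show "\<forall>\<alpha>. \<forall>x\<in>Hs \<alpha>. T (star_E Hs T x) = x"
    proof (intro allI ballI)
      fix \<alpha> x assume "x \<in> Hs \<alpha>"
      then show "T (star_E Hs T x) = x" using fun_cong[OF *, of x] by simp
    qed
  qed (auto intro!: \<D>_eqI)
  also have "\<dots> \<longleftrightarrow> (\<forall>\<alpha>. compose (Hs \<alpha>) (T\<alpha> \<alpha>) (adj_on (Hs \<alpha>) (T\<alpha> \<alpha>)) = op_id (Hs \<alpha>))"
  proof (intro iff_allI iffI ballI)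
    fix \<alpha>
    show "compose (Hs \<alpha>) (T\<alpha> \<alpha>) (adj_on (Hs \<alpha>) (T\<alpha> \<alpha>)) = op_id (Hs \<alpha>)"
      if "\<forall>x\<in>Hs \<alpha>. T (star_E Hs T x) = x"
      using that by (intro extensionalityI[of _ "Hs \<alpha>"]) (auto simp: star_E_apply)
    show "T (star_E Hs T x) = x"
      if "compose (Hs \<alpha>) (T\<alpha> \<alpha>) (adj_on (Hs \<alpha>) (T\<alpha> \<alpha>)) = op_id (Hs \<alpha>)" "x \<in> Hs \<alpha>" for x
      using fun_cong[OF that(1), of x] that(2) by (simp add: star_E_apply)
  qed
  finally show ?thesis
    by (auto simp: N.unitary_iff loc_spectrum_eq spec_at_eq)
qed

end

theorem theorem3p14:
  fixes Hs :: "'i::order \<Rightarrow> 'a::complex_hilbert_space set"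
    and T :: "'a \<Rightarrow> 'a"
  assumes "quantized_domain Hs"
    and "T \<in> cstar_E Hs"
    and "normal_E Hs T"
  shows "star_hom (loc_spectrum Hs T) (C_loc Hs T) (dom_E Hs) (A_alg Hs T) (star_E Hs)
           (func_calc Hs T) \<and>
         coherent Hs T (func_calc Hs T) \<and>
         local_isometric Hs T (func_calc Hs T) \<and>
         (\<forall>P. (\<lambda>z\<in>loc_spectrum Hs T. poly2 P z (cnj z)) \<in> C_loc Hs T \<and>
           func_calc Hs T (\<lambda>z\<in>loc_spectrum Hs T. poly2 P z (cnj z)) =
           proj_lim Hs (\<lambda>\<alpha>. op_poly2 (Hs \<alpha>) P (restrict T (Hs \<alpha>))
             (adj_on (Hs \<alpha>) (restrict T (Hs \<alpha>))))) \<and>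
         (\<lambda>z\<in>loc_spectrum Hs T. z) \<in> C_loc Hs T \<and>
         func_calc Hs T (\<lambda>z\<in>loc_spectrum Hs T. z) = T \<and>
         (selfadjoint_E Hs T \<longleftrightarrow> loc_spectrum Hs T \<subseteq> \<real>) \<and>
         (unitary_E Hs T \<longleftrightarrow> loc_spectrum Hs T \<subseteq> frontier {z. cmod z < 1})"
proof -
  interpret normal_on_domain Hs T
    using assms by (simp add: normal_on_domain_def normal_on_domain_axioms_def)
  have "{z. cmod z < 1} = ball 0 1" by auto
  then have "frontier {z. cmod z < 1} = sphere 0 1" by simp
  then show ?thesis
    using func_calc_star_hom func_calc_coherent func_calc_isometric func_calc_poly2 func_calc_id
      selfadjoint_E_iff unitary_E_iff by simp
qed

end
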